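(* Let $(S,\mathfrak m)$ be a regular local ring of dimension three containing a field, let $I$ be an $\mathfrak m$-primary ideal of $S$ such that $S/I$ is Gorenstein, and let $d=\mu(I)-3$ be its deviation. Then $\mathfrak m^{d}\not\subset I$.
   Context: $\mu(I)$ denotes the minimal number of generators of $I$. The convention is $\mathfrak m^0=S$. *)

theory Defs
  imports "HOL-Algebra.Algebra" "HOL-Library.Extended_Nat"
begin

text \<open>The rings are the commutative rings with \<^const>\<open>carrier\<close> of HOL-Algebra. Powers of an ideal are
  taken in the monoid \<^const>\<open>ideals_set\<close>, whose unit is the whole ring; so the zeroth power of an
  ideal is the whole ring.\<close>

section \<open>Local rings, Krull dimension, regularity\<close>

definition local_ring :: "('a, 'b) ring_scheme \<Rightarrow> 'a set \<Rightarrow> bool" where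
  "local_ring R \<mm> \<longleftrightarrow> cring R \<and> maximalideal \<mm> R \<and> (\<forall>\<nn>. maximalideal \<nn> R \<longrightarrow> \<nn> = \<mm>)"

definition noetherian_local_ring :: "('a, 'b) ring_scheme \<Rightarrow> 'a set \<Rightarrow> bool" where
  "noetherian_local_ring R \<mm> \<longleftrightarrow> local_ring R \<mm> \<and> noetherian_ring R"

definition krull_dim :: "('a, 'b) ring_scheme \<Rightarrow> enat" where
  "krull_dim R = Sup {enat n | n. \<exists>P :: nat \<Rightarrow> 'a set.
     (\<forall>i\<le>n. primeideal (P i) R) \<and> (\<forall>i<n. P i \<subset> P (Suc i))}"

text \<open>The minimal number of generators; only meaningful for finitely generated ideals.\<close>

definition min_gens :: "('a, 'b) ring_scheme \<Rightarrow> 'a set \<Rightarrow> nat" where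
  "min_gens R I = (LEAST n. \<exists>A. A \<subseteq> carrier R \<and> finite A \<and> card A = n \<and> I = Idl\<^bsub>R\<^esub> A)"

definition regular_local_ring :: "('a, 'b) ring_scheme \<Rightarrow> 'a set \<Rightarrow> bool" where
  "regular_local_ring R \<mm> \<longleftrightarrow>
     noetherian_local_ring R \<mm> \<and> krull_dim R = enat (min_gens R \<mm>)"

definition contains_field :: "('a, 'b) ring_scheme \<Rightarrow> bool" where
  "contains_field R \<longleftrightarrow> (\<exists>K. subfield K R)"


section \<open>Primary ideals\<close>

definition radical :: "('a, 'b) ring_scheme \<Rightarrow> 'a set \<Rightarrow> 'a set" where
  "radical R I = {a \<in> carrier R. \<exists>n::nat. a [^]\<^bsub>R\<^esub> n \<in> I}"

definition primary_ideal :: "('a, 'b) ring_scheme \<Rightarrow> 'a set \<Rightarrow> bool" where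
  "primary_ideal R Q \<longleftrightarrow> ideal Q R \<and> Q \<noteq> carrier R \<and>
     (\<forall>a\<in>carrier R. \<forall>b\<in>carrier R. a \<otimes>\<^bsub>R\<^esub> b \<in> Q \<longrightarrow> a \<in> Q \<or> b \<in> radical R Q)"

definition primary_to :: "('a, 'b) ring_scheme \<Rightarrow> 'a set \<Rightarrow> 'a set \<Rightarrow> bool" where
  "primary_to R P Q \<longleftrightarrow> primary_ideal R Q \<and> radical R Q = P"


section \<open>Injective dimension and Gorenstein rings\<close>

definition mod_hom ::
  "('r, 's) ring_scheme \<Rightarrow> ('r, 'm, 'u) module_scheme \<Rightarrow> ('r, 'n, 'v) module_scheme \<Rightarrow> ('m \<Rightarrow> 'n) set"
where
  "mod_hom R M N = {f. f \<in> carrier M \<rightarrow> carrier N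
     \<and> (\<forall>x\<in>carrier M. \<forall>y\<in>carrier M. f (x \<oplus>\<^bsub>M\<^esub> y) = f x \<oplus>\<^bsub>N\<^esub> f y)
     \<and> (\<forall>r\<in>carrier R. \<forall>x\<in>carrier M. f (r \<odot>\<^bsub>M\<^esub> x) = r \<odot>\<^bsub>N\<^esub> f x)}"

definition mod_ker ::
  "('r, 'm, 'u) module_scheme \<Rightarrow> ('r, 'n, 'v) module_scheme \<Rightarrow> ('m \<Rightarrow> 'n) \<Rightarrow> 'm set" where
  "mod_ker M N f = {x \<in> carrier M. f x = \<zero>\<^bsub>N\<^esub>}"

text \<open>HOL cannot quantify over types inside a definition, so ``all modules'' below means all
  modules whose elements live in \<^typ>\<open>nat \<Rightarrow> 'r\<close>, where \<^typ>\<open>'r\<close> is the type of the elements of the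
  ring \<open>R\<close>. This loses nothing. Every ideal of \<open>R\<close> is isomorphic to such a module, so by Baer's
  criterion injectivity tested on these modules is injectivity. If \<open>R\<close> is Noetherian, every module in
  the minimal injective resolution of a finitely generated \<open>R\<close>-module is a direct sum, over the
  primes of \<open>R\<close>, of finitely many copies of each \<open>E(R/p)\<close>; its cardinality is at most that of \<open>R\<close>
  or countable, so it is also isomorphic to such a module.\<close>

definition injective_module :: "('r, 's) ring_scheme \<Rightarrow> ('r, nat \<Rightarrow> 'r) module \<Rightarrow> bool" where
  "injective_module R E \<longleftrightarrow> module R E \<and>
     (\<forall>(A :: ('r, nat \<Rightarrow> 'r) module) (B :: ('r, nat \<Rightarrow> 'r) module) i f.
        module R A \<and> module R B \<and> i \<in> mod_hom R A B \<and> inj_on i (carrier A) \<and> f \<in> mod_hom R A E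
        \<longrightarrow> (\<exists>g \<in> mod_hom R B E. \<forall>x\<in>carrier A. g (i x) = f x))"

text \<open>Exactness of \<open>0 \<rightarrow> M \<rightarrow> E 0 \<rightarrow> E 1 \<rightarrow> \<dots>\<close>, all \<open>E i\<close> being injective.\<close>

definition injective_resolution ::
  "('r, 's) ring_scheme \<Rightarrow> ('r, 'm, 'u) module_scheme \<Rightarrow> (nat \<Rightarrow> ('r, nat \<Rightarrow> 'r) module) \<Rightarrow>
   ('m \<Rightarrow> nat \<Rightarrow> 'r) \<Rightarrow> (nat \<Rightarrow> (nat \<Rightarrow> 'r) \<Rightarrow> nat \<Rightarrow> 'r) \<Rightarrow> bool" where
  "injective_resolution R M E \<epsilon> \<delta> \<longleftrightarrow>
     module R M \<and> (\<forall>i. injective_module R (E i))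
     \<and> \<epsilon> \<in> mod_hom R M (E 0) \<and> (\<forall>i. \<delta> i \<in> mod_hom R (E i) (E (Suc i)))
     \<and> inj_on \<epsilon> (carrier M)
     \<and> \<epsilon> ` carrier M = mod_ker (E 0) (E (Suc 0)) (\<delta> 0)
     \<and> (\<forall>i. \<delta> i ` carrier (E i) = mod_ker (E (Suc i)) (E (Suc (Suc i))) (\<delta> (Suc i)))"

definition finite_injective_dim ::
  "('r, 's) ring_scheme \<Rightarrow> ('r, 'm, 'u) module_scheme \<Rightarrow> bool" where
  "finite_injective_dim R M \<longleftrightarrow> (\<exists>E \<epsilon> \<delta> n. injective_resolution R M E \<epsilon> \<delta>
     \<and> (\<forall>i>n. carrier (E i) = {\<zero>\<^bsub>E i\<^esub>}))"

definition self_module :: "('r, 's) ring_scheme \<Rightarrow> ('r, 'r) module" where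
  "self_module R = \<lparr>carrier = carrier R, monoid.mult = monoid.mult R, one = one R,
     ring.zero = ring.zero R, ring.add = ring.add R, smult = monoid.mult R\<rparr>"

lemma module_self_module:
  assumes "cring R"
  shows "module R (self_module R)"
proof -
  interpret cring R by fact
  show ?thesis
  proof (rule moduleI)
    show "abelian_group (self_module R)"
      by (rule abelian_groupI)
        (use l_neg in \<open>fastforce simp: self_module_def add.m_ac\<close>)+
  qed (auto simp: self_module_def assms l_distr r_distr m_assoc)
qed

definition gorenstein_local_ring :: "('r, 's) ring_scheme \<Rightarrow> bool" where
  "gorenstein_local_ring R \<longleftrightarrow>
     (\<exists>\<mm>. noetherian_local_ring R \<mm>) \<and> finite_injective_dim R (self_module R)"

end

theory Submission
  imports Defs
begin

text \<open>Write \<open>\<mm> = (x, y, z)\<close> and let \<open>a\<close> be the order of \<open>I\<close>, so that \<open>I \<subseteq> \<mm>\<^sup>a\<close> and \<open>I\<close> is not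
  contained in \<open>\<mm>\<^sup>a\<^sup>+\<^sup>1\<close>. Two facts give the theorem: \<open>I\<close> has at most \<open>2a + 1\<close> generators (so \<open>d \<le>
  2a - 2\<close>), and \<open>\<mm>\<^sup>2\<^sup>a\<^sup>-\<^sup>2\<close> is not contained in \<open>I\<close>. Both are proved by counting lengths of
  quotients of \<open>S\<close>.

  Write \<open>\<lambda>(K)\<close> for the length of \<open>S/K\<close>. The tools are the formula \<open>\<lambda>(K) = \<lambda>(K + (b)) + \<lambda>(K : b)\<close>
  (\<open>len_exact\<close>) and, for \<open>K \<supseteq> I\<close>, Gorenstein duality \<open>\<lambda>(I : K) = \<lambda>(I) - \<lambda>(K)\<close> and \<open>I : (I : K) =
  K\<close> (\<open>dual_len\<close>, \<open>dual_dual\<close>). Duality rests on the socle of \<open>S/I\<close> being one-dimensional. This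
  follows from finite injective dimension: over an artinian local ring, dimension shifting along a
  composition series carries injectivity from the end of a finite injective resolution through all
  syzygies down to the ring itself (\<open>finite_injective_dim_self_injective\<close>), and in a
  self-injective ring any two nonzero socle elements divide each other
  (\<open>gorenstein_simple_socle\<close>).

  The socle degree (\<open>gorenstein_order_bound\<close>, \<open>socle_degree_bound\<close>). Put \<open>a = t + 1\<close> and suppose
  that \<open>\<mm>\<^sup>2\<^sup>t \<subseteq> I\<close>. Since \<open>\<mm>\<^sup>t\<^sup>+\<^sup>1 : z = \<mm>\<^sup>t\<close>, the length of \<open>S/(\<mm>\<^sup>t\<^sup>+\<^sup>1 + (z))\<close> is \<open>\<lambda>(\<mm>\<^sup>t\<^sup>+\<^sup>1) -
  \<lambda>(\<mm>\<^sup>t) = \<lambda>(I : \<mm>\<^sup>t) - \<lambda>(I : \<mm>\<^sup>t\<^sup>+\<^sup>1)\<close>. As \<open>z\<close> multiplies \<open>I : \<mm>\<^sup>t\<^sup>+\<^sup>1\<close> into \<open>I : \<mm>\<^sup>t\<close>, this is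
  at most \<open>\<lambda>((I : \<mm>\<^sup>t) + (z))\<close>, which is at most \<open>\<lambda>(\<mm>\<^sup>t + (z))\<close> because \<open>\<mm>\<^sup>t \<subseteq> I : \<mm>\<^sup>t\<close>. Hence
  \<open>\<mm>\<^sup>t \<subseteq> \<mm>\<^sup>t\<^sup>+\<^sup>1 + (z)\<close>, which is false in a regular ring.

  The number of generators (\<open>gorenstein_generators_bound\<close>, \<open>generators_bound\<close>). This number is
  \<open>\<lambda>(\<mm>I) - \<lambda>(I)\<close>. If \<open>z\<^sup>a \<in> I + (x, y)\<close>, then comparing \<open>\<mm>I\<close> with \<open>I\<close> after cutting by \<open>x\<close> and by
  \<open>y\<close>, and treating the part annihilated by \<open>x\<close> by duality, bounds the difference by \<open>2a + 1\<close>. An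
  element of \<open>I\<close> of order \<open>a\<close> provides such coordinates if its leading form does not vanish at
  some point over the residue field, for instance at a generic one. The residue field may be too
  small for this; so \<open>S\<close> is replaced by \<open>S[Y]\<close> and a maximal ideal \<open>M = (\<mm>, p)\<close> with \<open>p\<close> monic,
  and \<open>K\<close> by \<open>K[Y] + (p)\<close>. This preserves lengths and the simple socle. The new coordinates are \<open>x
  - Yy\<close> and \<open>z - Y\<^sup>N y\<close>, modulo which the element becomes \<open>c y\<^sup>a\<close> with \<open>c\<close> outside \<open>\<mm>[Y]\<close>, and \<open>M\<close>
  is chosen to avoid \<open>c\<close>.

  Regularity enters through a chain of four primes. Krull's height theorem for two elements
  (\<open>krull_height_two\<close>) says that any two elements of \<open>\<mm>\<close> lie in a prime other than \<open>\<mm>\<close>. It is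
  proved by counting with an additive function on ideals. Given this, Nakayama arguments show that
  \<open>x, y, z\<close> is a regular sequence and that \<open>\<mm>\<^sup>t\<^sup>+\<^sup>1 : z = \<mm>\<^sup>t\<close> (\<open>colon_pw_z\<close>).\<close>

section \<open>Ideals with one more generator, and colon ideals\<close>

context cring
begin

text \<open>The ideal \<open>K + (a)\<close>. Lengths are computed by adding one element at a time, which leads only to
  such ideals and to colon ideals.\<close>

definition adj :: "'a set \<Rightarrow> 'a \<Rightarrow> 'a set" where
  "adj K a = {k \<oplus> r \<otimes> a | k r. k \<in> K \<and> r \<in> carrier R}"

definition colon :: "'a set \<Rightarrow> 'a set \<Rightarrow> 'a set" where
  "colon K A = {r \<in> carrier R. \<forall>a\<in>A. r \<otimes> a \<in> K}"

lemma ideal_carr: "ideal K R \<Longrightarrow> a \<in> K \<Longrightarrow> a \<in> carrier R"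
  by (rule ideal.Icarr)

lemma ideal_sub: "ideal K R \<Longrightarrow> K \<subseteq> carrier R"
  by (auto intro: ideal_carr)

lemma ideal_add: "ideal K R \<Longrightarrow> a \<in> K \<Longrightarrow> b \<in> K \<Longrightarrow> a \<oplus> b \<in> K"
  by (meson additive_subgroup.a_closed ideal.axioms(1))

lemma ideal_zero: "ideal K R \<Longrightarrow> \<zero> \<in> K"
  by (meson additive_subgroup.zero_closed ideal.axioms(1))

lemma ideal_neg: "ideal K R \<Longrightarrow> a \<in> K \<Longrightarrow> \<ominus> a \<in> K"
  by (meson additive_subgroup.a_inv_closed ideal.axioms(1))

lemma ideal_minus: "ideal K R \<Longrightarrow> a \<in> K \<Longrightarrow> b \<in> K \<Longrightarrow> a \<ominus> b \<in> K"
  unfolding minus_eq by (intro ideal_add ideal_neg)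

lemma ideal_l: "ideal K R \<Longrightarrow> a \<in> K \<Longrightarrow> r \<in> carrier R \<Longrightarrow> r \<otimes> a \<in> K"
  by (rule ideal.I_l_closed)

lemma ideal_r: "ideal K R \<Longrightarrow> a \<in> K \<Longrightarrow> r \<in> carrier R \<Longrightarrow> a \<otimes> r \<in> K"
  by (rule ideal.I_r_closed)

lemma ideal_add_iff:
  assumes "ideal K R" "a \<in> K" "b \<in> carrier R"
  shows "a \<oplus> b \<in> K \<longleftrightarrow> b \<in> K"
proof
  assume h: "a \<oplus> b \<in> K"
  have "a \<in> carrier R" using assms by (auto intro: ideal_carr)
  then have "b = (a \<oplus> b) \<ominus> a" using assms(3) by algebra
  then show "b \<in> K" using ideal_minus[OF assms(1) h assms(2)] by simp
qed (use assms ideal_add in auto)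

lemma ideal_minus_iff:
  assumes "ideal K R" "a \<ominus> b \<in> K" "a \<in> carrier R" "b \<in> carrier R"
  shows "a \<in> K \<longleftrightarrow> b \<in> K"
proof -
  have "a = (a \<ominus> b) \<oplus> b" using assms(3,4) by algebra
  then show ?thesis using ideal_add_iff[OF assms(1,2,4)] by simp
qed

lemma idealI':
  assumes "K \<subseteq> carrier R" "\<zero> \<in> K" "\<And>a b. a \<in> K \<Longrightarrow> b \<in> K \<Longrightarrow> a \<oplus> b \<in> K"
    "\<And>a r. a \<in> K \<Longrightarrow> r \<in> carrier R \<Longrightarrow> r \<otimes> a \<in> K"
  shows "ideal K R"
proof (rule idealI)
  show "ring R" by (rule ring_axioms)
  show "subgroup K (add_monoid R)"
  proof (unfold_locales; simp?)
    fix x assume x: "x \<in> K"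
    then have xc: "x \<in> carrier R" using assms(1) by auto
    have "inv\<^bsub>add_monoid R\<^esub> x = \<ominus> x" by (simp add: a_inv_def)
    also have "\<dots> = (\<ominus> \<one>) \<otimes> x" using xc by algebra
    finally show "inv\<^bsub>add_monoid R\<^esub> x \<in> K" using assms(4)[OF x] by simp
  qed (use assms in auto)
  fix a x assume "a \<in> K" "x \<in> carrier R"
  moreover from this have "a \<in> carrier R" using assms(1) by auto
  ultimately show "x \<otimes> a \<in> K" "a \<otimes> x \<in> K" using assms(4)[of a x] m_comm[of a x] by auto
qed

lemma adj_mem: "k \<in> K \<Longrightarrow> r \<in> carrier R \<Longrightarrow> k \<oplus> r \<otimes> a \<in> adj K a"
  by (auto simp: adj_def)

lemma adjE:
  assumes "b \<in> adj K a"
  obtains k r where "b = k \<oplus> r \<otimes> a" "k \<in> K" "r \<in> carrier R"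
  using assms unfolding adj_def by blast

lemma adj_ideal:
  assumes K: "ideal K R" and a: "a \<in> carrier R" shows "ideal (adj K a) R"
proof (rule idealI')
  show "adj K a \<subseteq> carrier R" using ideal_sub[OF K] a by (auto simp: adj_def)
  have "\<zero> = \<zero> \<oplus> \<zero> \<otimes> a" using a by algebra
  then show "\<zero> \<in> adj K a" using adj_mem[OF ideal_zero[OF K], of \<zero> a] by simp
  fix u assume "u \<in> adj K a"
  then obtain k r where u: "u = k \<oplus> r \<otimes> a" "k \<in> K" "r \<in> carrier R" by (auto simp: adj_def)
  have kc: "k \<in> carrier R" using u K ideal_carr by auto
  { fix v assume "v \<in> adj K a"
    then obtain l s where v: "v = l \<oplus> s \<otimes> a" "l \<in> K" "s \<in> carrier R" by (auto simp: adj_def)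
    have lc: "l \<in> carrier R" using v K ideal_carr by auto
    have "u \<oplus> v = (k \<oplus> l) \<oplus> (r \<oplus> s) \<otimes> a" unfolding u v using u v kc lc a by algebra
    then show "u \<oplus> v \<in> adj K a" using adj_mem[of "k \<oplus> l" K "r \<oplus> s" a] u v K ideal_add by auto }
  { fix s assume s: "s \<in> carrier R"
    have "s \<otimes> u = s \<otimes> k \<oplus> (s \<otimes> r) \<otimes> a" unfolding u using u s kc a by algebra
    then show "s \<otimes> u \<in> adj K a" using adj_mem[of "s \<otimes> k" K "s \<otimes> r" a] u s K ideal_l by auto }
qed

lemma adj_sub: "ideal K R \<Longrightarrow> a \<in> carrier R \<Longrightarrow> K \<subseteq> adj K a"
proof
  fix k assume "ideal K R" "a \<in> carrier R" "k \<in> K"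
  moreover from this have "k = k \<oplus> \<zero> \<otimes> a" using ideal_carr by simp
  ultimately show "k \<in> adj K a" using adj_mem[of k K \<zero> a] by simp
qed

lemma adj_gen: "ideal K R \<Longrightarrow> a \<in> carrier R \<Longrightarrow> a \<in> adj K a"
  using adj_mem[OF ideal_zero, of K \<one> a] by simp

lemma adj_least: "ideal J R \<Longrightarrow> K \<subseteq> J \<Longrightarrow> a \<in> J \<Longrightarrow> adj K a \<subseteq> J"
  by (auto simp: adj_def intro!: ideal_add ideal_l)

lemma adj_absorb: "ideal K R \<Longrightarrow> a \<in> K \<Longrightarrow> adj K a = K"
  using adj_least[of K K a] adj_sub[of K a] ideal_carr by auto

lemma adj_mono: "K \<subseteq> L \<Longrightarrow> adj K a \<subseteq> adj L a"
  by (auto simp: adj_def)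

lemma adj_comm:
  assumes "ideal K R" "a \<in> carrier R" "b \<in> carrier R"
  shows "adj (adj K a) b = adj (adj K b) a"
proof -
  have *: "adj (adj K a) b \<subseteq> adj (adj K b) a" if "a \<in> carrier R" "b \<in> carrier R" for a b
    using that assms(1)
    by (intro adj_least adj_ideal adj_mono subset_trans[OF adj_sub adj_mono] adj_sub)
       (auto intro: adj_ideal adj_gen set_mp[OF adj_sub])
  show ?thesis using *[of a b] *[of b a] assms by auto
qed

lemma adj_adj:
  assumes "ideal K R" "a \<in> carrier R" "b \<in> adj K a"
  shows "adj (adj K b) a = adj K a"
  using adj_comm[OF assms(1) _ assms(2), of b] adj_absorb[OF adj_ideal[OF assms(1,2)] assms(3)]
    ideal_carr[OF adj_ideal[OF assms(1,2)] assms(3)] by simp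

lemma pow_Suc_adj: "ideal K R \<Longrightarrow> x \<in> carrier R \<Longrightarrow> x [^] Suc i \<in> adj K (x [^] i)"
  using ideal_r[OF adj_ideal[of K "x [^] i"] adj_gen[of K "x [^] i"], of x] by simp

lemma colon_ideal:
  assumes K: "ideal K R" and A: "A \<subseteq> carrier R" shows "ideal (colon K A) R"
proof (rule idealI')
  show "\<zero> \<in> colon K A" using A ideal_zero[OF K] by (auto simp: colon_def)
  fix a assume a: "a \<in> colon K A"
  { fix b assume b: "b \<in> colon K A"
    have "(a \<oplus> b) \<otimes> c = a \<otimes> c \<oplus> b \<otimes> c" if "c \<in> A" for c
      using that a b A by (auto simp: colon_def intro!: l_distr)
    then show "a \<oplus> b \<in> colon K A" using a b K ideal_add by (auto simp: colon_def) }
  { fix r assume r: "r \<in> carrier R"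
    have "(r \<otimes> a) \<otimes> c = r \<otimes> (a \<otimes> c)" if "c \<in> A" for c
      using that a r A by (auto simp: colon_def intro!: m_assoc)
    then show "r \<otimes> a \<in> colon K A" using a r K ideal_l by (auto simp: colon_def) }
qed (auto simp: colon_def)

lemma colon_mem1: "r \<in> colon K {a} \<longleftrightarrow> r \<in> carrier R \<and> r \<otimes> a \<in> K"
  by (auto simp: colon_def)

lemma colon_sub: "ideal K R \<Longrightarrow> A \<subseteq> carrier R \<Longrightarrow> K \<subseteq> colon K A"
  by (auto simp: colon_def ideal_carr intro!: ideal_r)

lemma colon_mono: "K \<subseteq> L \<Longrightarrow> colon K A \<subseteq> colon L A"
  by (auto simp: colon_def)

lemma colon_anti: "A \<subseteq> B \<Longrightarrow> colon K B \<subseteq> colon K A"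
  by (auto simp: colon_def)

end

section \<open>Length over a maximal ideal\<close>

locale max_ring = cring R for R (structure) +
  fixes \<nn> :: "'a set"
  assumes max: "maximalideal \<nn> R"
begin

text \<open>\<open>colength K l\<close> says that \<open>R/K\<close> has a composition series of length \<open>l\<close> all of whose factors are
  isomorphic to \<open>R/\<nn>\<close>: the class of \<open>a\<close> spans a simple submodule of \<open>R/K\<close>, and the rest of the
  series is one of \<open>R/(K + (a))\<close>. The same notion is applied to a local ring and to a polynomial
  ring with one of its maximal ideals.\<close>

inductive colength :: "'a set \<Rightarrow> nat \<Rightarrow> bool" where
  top: "colength (carrier R) 0"
| step: "ideal K R \<Longrightarrow> a \<in> carrier R \<Longrightarrow> a \<notin> K \<Longrightarrow> (\<And>r. r \<in> \<nn> \<Longrightarrow> r \<otimes> a \<in> K) \<Longrightarrow>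
    colength (adj K a) l \<Longrightarrow> colength K (Suc l)"

definition fin :: "'a set \<Rightarrow> bool" where "fin K \<longleftrightarrow> (\<exists>l. colength K l)"

definition len :: "'a set \<Rightarrow> nat" where "len K = (THE l. colength K l)"

lemma n_ideal: "ideal \<nn> R" using max by (simp add: maximalideal_def)
lemma n_proper: "\<nn> \<noteq> carrier R" using max by (auto simp: maximalideal_def maximalideal_axioms_def)
lemma n_max: "ideal J R \<Longrightarrow> \<nn> \<subseteq> J \<Longrightarrow> J = \<nn> \<or> J = carrier R"
  using max ideal_sub[of J] by (auto simp: maximalideal_def maximalideal_axioms_def)

lemma proper_iff: "ideal K R \<Longrightarrow> K = carrier R \<longleftrightarrow> \<one> \<in> K"
  using ideal.one_imp_carrier by auto

lemma n_colon: 
  assumes "ideal K R" "a \<in> carrier R" "a \<notin> K" "\<And>r. r \<in> \<nn> \<Longrightarrow> r \<otimes> a \<in> K"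
  shows "colon K {a} = \<nn>"
proof -
  have "\<nn> \<subseteq> colon K {a}" using assms(4) ideal_carr[OF n_ideal] by (auto simp: colon_mem1)
  moreover have "\<one> \<notin> colon K {a}" using assms by (auto simp: colon_mem1)
  ultimately show ?thesis using n_max[OF colon_ideal[OF assms(1), of "{a}"]] assms(2) by auto
qed

lemma n_unit: 
  assumes "s \<in> carrier R" "s \<notin> \<nn>" obtains u v where "u \<in> carrier R" "v \<in> \<nn>" "\<one> = v \<oplus> u \<otimes> s"
proof -
  have "adj \<nn> s = carrier R"
    using n_max[OF adj_ideal[OF n_ideal assms(1)] adj_sub[OF n_ideal assms(1)]]
      adj_gen[OF n_ideal assms(1)] assms(2) by auto
  then have "\<one> \<in> adj \<nn> s" by simp
  then show thesis using that by (auto simp: adj_def)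
qed

lemma colength_ideal: "colength K l \<Longrightarrow> ideal K R"
  by (induction rule: colength.induct) (auto simp: oneideal)

lemma colength_mono: "colength K l \<Longrightarrow> ideal J R \<Longrightarrow> K \<subseteq> J \<Longrightarrow> \<exists>l'\<le>l. colength J l'"
proof (induction arbitrary: J rule: colength.induct)
  case top
  then have "J = carrier R" using ideal_sub by blast
  then show ?case using colength.top by auto
next
  case (step K a l)
  show ?case
  proof (cases "a \<in> J")
    case True
    then have "adj K a \<subseteq> J" using adj_least step.prems by simp
    then show ?thesis using step.IH step.prems by (meson le_SucI)
  next
    case False
    have "adj K a \<subseteq> adj J a" using step.prems adj_mono by simp
    then obtain l' where "l' \<le> l" "colength (adj J a) l'"
      using step.IH[OF adj_ideal[OF step.prems(1) step.hyps(2)]] by auto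
    then show ?thesis using colength.step[of J a l'] False step by auto
  qed
qed

text \<open>The class of \<open>a\<close> spans at most one copy of the field \<open>R/\<nn>\<close> in \<open>R/K\<close>, and any nonzero multiple
  of a vector spans the same line.\<close>

lemma simple_exchange:
  assumes K: "ideal K R" and a: "a \<in> carrier R" and na: "\<And>r. r \<in> \<nn> \<Longrightarrow> r \<otimes> a \<in> K"
    and b: "b \<in> adj K a" "b \<notin> K"
  shows "a \<in> adj K b"
proof -
  obtain k r where r: "b = k \<oplus> r \<otimes> a" "k \<in> K" "r \<in> carrier R" using b(1) by (auto simp: adj_def)
  have kc: "k \<in> carrier R" using r(2) K ideal_carr by auto
  have "r \<notin> \<nn>" using na r b(2) K ideal_add by auto
  then obtain u v where uv: "u \<in> carrier R" "v \<in> \<nn>" "\<one> = v \<oplus> u \<otimes> r" using n_unit r(3) by metis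
  have vc: "v \<in> carrier R" using uv(2) n_ideal ideal_carr by auto
  have "a = \<one> \<otimes> a" using a by simp
  also have "\<dots> = (v \<oplus> u \<otimes> r) \<otimes> a" by (simp only: uv(3)[symmetric])
  also have "\<dots> = (v \<otimes> a \<ominus> u \<otimes> k) \<oplus> u \<otimes> b" unfolding r(1) using uv(1) vc r(3) kc a by algebra
  finally have "a = (v \<otimes> a \<ominus> u \<otimes> k) \<oplus> u \<otimes> b" .
  moreover have "v \<otimes> a \<ominus> u \<otimes> k \<in> K" using na[OF uv(2)] ideal_l[OF K r(2) uv(1)] ideal_minus[OF K] by blast
  ultimately show ?thesis using adj_mem[OF _ uv(1)] by metis
qed

text \<open>The Jordan-Hoelder theorem: two different first steps \<open>a\<close> and \<open>b\<close> are both continued through \<open>K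
  + (a) + (b)\<close>.\<close>

lemma colength_unique: "colength K l \<Longrightarrow> colength K l' \<Longrightarrow> l = l'"
proof (induction l arbitrary: K l')
  case 0
  then have "K = carrier R" by cases auto
  with 0(2) show ?case by cases auto
next
  case (Suc l)
  from Suc.prems(1) obtain a where a: "a \<in> carrier R" "a \<notin> K" "\<And>r. r \<in> \<nn> \<Longrightarrow> r \<otimes> a \<in> K"
    "colength (adj K a) l" and K: "ideal K R" by cases auto
  from Suc.prems(2) a(1,2) obtain m b where b: "b \<in> carrier R" "b \<notin> K" "\<And>r. r \<in> \<nn> \<Longrightarrow> r \<otimes> b \<in> K"
    "colength (adj K b) m" and l': "l' = Suc m" by cases auto
  have Ka: "ideal (adj K a) R" and Kb: "ideal (adj K b) R" using K a(1) b(1) adj_ideal by auto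
  show ?case
  proof (cases "b \<in> adj K a")
    case True
    then have "a \<in> adj K b" using simple_exchange[OF K a(1,3)] b(2) by blast
    then have "adj K b = adj K a"
      using True adj_least[OF Ka adj_sub[OF K a(1)]] adj_least[OF Kb adj_sub[OF K b(1)]] by blast
    then show ?thesis using Suc.IH[OF a(4)] b(4) l' by simp
  next
    case False
    then have F: "a \<notin> adj K b" using simple_exchange[OF K b(1,3)] a(2) by blast
    obtain m' where m': "colength (adj (adj K a) b) m'"
      using colength_mono[OF a(4) adj_ideal[OF Ka b(1)] adj_sub[OF Ka b(1)]] by auto
    have "colength (adj K a) (Suc m')"
      using colength.step[OF Ka b(1) False _ m'] b(3) adj_sub[OF K a(1)] by blast
    moreover have "colength (adj K b) (Suc m')"
      using colength.step[OF Kb a(1) F _ m'[unfolded adj_comm[OF K a(1) b(1)]]] a(3) adj_sub[OF K b(1)] by blast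
    ultimately show ?thesis using Suc.IH[OF a(4), of "Suc m'"] Suc.IH[of "adj K b" m] b(4) l' by auto
  qed
qed

lemma len_eq: "colength K l \<Longrightarrow> len K = l"
  unfolding len_def using colength_unique by (intro the_equality) auto

lemma fin_len: "fin K \<longleftrightarrow> colength K (len K)"
  using len_eq by (auto simp: fin_def)

lemma fin_ideal: "fin K \<Longrightarrow> ideal K R" using fin_len colength_ideal by auto

lemma fin_mono: "fin K \<Longrightarrow> ideal J R \<Longrightarrow> K \<subseteq> J \<Longrightarrow> fin J"
  unfolding fin_def using colength_mono by blast

lemma fin_adj: "fin K \<Longrightarrow> a \<in> carrier R \<Longrightarrow> fin (adj K a)"
  using fin_mono[OF _ adj_ideal adj_sub] fin_ideal by blast

lemma fin_colon: "fin K \<Longrightarrow> A \<subseteq> carrier R \<Longrightarrow> fin (colon K A)"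
  using fin_mono[OF _ colon_ideal colon_sub] fin_ideal by blast

lemma len_anti: "fin K \<Longrightarrow> ideal J R \<Longrightarrow> K \<subseteq> J \<Longrightarrow> len J \<le> len K"
  using colength_mono[of K "len K" J] fin_len[of K] len_eq[of J] by auto

text \<open>The exact sequence \<open>0 \<rightarrow> R/(K : a) \<rightarrow> R/K \<rightarrow> R/(K + (a)) \<rightarrow> 0\<close>, whose first map is multiplication
  by \<open>a\<close>. A composition series of \<open>R/(K : a)\<close> is transported into \<open>R/K\<close> by multiplying with \<open>a\<close>.\<close>

lemma colength_exact:
  "colength M s \<Longrightarrow> ideal K R \<Longrightarrow> a \<in> carrier R \<Longrightarrow> M = colon K {a} \<Longrightarrow> colength (adj K a) r \<Longrightarrow>
   colength K (r + s)"
proof (induction arbitrary: K rule: colength.induct)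
  case top
  have "\<one> \<in> colon K {a}" using top(3) one_closed by simp
  then have "a \<in> K" using top(2) by (simp add: colon_mem1)
  then show ?case using top(4) adj_absorb[OF top(1)] by simp
next
  case (step M b l)
  let ?K = "adj K (b \<otimes> a)"
  note K = step.prems(1) and a = step.prems(2) and M = step.prems(3) and b = step.hyps(2)
  have c: "b \<otimes> a \<in> carrier R" using a b by simp
  have K': "ideal ?K R" using adj_ideal[OF K c] .
  have "colon ?K {a} = adj M b"
  proof
    show "colon ?K {a} \<subseteq> adj M b"
    proof
      fix r assume "r \<in> colon ?K {a}"
      then obtain k s where r: "r \<in> carrier R" "r \<otimes> a = k \<oplus> s \<otimes> (b \<otimes> a)" "k \<in> K" "s \<in> carrier R"
        by (auto simp: colon_mem1 adj_def)
      have kc: "k \<in> carrier R" using r(3) K ideal_carr by auto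
      have "(r \<ominus> s \<otimes> b) \<otimes> a = r \<otimes> a \<ominus> s \<otimes> (b \<otimes> a)" using r(1,4) a b by algebra
      also have "\<dots> = k" unfolding r(2) using r(4) kc c by algebra
      finally have "r \<ominus> s \<otimes> b \<in> M" using r(1,3,4) b M by (simp add: colon_mem1)
      moreover have "r = (r \<ominus> s \<otimes> b) \<oplus> s \<otimes> b" using r(1,4) b by algebra
      ultimately show "r \<in> adj M b" using adj_mem[OF _ r(4)] by metis
    qed
    show "adj M b \<subseteq> colon ?K {a}"
    proof (rule adj_least)
      show "ideal (colon ?K {a}) R" using K' a colon_ideal by simp
      show "M \<subseteq> colon ?K {a}" unfolding M using colon_mono adj_sub[OF K c] by simp
      show "b \<in> colon ?K {a}" using b adj_gen[OF K c] by (simp add: colon_mem1)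
    qed
  qed
  moreover have "adj ?K a = adj K a"
    using adj_adj[OF K a ideal_l[OF adj_ideal[OF K a] adj_gen[OF K a] b]] .
  ultimately have *: "colength ?K (r + l)" using step.IH[OF K' a] step.prems(4) by simp
  have nK: "b \<otimes> a \<notin> K" using step.hyps(3) b M by (simp add: colon_mem1)
  have "v \<otimes> (b \<otimes> a) \<in> K" if "v \<in> \<nn>" for v
  proof -
    have "(v \<otimes> b) \<otimes> a \<in> K" using step.hyps(4)[OF that] M by (simp add: colon_mem1)
    then show ?thesis using m_assoc[of v b a] a b that ideal_carr[OF n_ideal] by simp
  qed
  then show ?case using colength.step[OF K c nK _ *] by simp
qed

lemma fin_exact:
  assumes "ideal K R" "a \<in> carrier R" "fin (adj K a)" "fin (colon K {a})" shows "fin K"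
proof -
  obtain r s where "colength (adj K a) r" "colength (colon K {a}) s" using assms(3,4) fin_def by auto
  then show ?thesis using colength_exact[OF _ assms(1,2) refl] fin_def by blast
qed

lemma len_exact:
  assumes "fin K" "a \<in> carrier R" shows "len K = len (adj K a) + len (colon K {a})"
proof -
  have "colength (adj K a) (len (adj K a))" using fin_adj[OF assms] fin_len by blast
  moreover have "colength (colon K {a}) (len (colon K {a}))"
    using fin_colon[OF assms(1), of "{a}"] assms(2) fin_len by blast
  ultimately show ?thesis
    using colength_exact[OF _ fin_ideal[OF assms(1)] assms(2) refl] len_eq by blast
qed

lemma len_carrier: "len (carrier R) = 0" using colength.top len_eq by blast

lemma fin_carrier: "fin (carrier R)" using colength.top fin_def by blast

lemma len_0_iff: "fin K \<Longrightarrow> len K = 0 \<longleftrightarrow> K = carrier R"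
  using fin_len[of K] len_carrier colength.cases[of K 0 "K = carrier R"] by auto

lemma colength_n: "colength \<nn> 1"
proof -
  have "\<one> \<notin> \<nn>" using n_proper proper_iff[OF n_ideal] by simp
  moreover have "adj \<nn> \<one> = carrier R"
    using adj_gen[OF n_ideal one_closed] proper_iff[OF adj_ideal[OF n_ideal one_closed]] by simp
  ultimately show ?thesis
    using colength.step[OF n_ideal one_closed, of 0] colength.top ideal_r[OF n_ideal _ one_closed] by simp
qed

lemma fin_n: "fin \<nn>" and len_n: "len \<nn> = 1"
  using colength_n fin_def len_eq by blast+

lemma len_strict:
  assumes "fin K" "ideal J R" "K \<subset> J" shows "len J < len K"
proof -
  obtain a where a: "a \<in> J" "a \<notin> K" using assms by auto
  have ac: "a \<in> carrier R" using a assms ideal_carr by auto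
  have K: "ideal K R" using assms fin_ideal by simp
  have "\<one> \<notin> colon K {a}" using a ac by (simp add: colon_mem1)
  then have "len (colon K {a}) \<noteq> 0"
    using len_0_iff fin_colon[OF assms(1), of "{a}"] ac by auto
  then have "len (adj K a) < len K" using len_exact[OF assms(1) ac] by simp
  moreover have "len J \<le> len (adj K a)"
    using len_anti[OF fin_adj[OF assms(1) ac] assms(2)] adj_least assms a by auto
  ultimately show ?thesis by simp
qed

lemma len_eq_imp: "fin K \<Longrightarrow> ideal J R \<Longrightarrow> K \<subseteq> J \<Longrightarrow> len K \<le> len J \<Longrightarrow> K = J"
  using len_strict by (metis leD psubsetI)

lemma len_adj_simple:
  assumes "fin K" "a \<in> carrier R" "\<And>r. r \<in> \<nn> \<Longrightarrow> r \<otimes> a \<in> K"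
  shows "len K \<le> Suc (len (adj K a))" "a \<notin> K \<Longrightarrow> len K = Suc (len (adj K a))"
proof -
  have *: "len K = Suc (len (adj K a))" if "a \<notin> K"
    using len_exact[OF assms(1,2)] n_colon[OF fin_ideal[OF assms(1)] assms(2) that assms(3)] len_n by simp
  then show "a \<notin> K \<Longrightarrow> len K = Suc (len (adj K a))" .
  show "len K \<le> Suc (len (adj K a))"
    using * adj_absorb[OF fin_ideal[OF assms(1)]] by (cases "a \<in> K") auto
qed

text \<open>All composition factors of \<open>R/K\<close> are \<open>R/\<nn>\<close>, hence \<open>R/K\<close> is a local ring even if \<open>R\<close> is not.\<close>

lemma fin_sub_n: assumes "fin K" "K \<noteq> carrier R" shows "K \<subseteq> \<nn>"
proof -
  have "colength K l \<Longrightarrow> K \<noteq> carrier R \<Longrightarrow> K \<subseteq> \<nn>" for l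
  proof (induction rule: colength.induct)
    case (step K a l)
    show ?case
    proof (cases "adj K a = carrier R")
      case True
      have f: "fin K" using colength.step[OF step(1-5)] fin_def by blast
      have "len K = 1" using len_adj_simple(2)[OF f step(2,4,3)] True len_carrier by simp
      moreover have n: "\<nn> = colon K {a}" using n_colon[OF step(1-4)] by simp
      ultimately have "K = \<nn>"
        using len_eq_imp[OF f n_ideal] len_n colon_sub[OF step(1), of "{a}"] step(2) by simp
      then show ?thesis by simp
    next
      case False
      then show ?thesis using step.IH adj_sub[OF step(1,2)] by blast
    qed
  qed auto
  then show ?thesis using assms unfolding fin_def by blast
qed

lemma fin_power:
  assumes "fin K" "x \<in> \<nn>" shows "x [^] len K \<in> K"
proof -
  have xc: "x \<in> carrier R" using assms n_ideal ideal_carr by auto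
  have "colength K l \<Longrightarrow> x [^] l \<in> K" for l
  proof (induction rule: colength.induct)
    case (step K a l)
    then obtain k r where k: "x [^] l = k \<oplus> r \<otimes> a" "k \<in> K" "r \<in> carrier R" by (auto simp: adj_def)
    have kc: "k \<in> carrier R" using k(2) step(1) ideal_carr by auto
    have "x [^] Suc l = x \<otimes> (k \<oplus> r \<otimes> a)" using xc k m_comm[of "x [^] l" x] kc step(2) by simp
    also have "\<dots> = x \<otimes> k \<oplus> r \<otimes> (x \<otimes> a)" using k(3) kc step(2) xc by algebra
    also have "\<dots> \<in> K"
      using ideal_add[OF step(1) ideal_l[OF step(1) k(2) xc] ideal_l[OF step(1) step(4)[OF assms(2)] k(3)]] .
    finally show ?case .
  qed (use xc in auto)
  then show ?thesis using assms fin_len by simp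
qed

section \<open>Duality for an ideal with simple socle\<close>

text \<open>The socle of \<open>R/I\<close>, that is the annihilator of \<open>\<nn>\<close>, is the line spanned by the class of \<open>\<omega>\<close>.\<close>

definition simple_socle :: "'a set \<Rightarrow> 'a \<Rightarrow> bool" where
  "simple_socle I \<omega> \<longleftrightarrow> \<omega> \<in> carrier R \<and> \<omega> \<notin> I \<and> (\<forall>r\<in>\<nn>. r \<otimes> \<omega> \<in> I) \<and>
     (\<forall>t\<in>carrier R. (\<forall>r\<in>\<nn>. r \<otimes> t \<in> I) \<longrightarrow> t \<in> adj I \<omega>)"

lemma n_carr: "r \<in> \<nn> \<Longrightarrow> r \<in> carrier R"
  by (rule ideal_carr[OF n_ideal])

text \<open>Among the elements of \<open>B\<close> outside \<open>A\<close>, one whose annihilator modulo \<open>A\<close> is largest is a socle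
  element: otherwise multiplication with some \<open>v \<in> \<nn>\<close> would not enlarge the annihilator, although
  \<open>v\<close> is nilpotent modulo it.\<close>

lemma socle_between:
  assumes A: "fin A" and B: "ideal B R" and AB: "A \<subset> B"
  obtains b where "b \<in> B" "b \<notin> A" "\<And>r. r \<in> \<nn> \<Longrightarrow> r \<otimes> b \<in> A"
proof -
  let ?f = "\<lambda>b. len (colon A {b})"
  obtain b0 where "b0 \<in> B - A" using AB by auto
  then obtain b where b: "b \<in> B - A" and min: "\<And>c. c \<in> B - A \<Longrightarrow> ?f b \<le> ?f c"
    using ex_has_least_nat[of "\<lambda>b. b \<in> B - A" b0 ?f] by auto
  have bc: "b \<in> carrier R" using b B ideal_carr by auto
  have fC: "fin (colon A {b})" using fin_colon[OF A] bc by simp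
  have Ai: "ideal A R" using A fin_ideal by simp
  have "v \<otimes> b \<in> A" if v: "v \<in> \<nn>" for v
  proof (rule ccontr)
    assume vb: "v \<otimes> b \<notin> A"
    have vc: "v \<in> carrier R" using v n_carr by simp
    have vbc: "v \<otimes> b \<in> carrier R" using vc bc by simp
    have "colon A {b} \<subseteq> colon A {v \<otimes> b}"
    proof
      fix r assume r: "r \<in> colon A {b}"
      then have rc: "r \<in> carrier R" by (simp add: colon_mem1)
      have "r \<otimes> (v \<otimes> b) = v \<otimes> (r \<otimes> b)" using rc vc bc by algebra
      also have "\<dots> \<in> A" using r ideal_l[OF Ai _ vc] by (simp add: colon_mem1)
      finally show "r \<in> colon A {v \<otimes> b}" using rc by (simp add: colon_mem1)
    qed
    moreover have "?f b \<le> ?f (v \<otimes> b)" using min[of "v \<otimes> b"] vb b ideal_l[OF B _ vc] by auto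
    ultimately have eq: "colon A {b} = colon A {v \<otimes> b}"
      using len_eq_imp[OF fC colon_ideal[OF Ai, of "{v \<otimes> b}"]] vbc by simp
    let ?P = "\<lambda>N::nat. v [^] N \<in> colon A {b}"
    have P: "?P (LEAST N. ?P N)" using fin_power[OF fC v] by (rule LeastI)
    have "\<not> ?P 0" using b bc by (simp add: colon_mem1)
    then obtain N where N: "(LEAST N. ?P N) = Suc N" using P by (cases "LEAST N. ?P N") auto
    have "v [^] N \<otimes> v \<otimes> b \<in> A" using P unfolding N by (simp add: colon_mem1)
    then have "v [^] N \<otimes> (v \<otimes> b) \<in> A" using m_assoc vc bc by simp
    then have "?P N" unfolding eq using vc by (simp add: colon_mem1)
    then show False using not_less_Least[of N ?P] N by simp
  qed
  then show thesis using that b by blast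
qed

lemma colon_adj_mem:
  assumes "ideal I R" "ideal A R" "a \<in> carrier R"
  shows "c \<in> colon I (adj A a) \<longleftrightarrow> c \<in> colon I A \<and> c \<otimes> a \<in> I"
proof
  assume c: "c \<in> colon I (adj A a)"
  then show "c \<in> colon I A \<and> c \<otimes> a \<in> I"
    using adj_sub[OF assms(2,3)] adj_gen[OF assms(2,3)] by (auto simp: colon_def)
next
  assume c: "c \<in> colon I A \<and> c \<otimes> a \<in> I"
  then have cc: "c \<in> carrier R" by (simp add: colon_def)
  have "c \<otimes> (k \<oplus> r \<otimes> a) \<in> I" if k: "k \<in> A" and r: "r \<in> carrier R" for k r
  proof -
    have "c \<otimes> (k \<oplus> r \<otimes> a) = c \<otimes> k \<oplus> r \<otimes> (c \<otimes> a)"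
      using ideal_carr[OF assms(2) k] r cc assms(3) by algebra
    then show ?thesis using ideal_add[OF assms(1) _ ideal_l[OF assms(1) _ r]] c k by (simp add: colon_def)
  qed
  then show "c \<in> colon I (adj A a)" using cc by (auto simp: colon_def adj_def)
qed

text \<open>Multiplication with \<open>a\<close> maps \<open>(I : A)/(I : (A + (a)))\<close> injectively into the socle of \<open>R/I\<close>,
  which is one-dimensional. So one step up from \<open>A\<close> costs the dual ideal at most one step down.\<close>

lemma dual_step:
  assumes I: "fin I" and s: "simple_socle I \<omega>" and A: "ideal A R" "I \<subseteq> A"
    and a: "a \<in> carrier R" "\<And>r. r \<in> \<nn> \<Longrightarrow> r \<otimes> a \<in> A"
  shows "len (colon I (adj A a)) \<le> Suc (len (colon I A))"
proof -
  let ?M = "colon I A" and ?M' = "colon I (adj A a)"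
  have Ii: "ideal I R" using I fin_ideal by simp
  have sc: "\<omega> \<in> carrier R" and s0: "\<And>r. r \<in> \<nn> \<Longrightarrow> r \<otimes> \<omega> \<in> I" using s by (auto simp: simple_socle_def)
  note mem = colon_adj_mem[OF Ii A(1) a(1)]
  have fM': "fin ?M'" using fin_colon[OF I ideal_sub[OF adj_ideal[OF A(1) a(1)]]] .
  have Mi: "ideal ?M R" using colon_ideal[OF Ii ideal_sub[OF A(1)]] .
  have M'i: "ideal ?M' R" using fM' fin_ideal by simp
  have ex: "\<exists>i s. i \<in> I \<and> s \<in> carrier R \<and> c \<otimes> a = i \<oplus> s \<otimes> \<omega>" if c: "c \<in> ?M" for c
  proof -
    have cc: "c \<in> carrier R" using c by (simp add: colon_def)
    have "r \<otimes> (c \<otimes> a) \<in> I" if r: "r \<in> \<nn>" for r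
    proof -
      have "r \<otimes> (c \<otimes> a) = c \<otimes> (r \<otimes> a)" using n_carr[OF r] cc a(1) by algebra
      then show ?thesis using c a(2)[OF r] by (simp add: colon_def)
    qed
    then have "c \<otimes> a \<in> adj I \<omega>" using s cc a(1) by (simp add: simple_socle_def)
    then show ?thesis by (auto simp: adj_def)
  qed
  show ?thesis
  proof (cases "?M \<subseteq> ?M'")
    case True
    then have "?M' = ?M" using mem by auto
    then show ?thesis by simp
  next
    case False
    then obtain c where c: "c \<in> ?M" "c \<notin> ?M'" by auto
    have cc: "c \<in> carrier R" using c by (simp add: colon_def)
    have caI: "c \<otimes> a \<notin> I" using c mem by auto
    obtain i t where t: "i \<in> I" "t \<in> carrier R" "c \<otimes> a = i \<oplus> t \<otimes> \<omega>" using ex[OF c(1)] by auto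
    have ic: "i \<in> carrier R" using t(1) Ii ideal_carr by auto
    have "t \<notin> \<nn>" using caI t ideal_add[OF Ii] s0 by auto
    then obtain u v where uv: "u \<in> carrier R" "v \<in> \<nn>" "\<one> = v \<oplus> u \<otimes> t" using n_unit t(2) by metis
    have vc: "v \<in> carrier R" using uv n_carr by simp
    have "?M \<subseteq> adj ?M' c"
    proof
      fix d assume d: "d \<in> ?M"
      have dc: "d \<in> carrier R" using d by (simp add: colon_def)
      obtain j w where w: "j \<in> I" "w \<in> carrier R" "d \<otimes> a = j \<oplus> w \<otimes> \<omega>" using ex[OF d] by auto
      have jc: "j \<in> carrier R" using w(1) Ii ideal_carr by auto
      let ?e = "d \<ominus> (w \<otimes> u) \<otimes> c"
      have "?e \<otimes> a = d \<otimes> a \<ominus> (w \<otimes> u) \<otimes> (c \<otimes> a)" using dc cc uv(1) w(2) a(1) by algebra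
      also have "\<dots> = (j \<oplus> w \<otimes> (\<one> \<otimes> \<omega>)) \<ominus> (w \<otimes> u) \<otimes> (i \<oplus> t \<otimes> \<omega>)" using sc by (simp add: w(3) t(3))
      also have "\<dots> = (j \<oplus> w \<otimes> ((v \<oplus> u \<otimes> t) \<otimes> \<omega>)) \<ominus> (w \<otimes> u) \<otimes> (i \<oplus> t \<otimes> \<omega>)"
        by (simp only: uv(3)[symmetric])
      also have "\<dots> = (j \<oplus> w \<otimes> (v \<otimes> \<omega>)) \<ominus> (w \<otimes> u) \<otimes> i" using jc w(2) vc uv(1) t(2) sc ic by algebra
      also have "\<dots> \<in> I"
        using ideal_minus[OF Ii ideal_add[OF Ii w(1) ideal_l[OF Ii s0[OF uv(2)] w(2)]]
          ideal_l[OF Ii t(1), of "w \<otimes> u"]] w(2) uv(1) by simp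
      finally have "?e \<otimes> a \<in> I" .
      moreover have "?e \<in> ?M" using ideal_minus[OF Mi d ideal_l[OF Mi c(1)]] w(2) uv(1) by simp
      ultimately have "?e \<in> ?M'" using mem by simp
      moreover have "d = ?e \<oplus> (w \<otimes> u) \<otimes> c" using dc cc w(2) uv(1) by algebra
      ultimately show "d \<in> adj ?M' c" using adj_mem[of ?e ?M' "w \<otimes> u" c] w(2) uv(1) by simp
    qed
    then have "len (adj ?M' c) \<le> len ?M"
      using len_anti[OF fin_colon[OF I ideal_sub[OF A(1)]] adj_ideal[OF M'i cc]] by simp
    moreover have "r \<otimes> c \<in> ?M'" if r: "r \<in> \<nn>" for r
    proof -
      have "r \<otimes> c \<otimes> a = r \<otimes> (c \<otimes> a)" using n_carr[OF r] cc a(1) by algebra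
      also have "\<dots> = r \<otimes> i \<oplus> t \<otimes> (r \<otimes> \<omega>)" unfolding t(3) using n_carr[OF r] ic t(2) sc by algebra
      also have "\<dots> \<in> I" using ideal_add[OF Ii ideal_l[OF Ii t(1)] ideal_l[OF Ii s0]] r n_carr t(2) by simp
      finally show ?thesis using mem ideal_l[OF Mi c(1) n_carr[OF r]] by simp
    qed
    ultimately show ?thesis using len_adj_simple(1)[OF fM' cc] by fastforce
  qed
qed

text \<open>The sum of the two lengths does not grow with \<open>A\<close>. It has the same value at \<open>A = I\<close> and \<open>A =
  R\<close>, and is therefore constant; this is the next lemma.\<close>

lemma dual_mono:
  assumes I: "fin I" and s: "simple_socle I \<omega>" and A: "ideal A R" "I \<subseteq> A" and B: "ideal B R" "A \<subseteq> B"
  shows "len (colon I B) + len B \<le> len (colon I A) + len A"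
  using A B(2)
proof (induction "len A" arbitrary: A rule: less_induct)
  case less
  show ?case
  proof (cases "A = B")
    case False
    have fA: "fin A" using fin_mono[OF I less.prems(1,2)] .
    obtain b where b: "b \<in> B" "b \<notin> A" "\<And>r. r \<in> \<nn> \<Longrightarrow> r \<otimes> b \<in> A"
      using socle_between[OF fA B(1)] False less.prems(3) by blast
    have bc: "b \<in> carrier R" using b B ideal_carr by auto
    have l: "len A = Suc (len (adj A b))" using len_adj_simple(2)[OF fA bc b(3,2)] .
    have "len (colon I B) + len B \<le> len (colon I (adj A b)) + len (adj A b)"
      using less.hyps[of "adj A b"] l adj_ideal[OF less.prems(1) bc] adj_sub[OF less.prems(1) bc]
        less.prems(2) adj_least[OF B(1) less.prems(3) b(1)] by auto
    moreover have "len (colon I (adj A b)) \<le> Suc (len (colon I A))"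
      using dual_step[OF I s less.prems(1,2) bc b(3)] .
    ultimately show ?thesis using l by simp
  qed simp
qed

lemma dual_len:
  assumes I: "fin I" and s: "simple_socle I \<omega>" and K: "ideal K R" "I \<subseteq> K"
  shows "len (colon I K) + len K = len I"
proof -
  have Ii: "ideal I R" using I fin_ideal by simp
  have "colon I I = carrier R" using ideal_l[OF Ii] by (auto simp: colon_def)
  moreover have "colon I (carrier R) = I"
  proof
    show "colon I (carrier R) \<subseteq> I" by (auto simp: colon_def) (metis one_closed r_one)
  qed (use ideal_carr[OF Ii] ideal_r[OF Ii] in \<open>auto simp: colon_def\<close>)
  ultimately show ?thesis
    using dual_mono[OF I s Ii subset_refl K] dual_mono[OF I s K oneideal ideal_sub[OF K(1)]] len_carrier
    by simp
qed

lemma dual_dual: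
  assumes I: "fin I" and s: "simple_socle I \<omega>" and K: "ideal K R" "I \<subseteq> K"
  shows "colon I (colon I K) = K"
proof -
  have Ii: "ideal I R" using I fin_ideal by simp
  let ?W = "colon I K"
  have W: "ideal ?W R" "I \<subseteq> ?W" using colon_ideal[OF Ii ideal_sub[OF K(1)]] colon_sub[OF Ii ideal_sub[OF K(1)]] by auto
  have "K \<subseteq> colon I ?W" using ideal_sub[OF K(1)] by (auto simp: colon_def) (metis m_comm subsetD)
  moreover have "len K = len (colon I ?W)" using dual_len[OF I s K] dual_len[OF I s W] by simp
  ultimately show ?thesis
    using len_eq_imp[OF fin_mono[OF I K] colon_ideal[OF Ii ideal_sub[OF W(1)]]] by simp
qed

section \<open>The two length estimates\<close>

text \<open>Modulo \<open>Q\<close> the maximal ideal is generated by \<open>z\<close>, so each step of the chain \<open>Q = Q + (z\<^sup>a) \<subseteq> \<dots>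
  \<subseteq> Q + (z) \<subseteq> R\<close> has length at most one.\<close>

lemma generic_len_bound:
  assumes Q: "fin Q" and z: "z \<in> \<nn>" and n: "\<nn> \<subseteq> adj Q z" and za: "z [^] (a::nat) \<in> Q"
  shows "len Q \<le> a"
proof -
  have Qi: "ideal Q R" using Q fin_ideal by simp
  have zc: "z \<in> carrier R" using z n_carr by simp
  have "len (adj Q (z [^] i)) \<le> i" for i :: nat
  proof (induction i)
    case 0
    have "adj Q \<one> = carrier R"
      using proper_iff[OF adj_ideal[OF Qi one_closed]] adj_gen[OF Qi one_closed] by simp
    then show ?case using len_carrier by simp
  next
    case (Suc i)
    let ?A = "adj Q (z [^] Suc i)"
    have p: "z [^] i \<in> carrier R" "z [^] Suc i \<in> carrier R" using zc by auto
    have Ai: "ideal ?A R" using adj_ideal[OF Qi p(2)] .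
    have "r \<otimes> z [^] i \<in> ?A" if r: "r \<in> \<nn>" for r
    proof -
      obtain q s where q: "r = q \<oplus> s \<otimes> z" "q \<in> Q" "s \<in> carrier R" using r n by (auto simp: adj_def)
      have qc: "q \<in> carrier R" using q Qi ideal_carr by auto
      have "r \<otimes> z [^] i = z [^] i \<otimes> q \<oplus> s \<otimes> (z [^] i \<otimes> z)" unfolding q(1) using q(3) qc zc p(1) by algebra
      then show ?thesis using adj_mem[OF ideal_l[OF Qi q(2) p(1)] q(3)] by simp
    qed
    then have "len ?A \<le> Suc (len (adj ?A (z [^] i)))"
      using len_adj_simple(1)[OF fin_adj[OF Q p(2)] p(1)] by simp
    moreover have "len (adj ?A (z [^] i)) \<le> len (adj Q (z [^] i))"
      using len_anti[OF fin_adj[OF Q p(1)] adj_ideal[OF Ai p(1)]] adj_mono[OF adj_sub[OF Qi p(2)]] by simp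
    ultimately show ?case using Suc by simp
  qed
  from this[of a] show ?thesis using adj_absorb[OF Qi za] by simp
qed

text \<open>Modulo \<open>C\<close> the maximal ideal is generated by \<open>z\<close>, so as in a discrete valuation ring \<open>Q\<close> is
  generated by the smallest power of \<open>z\<close> that it contains.\<close>

lemma generic_principal:
  assumes C: "ideal C R" and Q: "fin Q" and CQ: "C \<subseteq> Q" and z: "z \<in> \<nn>" and n: "\<nn> \<subseteq> adj C z"
    and za: "z [^] (a::nat) \<in> Q"
  shows "\<exists>i. z [^] (i::nat) \<in> Q \<and> Q \<subseteq> adj C (z [^] i)"
proof -
  have zc: "z \<in> carrier R" using z n_carr by simp
  have Qi: "ideal Q R" using Q fin_ideal by simp
  define i where "i = (LEAST i::nat. z [^] i \<in> Q)"
  have iQ: "z [^] i \<in> Q" unfolding i_def using za by (rule LeastI)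
  have least: "z [^] l \<notin> Q" if "l < i" for l using that not_less_Least unfolding i_def by blast
  have "q \<in> adj C (z [^] l)" if q: "q \<in> Q" and "l \<le> i" for q l
    using that(2)
  proof (induction l)
    case 0
    have "\<zero> \<oplus> q \<otimes> \<one> = q" using ideal_carr[OF Qi q] by simp
    then show ?case using adj_mem[OF ideal_zero[OF C] ideal_carr[OF Qi q], of \<one>] by simp
  next
    case (Suc l)
    have pc: "z [^] l \<in> carrier R" using zc by simp
    obtain c r where r: "q = c \<oplus> r \<otimes> z [^] l" "c \<in> C" "r \<in> carrier R" using Suc by (auto simp: adj_def)
    have cc: "c \<in> carrier R" using r(2) C ideal_carr by auto
    have "c \<in> Q" using r(2) CQ by auto
    then have "r \<otimes> z [^] l \<in> Q" using ideal_add_iff[OF Qi, of c "r \<otimes> z [^] l"] q r pc by simp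
    then have "r \<in> colon Q {z [^] l}" using r(3) by (simp add: colon_mem1)
    moreover have "colon Q {z [^] l} \<noteq> carrier R"
      using least[of l] Suc.prems proper_iff[OF colon_ideal[OF Qi, of "{z [^] l}"]] pc by (simp add: colon_mem1)
    ultimately have "r \<in> \<nn>" using fin_sub_n[OF fin_colon[OF Q, of "{z [^] l}"]] pc by auto
    then obtain c' s where s: "r = c' \<oplus> s \<otimes> z" "c' \<in> C" "s \<in> carrier R" using n by (auto simp: adj_def)
    have c'c: "c' \<in> carrier R" using s(2) C ideal_carr by auto
    have "q = (c \<oplus> z [^] l \<otimes> c') \<oplus> s \<otimes> (z [^] l \<otimes> z)" unfolding r(1) s(1) using cc c'c s(3) pc zc by algebra
    then show ?case
      using adj_mem[OF ideal_add[OF C r(2) ideal_l[OF C s(2) pc]] s(3), of "z [^] Suc l"] by simp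
  qed
  then show ?thesis using iQ by blast
qed

text \<open>\<open>C\<close> stands for \<open>\<nn>I\<close>. Write \<open>\<lambda>\<close> for the length and put \<open>J = I + (x)\<close>, \<open>C\<^sub>1 = C + (x)\<close>, \<open>Q = J +
  (y)\<close>, \<open>C\<^sub>2 = C\<^sub>1 + (y)\<close>. Cutting by \<open>x\<close> splits \<open>\<lambda>(C) - \<lambda>(I)\<close> into \<open>\<lambda>(C\<^sub>1) - \<lambda>(J)\<close> and \<open>\<lambda>(C : x)
  - \<lambda>(I : x)\<close>.

  The first part is at most \<open>a + 1\<close>: \<open>\<lambda>(C\<^sub>1) = \<lambda>(C\<^sub>2) + \<lambda>(C\<^sub>1 : y) \<le> \<lambda>(C\<^sub>2) + \<lambda>(J)\<close>, and modulo
  \<open>x, y\<close> everything is principal, so that \<open>\<lambda>(C\<^sub>2) \<le> \<lambda>(Q) + 1 \<le> a + 1\<close>.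

  By duality the second part is \<open>\<lambda>(J) - \<lambda>(I : (C : x))\<close>. Here \<open>I : (C : x) \<subseteq> J : \<nn> \<subseteq> J : y\<close>, and
  \<open>\<lambda>(J) - \<lambda>(J : y) = \<lambda>(Q) \<le> a\<close>.\<close>

theorem gorenstein_generators_bound:
  assumes C: "fin C" and I: "ideal I R" and CI: "C \<subseteq> I" and nI: "\<And>r i. r \<in> \<nn> \<Longrightarrow> i \<in> I \<Longrightarrow> r \<otimes> i \<in> C"
    and xyz: "x \<in> \<nn>" "y \<in> \<nn>" "z \<in> \<nn>" and n: "\<nn> \<subseteq> adj (adj (adj C x) y) z"
    and s: "simple_socle I \<omega>" and za: "z [^] (a::nat) \<in> adj (adj I x) y"
  shows "len C \<le> len I + (2 * a + 1)"
proof -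
  have Ci: "ideal C R" using C fin_ideal by simp
  have fI: "fin I" using fin_mono[OF C I CI] .
  have xc: "x \<in> carrier R" and yc: "y \<in> carrier R" and zc: "z \<in> carrier R" using xyz n_carr by auto
  let ?J = "adj I x" and ?C1 = "adj C x"
  let ?Q = "adj ?J y" and ?C2 = "adj ?C1 y"
  have fJ: "fin ?J" "fin ?C1" "fin ?Q" "fin ?C2" using fI C fin_adj xc yc by auto
  have Ji: "ideal ?J R" "ideal ?C1 R" "ideal ?Q R" "ideal ?C2 R" using fJ fin_ideal by auto
  have sub: "?C2 \<subseteq> ?Q" using adj_mono CI by simp
  have "\<nn> \<subseteq> adj ?Q z" using n adj_mono[OF sub] by blast
  then have lQ: "len ?Q \<le> a" using generic_len_bound[OF fJ(3) xyz(3) _ za] by simp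
  have nQ: "r \<otimes> q \<in> ?C2" if r: "r \<in> \<nn>" and q: "q \<in> ?Q" for r q
  proof -
    obtain i u v where q': "q = (i \<oplus> u \<otimes> x) \<oplus> v \<otimes> y" "i \<in> I" "u \<in> carrier R" "v \<in> carrier R"
      using q by (auto simp: adj_def)
    have ic: "i \<in> carrier R" using q' I ideal_carr by auto
    have rc: "r \<in> carrier R" using r n_carr by simp
    have "r \<otimes> q = (r \<otimes> i \<oplus> (r \<otimes> u) \<otimes> x) \<oplus> (r \<otimes> v) \<otimes> y" unfolding q'(1) using q'(3,4) ic rc xc yc by algebra
    then show ?thesis using adj_mem[OF adj_mem[OF nI[OF r q'(2)]]] q' rc by simp
  qed
  \<comment> \<open>\<open>C\<^sub>2\<close> and \<open>Q\<close> differ by at most one step: \<open>\<nn>Q \<subseteq> C\<^sub>2\<close>, and \<open>Q\<close> is generated by one element modulo \<open>C\<^sub>2\<close>.\<close>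
  obtain i where i: "z [^] (i::nat) \<in> ?Q" "?Q \<subseteq> adj ?C2 (z [^] i)"
    using generic_principal[OF Ji(4) fJ(3) sub xyz(3) n za] by auto
  have pc: "z [^] i \<in> carrier R" using zc by simp
  have "len ?C2 \<le> Suc (len (adj ?C2 (z [^] i)))" using len_adj_simple(1)[OF fJ(4) pc] nQ i(1) by simp
  also have "len (adj ?C2 (z [^] i)) \<le> len ?Q" using len_anti[OF fJ(3) adj_ideal[OF Ji(4) pc] i(2)] .
  finally have 1: "len ?C2 \<le> Suc (len ?Q)" by simp
  have "?J \<subseteq> colon ?C1 {y}"
  proof (rule adj_least)
    show "ideal (colon ?C1 {y}) R" using colon_ideal[OF Ji(2)] yc by simp
    show "I \<subseteq> colon ?C1 {y}"
    proof
      fix i assume i: "i \<in> I"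
      then have "y \<otimes> i \<in> ?C1" using nI[OF xyz(2)] adj_sub[OF Ci xc] by blast
      then show "i \<in> colon ?C1 {y}" using m_comm[of y i] ideal_carr[OF I i] yc by (simp add: colon_mem1)
    qed
    have "y \<otimes> x \<in> ?C1" using ideal_l[OF Ji(2) adj_gen[OF Ci xc] yc] .
    then show "x \<in> colon ?C1 {y}" using m_comm[of y x] yc xc by (simp add: colon_mem1)
  qed
  then have "len (colon ?C1 {y}) \<le> len ?J" using len_anti[OF fJ(1)] colon_ideal[OF Ji(2)] yc by simp
  then have 2: "len ?C1 \<le> len ?C2 + len ?J" using len_exact[OF fJ(2) yc] by simp
  have 3: "len ?J = len ?Q + len (colon ?J {y})" using len_exact[OF fJ(1) yc] .
  \<comment> \<open>The elements annihilated by \<open>x\<close>, modulo \<open>I\<close> and modulo \<open>C\<close>; both ideals are replaced by their duals.\<close>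
  let ?W = "colon I {x}" and ?A = "colon C {x}"
  have W: "ideal ?W R" "I \<subseteq> ?W" using colon_ideal[OF I] colon_sub[OF I] xc by auto
  have Ai: "ideal ?A R" using colon_ideal[OF Ci] xc by simp
  have IA: "I \<subseteq> ?A"
  proof
    fix i assume i: "i \<in> I"
    then have "x \<otimes> i \<in> C" using nI[OF xyz(1)] by blast
    then show "i \<in> ?A" using m_comm[of x i] ideal_carr[OF I i] xc by (simp add: colon_mem1)
  qed
  have JW: "colon I ?J = ?W"
    using colon_adj_mem[OF I I xc] ideal_l[OF I] by (auto simp: colon_def)
  have WJ: "colon I ?W = ?J" using dual_dual[OF fI s Ji(1) adj_sub[OF I xc]] JW by simp
  have "colon I ?A \<subseteq> colon ?J \<nn>"
  proof
    fix r assume r: "r \<in> colon I ?A"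
    have rc: "r \<in> carrier R" using r by (simp add: colon_def)
    have "r \<otimes> v \<in> ?J" if v: "v \<in> \<nn>" for v
    proof -
      have "r \<otimes> v \<otimes> w \<in> I" if w: "w \<in> ?W" for w
      proof -
        have wc: "w \<in> carrier R" "w \<otimes> x \<in> I" using w by (auto simp: colon_mem1)
        have "(v \<otimes> w) \<otimes> x = v \<otimes> (w \<otimes> x)" using wc(1) xc n_carr[OF v] by algebra
        then have "v \<otimes> w \<in> ?A" using nI[OF v wc(2)] n_carr[OF v] wc(1) by (simp add: colon_mem1)
        then show ?thesis using r m_assoc[OF rc n_carr[OF v] wc(1)] by (simp add: colon_def)
      qed
      then have "r \<otimes> v \<in> colon I ?W" using rc n_carr[OF v] by (simp add: colon_def)
      then show ?thesis using WJ by simp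
    qed
    then show "r \<in> colon ?J \<nn>" using rc by (simp add: colon_def)
  qed
  also have "\<dots> \<subseteq> colon ?J {y}" using colon_anti xyz(2) by simp
  finally have "len (colon ?J {y}) \<le> len (colon I ?A)"
    using len_anti[OF fin_colon[OF fI ideal_sub[OF Ai]]] colon_ideal[OF Ji(1)] yc by simp
  moreover have "len (colon I ?A) + len ?A = len I" using dual_len[OF fI s Ai IA] .
  ultimately show ?thesis using 1 2 3 lQ len_exact[OF C xc] len_exact[OF fI xc] by simp
qed

text \<open>Applied with \<open>A = \<nn>\<^sup>t\<^sup>+\<^sup>1\<close> and \<open>B = \<nn>\<^sup>t\<close>. With \<open>\<lambda>\<close> for the length, \<open>\<lambda>(A + (x)) = \<lambda>(A) - \<lambda>(B) =
  \<lambda>(I : B) - \<lambda>(I : A) \<le> \<lambda>((I : B) + (x)) \<le> \<lambda>(B + (x))\<close>. The first inequality holds because \<open>I : A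
  \<subseteq> (I : B) : x\<close>, the second because \<open>B \<subseteq> I : B\<close>. So \<open>A + (x)\<close> is not smaller than \<open>B + (x)\<close>.\<close>

theorem gorenstein_order_bound:
  assumes A: "ideal A R" and B: "ideal B R" and AB: "A \<subseteq> B" and I: "fin I" and IA: "I \<subseteq> A"
    and s: "simple_socle I \<omega>" and x: "x \<in> carrier R" and Ax: "colon A {x} = B"
    and BB: "\<And>b c. b \<in> B \<Longrightarrow> c \<in> B \<Longrightarrow> b \<otimes> c \<in> I"
  shows "B \<subseteq> adj A x"
proof -
  have Ii: "ideal I R" using I fin_ideal by simp
  have IB: "I \<subseteq> B" using IA AB by simp
  have fA: "fin A" and fB: "fin B" using fin_mono[OF I] A B IA IB by auto
  let ?B' = "colon I B" and ?A' = "colon I A"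
  have B': "ideal ?B' R" "fin ?B'" using fin_colon[OF I ideal_sub[OF B]] fin_ideal by auto
  have A': "ideal ?A' R" "fin ?A'" using fin_colon[OF I ideal_sub[OF A]] fin_ideal by auto
  have "?A' \<subseteq> colon ?B' {x}"
  proof
    fix r assume r: "r \<in> ?A'"
    have rc: "r \<in> carrier R" using r by (simp add: colon_def)
    have "r \<otimes> x \<otimes> b \<in> I" if b: "b \<in> B" for b
    proof -
      have bc: "b \<in> carrier R" using b B ideal_carr by auto
      have "b \<otimes> x \<in> A" using b Ax by (auto simp: colon_mem1)
      moreover have "r \<otimes> x \<otimes> b = r \<otimes> (b \<otimes> x)" using rc x bc by algebra
      ultimately show ?thesis using r by (simp add: colon_def)
    qed
    then show "r \<in> colon ?B' {x}" using rc x by (simp add: colon_def)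
  qed
  then have "len (colon ?B' {x}) \<le> len ?A'" using len_anti[OF A'(2)] colon_ideal[OF B'(1)] x by simp
  then have "len ?B' \<le> len (adj ?B' x) + len ?A'" using len_exact[OF B'(2) x] by simp
  moreover have "len (adj ?B' x) \<le> len (adj B x)"
    using len_anti[OF fin_adj[OF fB x] adj_ideal[OF B'(1) x] adj_mono] BB ideal_carr[OF B]
    by (simp add: colon_def subset_iff)
  moreover have "len A = len (adj A x) + len B" using len_exact[OF fA x] Ax by simp
  ultimately have "len (adj A x) \<le> len (adj B x)"
    using dual_len[OF I s A IA] dual_len[OF I s B IB] by simp
  then have "adj A x = adj B x"
    using len_eq_imp[OF fin_adj[OF fA x] adj_ideal[OF B x] adj_mono[OF AB]] by simp
  then show ?thesis using adj_sub[OF B x] by simp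
qed

end

section \<open>Noetherian local rings and Krull's height theorem\<close>

lemma linear_slope_le:
  fixes a b p q :: nat assumes "\<And>j. a + j * p \<le> b + j * q" shows "p \<le> q"
proof (rule ccontr)
  assume "\<not> p \<le> q"
  then have "Suc b * Suc q \<le> Suc b * p" by (intro mult_le_mono) auto
  then have "Suc b * Suc q \<le> b + Suc b * q" using assms[of "Suc b"] by linarith
  then show False by simp
qed

lemma (in noetherian_ring) exists_maximal_ideal_in:
  assumes "\<C> \<noteq> {}" "\<And>K. K \<in> \<C> \<Longrightarrow> ideal K R"
  shows "\<exists>M\<in>\<C>. \<forall>K\<in>\<C>. M \<subseteq> K \<longrightarrow> K = M"
proof (rule subset_Zorn_nonempty[OF assms(1)])
  fix C assume C: "C \<noteq> {}" "subset.chain \<C> C"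
  then have "subset.chain {I. ideal I R} C" using assms(2) by (auto simp: pred_on.chain_def)
  then show "\<Union>C \<in> \<C>" using ideal_chain_is_trivial[OF C(1)] C(2) by (auto simp: pred_on.chain_def)
qed

lemma (in noetherian_ring) obtain_maximal_ideal:
  assumes "\<phi> K" "\<And>K. \<phi> K \<Longrightarrow> ideal K R"
  obtains M where "\<phi> M" "\<And>K. \<phi> K \<Longrightarrow> M \<subseteq> K \<Longrightarrow> K = M"
proof -
  have "{K. \<phi> K} \<noteq> {}" using assms(1) by blast
  from exists_maximal_ideal_in[OF this] show thesis using that assms(2) by blast
qed

context cring
begin

lemma prime_ideal: "primeideal P R \<Longrightarrow> ideal P R"
  by (simp add: primeideal_def)

lemma prime_one: "primeideal P R \<Longrightarrow> \<one> \<notin> P"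
  using primeideal.I_notcarr ideal.one_imp_carrier prime_ideal by metis

lemma prime_mult: "primeideal P R \<Longrightarrow> a \<in> carrier R \<Longrightarrow> b \<in> carrier R \<Longrightarrow> a \<otimes> b \<in> P \<Longrightarrow> a \<in> P \<or> b \<in> P"
  by (rule primeideal.I_prime)

lemma prime_pow: "primeideal P R \<Longrightarrow> a \<in> carrier R \<Longrightarrow> a [^] (n::nat) \<in> P \<Longrightarrow> a \<in> P"
proof (induction n)
  case 0 then show ?case using prime_one by simp
next
  case (Suc n) then show ?case using prime_mult[of P "a [^] n" a] by auto
qed

lemma prime_sum_mem:
  assumes Q: "primeideal Q R" "y \<oplus> a \<in> Q" "a \<otimes> y [^] (c::nat) \<in> Q" and ya: "y \<in> carrier R" "a \<in> carrier R"
  shows "a \<in> Q \<and> y \<in> Q"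
proof -
  have Qi: "ideal Q R" using Q prime_ideal by simp
  have "a \<in> Q \<or> y \<in> Q" using prime_mult[OF Q(1) ya(2), of "y [^] c"] prime_pow[OF Q(1) ya(1)] Q(3) ya by auto
  then show ?thesis
    using ideal_add_iff[OF Qi, of y a] ideal_add_iff[OF Qi, of a y] Q(2) ya a_comm[OF ya] by auto
qed

end

locale noeth_local = max_ring R \<nn> + noetherian_ring R for R (structure) and \<nn> +
  assumes only_max: "maximalideal J R \<Longrightarrow> J = \<nn>"
begin

lemma proper_sub_n: assumes "ideal J R" "J \<noteq> carrier R" shows "J \<subseteq> \<nn>"
proof -
  let ?C = "\<lambda>K. ideal K R \<and> J \<subseteq> K \<and> K \<noteq> carrier R"
  have "?C J" using assms by blast
  then obtain M where M: "?C M" "\<And>K. ?C K \<Longrightarrow> M \<subseteq> K \<Longrightarrow> K = M"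
    by (rule obtain_maximal_ideal[of ?C]) blast+
  have "maximalideal M R"
  proof (rule maximalidealI)
    fix K assume K: "ideal K R" "M \<subseteq> K" "K \<subseteq> carrier R"
    show "K = M \<or> K = carrier R"
    proof (cases "K = carrier R")
      case False
      then have "?C K" using K M(1) by blast
      then show ?thesis using M(2) K(2) by blast
    qed simp
  qed (use M in auto)
  then show ?thesis using only_max M by auto
qed

text \<open>The element \<open>1 - a\<close> is a unit, since \<open>a \<in> \<nn>\<close>.\<close>

lemma local_absorb:
  assumes K: "ideal K R" and a: "a \<in> \<nn>" and b: "b \<in> carrier R" and k: "k \<in> K" and eq: "b = k \<oplus> a \<otimes> b"
  shows "b \<in> K"
proof (rule ccontr)
  assume nb: "b \<notin> K"
  have ac: "a \<in> carrier R" using a n_carr by simp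
  have kc: "k \<in> carrier R" using k K ideal_carr by auto
  have "(\<one> \<ominus> a) \<otimes> b = b \<ominus> a \<otimes> b" using ac b by algebra
  also have "\<dots> = (k \<oplus> a \<otimes> b) \<ominus> a \<otimes> b" using eq by simp
  also have "\<dots> = k" using ac b kc by algebra
  finally have "\<one> \<ominus> a \<in> colon K {b}" using k ac by (simp add: colon_mem1)
  moreover have "colon K {b} \<noteq> carrier R"
    using proper_iff[OF colon_ideal[OF K, of "{b}"]] b nb by (simp add: colon_mem1)
  ultimately have "\<one> \<ominus> a \<in> \<nn>" using proper_sub_n[OF colon_ideal[OF K, of "{b}"]] b by auto
  then have "(\<one> \<ominus> a) \<oplus> a \<in> \<nn>" using a ideal_add[OF n_ideal] by simp
  moreover have "(\<one> \<ominus> a) \<oplus> a = \<one>" using ac by algebra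
  ultimately show False using n_proper proper_iff[OF n_ideal] by simp
qed

lemma local_absorb_power:
  assumes K: "ideal K R" and y: "y \<in> \<nn>" and yj: "y [^] j \<in> adj K (y [^] Suc j)"
  shows "y [^] (j::nat) \<in> K"
proof -
  have yc: "y \<in> carrier R" using y n_carr by simp
  obtain q s where s: "y [^] j = q \<oplus> s \<otimes> y [^] Suc j" "q \<in> K" "s \<in> carrier R" using yj by (rule adjE)
  have "y [^] j = q \<oplus> (s \<otimes> y) \<otimes> y [^] j" using s yc by (simp add: m_assoc m_comm[of y])
  then show ?thesis using local_absorb[OF K ideal_l[OF n_ideal y s(3)] _ s(2)] yc by simp
qed

text \<open>Nakayama's lemma: \<open>H \<subseteq> K + \<nn>H\<close> implies \<open>H \<subseteq> K\<close>. The hypothesis is expressed through all ideals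
  \<open>N\<close> that contain \<open>K\<close> and \<open>\<nn>H\<close>, which avoids forming products and sums of ideals. For an ideal \<open>N
  \<supseteq> K\<close> maximal among those not containing \<open>H\<close>, \<open>H\<close> is generated by one element \<open>h\<close> modulo \<open>N\<close>;
  then \<open>h \<in> N + \<nn>h\<close> forces \<open>h \<in> N\<close>.\<close>

lemma nakayama:
  assumes K: "ideal K R" and H: "ideal H R"
    and gen: "\<And>N. ideal N R \<Longrightarrow> K \<subseteq> N \<Longrightarrow> (\<And>r h. r \<in> \<nn> \<Longrightarrow> h \<in> H \<Longrightarrow> r \<otimes> h \<in> N) \<Longrightarrow> H \<subseteq> N"
  shows "H \<subseteq> K"
proof (rule ccontr)
  assume nH: "\<not> H \<subseteq> K"
  let ?C = "\<lambda>N. ideal N R \<and> K \<subseteq> N \<and> \<not> H \<subseteq> N"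
  have "?C K" using K nH by blast
  then obtain N where N: "?C N" and max: "\<And>L. ?C L \<Longrightarrow> N \<subseteq> L \<Longrightarrow> L = N"
    by (rule obtain_maximal_ideal[of ?C]) blast+
  have Ni: "ideal N R" using N by simp
  obtain h where h: "h \<in> H" "h \<notin> N" using N by auto
  have hc: "h \<in> carrier R" using h H ideal_carr by auto
  have Hh: "H \<subseteq> adj N h"
  proof (rule ccontr)
    assume "\<not> H \<subseteq> adj N h"
    then have "adj N h = N"
      using max[of "adj N h"] N adj_ideal[OF Ni hc] adj_sub[OF Ni hc] by blast
    then show False using adj_gen[OF Ni hc] h by blast
  qed
  let ?N = "{n \<oplus> r \<otimes> h | n r. n \<in> N \<and> r \<in> \<nn>}"
  have mem: "n \<oplus> r \<otimes> h \<in> ?N" if "n \<in> N" "r \<in> \<nn>" for n r using that by blast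
  have z: "n \<in> ?N" if "n \<in> N" for n
    using mem[OF that ideal_zero[OF n_ideal]] hc ideal_carr[OF Ni that] by simp
  have "ideal ?N R"
  proof (rule idealI')
    show "?N \<subseteq> carrier R" using ideal_carr[OF Ni] n_carr hc by auto
    show "\<zero> \<in> ?N" using z ideal_zero[OF Ni] by simp
    fix a assume "a \<in> ?N"
    then obtain n r where a: "a = n \<oplus> r \<otimes> h" "n \<in> N" "r \<in> \<nn>" by auto
    have ac: "n \<in> carrier R" "r \<in> carrier R" using a ideal_carr[OF Ni] n_carr by auto
    { fix b assume "b \<in> ?N"
      then obtain m s where b: "b = m \<oplus> s \<otimes> h" "m \<in> N" "s \<in> \<nn>" by auto
      have bc: "m \<in> carrier R" "s \<in> carrier R" using b ideal_carr[OF Ni] n_carr by auto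
      have "a \<oplus> b = (n \<oplus> m) \<oplus> (r \<oplus> s) \<otimes> h" unfolding a(1) b(1) using ac bc hc by algebra
      then show "a \<oplus> b \<in> ?N" using mem[OF ideal_add[OF Ni a(2) b(2)] ideal_add[OF n_ideal a(3) b(3)]] by simp }
    { fix s assume s: "s \<in> carrier R"
      have "s \<otimes> a = s \<otimes> n \<oplus> (s \<otimes> r) \<otimes> h" unfolding a(1) using ac s hc by algebra
      then show "s \<otimes> a \<in> ?N" using mem[OF ideal_l[OF Ni a(2) s] ideal_l[OF n_ideal a(3) s]] by simp }
  qed
  moreover have "K \<subseteq> ?N" using N z by blast
  moreover have "r \<otimes> g \<in> ?N" if r: "r \<in> \<nn>" and g: "g \<in> H" for r g
  proof -
    obtain n s where s: "g = n \<oplus> s \<otimes> h" "n \<in> N" "s \<in> carrier R" using Hh g by (auto simp: adj_def)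
    have "r \<otimes> g = r \<otimes> n \<oplus> (r \<otimes> s) \<otimes> h"
      unfolding s(1) using s(3) ideal_carr[OF Ni s(2)] n_carr[OF r] hc by algebra
    then show ?thesis using mem[OF ideal_l[OF Ni s(2) n_carr[OF r]] ideal_r[OF n_ideal r s(3)]] by simp
  qed
  ultimately have "h \<in> ?N" using gen[of ?N] h by blast
  then obtain n r where "h = n \<oplus> r \<otimes> h" "n \<in> N" "r \<in> \<nn>" by auto
  then show False using local_absorb[OF Ni _ hc] h(2) by blast
qed

text \<open>If \<open>y\<close> is a nonzerodivisor modulo \<open>A\<close> and \<open>A \<subseteq> K + (y)\<close>, then \<open>A = K + yA\<close>, and Nakayama's
  lemma applies. This is the step that turns primes supplied by Krull's theorem into statements
  about regular sequences.\<close>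

lemma nakayama_cancel:
  assumes K: "ideal K R" and A: "ideal A R" and KA: "K \<subseteq> A" and y: "y \<in> \<nn>" and Ay: "A \<subseteq> adj K y"
    and cancel: "\<And>s. s \<in> carrier R \<Longrightarrow> s \<otimes> y \<in> A \<Longrightarrow> s \<in> A"
  shows "A \<subseteq> K"
proof (rule nakayama[OF K A])
  have yc: "y \<in> carrier R" using y n_carr by simp
  fix N assume N: "ideal N R" "K \<subseteq> N" "\<And>r h. r \<in> \<nn> \<Longrightarrow> h \<in> A \<Longrightarrow> r \<otimes> h \<in> N"
  show "A \<subseteq> N"
  proof
    fix a assume a: "a \<in> A"
    obtain k s where s: "a = k \<oplus> s \<otimes> y" "k \<in> K" "s \<in> carrier R" using Ay a by (blast elim: adjE)
    have "s \<otimes> y \<in> A" using ideal_add_iff[OF A, of k "s \<otimes> y"] KA a s yc by auto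
    then have "s \<otimes> y \<in> N" using N(3)[OF y cancel[OF s(3)]] m_comm[OF s(3) yc] by simp
    then show "a \<in> N" using ideal_add[OF N(1)] N(2) s by auto
  qed
qed

text \<open>An ideal maximal among those of infinite colength is prime: if \<open>ab \<in> M\<close> with \<open>a, b \<notin> M\<close>, then
  \<open>M + (a)\<close> and \<open>M : a\<close> are strictly larger, and the exact sequence makes \<open>M\<close> of finite colength.
  But the only prime over \<open>J\<close> is \<open>\<nn>\<close>, of colength one.\<close>

lemma fin_if_primes:
  assumes J: "ideal J R" and p: "\<And>P. primeideal P R \<Longrightarrow> J \<subseteq> P \<Longrightarrow> P = \<nn>"
  shows "fin J"
proof (rule ccontr)
  assume nf: "\<not> fin J"
  let ?C = "\<lambda>K. ideal K R \<and> J \<subseteq> K \<and> \<not> fin K"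
  have "?C J" using J nf by blast
  then obtain M where M: "?C M" and max: "\<And>K. ?C K \<Longrightarrow> M \<subseteq> K \<Longrightarrow> K = M"
    by (rule obtain_maximal_ideal[of ?C]) blast+
  have Mi: "ideal M R" using M by simp
  have "primeideal M R"
  proof (rule primeidealI[OF Mi is_cring])
    show "carrier R \<noteq> M" using M fin_carrier by blast
    fix a b assume ab: "a \<in> carrier R" "b \<in> carrier R" "a \<otimes> b \<in> M"
    show "a \<in> M \<or> b \<in> M"
    proof (rule ccontr)
      assume n: "\<not> (a \<in> M \<or> b \<in> M)"
      have "fin (adj M a)"
        using max[of "adj M a"] M n adj_ideal[OF Mi ab(1)] adj_sub[OF Mi ab(1)] adj_gen[OF Mi ab(1)] by blast
      moreover have "b \<in> colon M {a}" using ab m_comm by (simp add: colon_mem1)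
      then have "fin (colon M {a})"
        using max[of "colon M {a}"] M n colon_ideal[OF Mi, of "{a}"] colon_sub[OF Mi, of "{a}"] ab(1) by blast
      ultimately have "fin M" using fin_exact[OF Mi ab(1)] by simp
      then show False using M by simp
    qed
  qed
  then have "M = \<nn>" using p M by blast
  then show False using M fin_n by blast
qed

lemma prime_sub_n: "primeideal P R \<Longrightarrow> P \<subseteq> \<nn>"
  using proper_sub_n prime_ideal primeideal.I_notcarr by metis

lemma colon_power_stable:
  assumes K: "ideal K R" and x: "x \<in> carrier R"
  shows "\<exists>c. \<forall>n\<ge>c. colon K {x [^] (n::nat)} = colon K {x [^] (c::nat)}"
proof -
  have "\<exists>M\<in>range (\<lambda>n::nat. colon K {x [^] n}). \<forall>L\<in>range (\<lambda>n::nat. colon K {x [^] n}). M \<subseteq> L \<longrightarrow> L = M"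
    by (rule exists_maximal_ideal_in) (use colon_ideal[OF K] x in auto)
  then obtain c where c: "\<And>n. colon K {x [^] (c::nat)} \<subseteq> colon K {x [^] (n::nat)} \<Longrightarrow> colon K {x [^] n} = colon K {x [^] c}"
    by auto
  have "colon K {x [^] c} \<subseteq> colon K {x [^] (c + d)}" for d
  proof
    fix r assume r: "r \<in> colon K {x [^] c}"
    have "r \<otimes> x [^] (c + d) = (r \<otimes> x [^] c) \<otimes> x [^] d"
      using r x by (simp add: colon_mem1 nat_pow_mult[symmetric] m_assoc)
    then show "r \<in> colon K {x [^] (c + d)}" using r x ideal_r[OF K] by (simp add: colon_mem1)
  qed
  then show ?thesis using c by (metis le_add_diff_inverse)
qed

lemma colon_power_cancel:
  assumes c: "\<And>n. n \<ge> c \<Longrightarrow> colon K {x [^] (n::nat)} = colon K {x [^] (c::nat)}"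
    and x: "x \<in> carrier R" and s: "s \<in> carrier R" "s \<otimes> x \<in> colon K {x [^] c}"
  shows "s \<in> colon K {x [^] c}"
proof -
  have "s \<otimes> x [^] Suc c = (s \<otimes> x) \<otimes> x [^] c" using x s(1) by (simp add: m_ac)
  then have "s \<in> colon K {x [^] Suc c}" using s by (simp add: colon_mem1 del: nat_pow_Suc)
  then show ?thesis using c[of "Suc c"] by simp
qed

text \<open>A form of the Artin-Rees lemma. If \<open>ru = p + s x\<^sup>j\<^sup>+\<^sup>c\<close>, then \<open>s x\<^sup>j\<^sup>+\<^sup>c \<in> K + (u)\<close>. Because
  the ideals \<open>(K + (u)) : x\<^sup>n\<close> are constant from \<open>n = c\<close> on, already \<open>s x\<^sup>c \<in> K + (u)\<close>, and a
  multiple of \<open>x\<^sup>j\<close> can be subtracted from \<open>r\<close>.\<close>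

lemma colon_adj_power:
  assumes K: "ideal K R" and x: "x \<in> carrier R" and u: "u \<in> carrier R"
  shows "\<exists>c. \<forall>j. colon (adj K (x [^] (j + c :: nat))) {u} \<subseteq> adj (colon K {u}) (x [^] j)"
proof -
  have pc: "x [^] j \<in> carrier R" for j :: nat using x by simp
  obtain c where c: "\<And>n. n \<ge> c \<Longrightarrow> colon (adj K u) {x [^] (n::nat)} = colon (adj K u) {x [^] (c::nat)}"
    using colon_power_stable[OF adj_ideal[OF K u] x] by blast
  have "r \<in> adj (colon K {u}) (x [^] j)" if r': "r \<in> colon (adj K (x [^] (j + c))) {u}" for r j
  proof -
    obtain p s where r: "r \<in> carrier R" "r \<otimes> u = p \<oplus> s \<otimes> x [^] (j + c)" "p \<in> K" "s \<in> carrier R"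
      using r' by (auto simp: colon_mem1 adj_def)
    have p: "p \<in> carrier R" using r K ideal_carr by auto
    have "s \<otimes> x [^] (j + c) = (p \<oplus> s \<otimes> x [^] (j + c)) \<ominus> p" using r(4) p pc[of "j + c"] by algebra
    also have "\<dots> = (\<ominus> p) \<oplus> r \<otimes> u" unfolding r(2)[symmetric] using p r(1) u by algebra
    also have "\<dots> \<in> adj K u" using adj_mem[OF ideal_neg[OF K r(3)] r(1)] .
    finally have "s \<in> colon (adj K u) {x [^] c}" using c[of "j + c"] r(4) by (auto simp: colon_mem1)
    then obtain q w where w: "s \<otimes> x [^] c = q \<oplus> w \<otimes> u" "q \<in> K" "w \<in> carrier R"
      by (auto simp: colon_mem1 adj_def)
    have q: "q \<in> carrier R" using w K ideal_carr by auto
    have "(r \<ominus> w \<otimes> x [^] j) \<otimes> u = r \<otimes> u \<ominus> x [^] j \<otimes> (w \<otimes> u)" using r(1) w(3) pc[of j] u by algebra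
    also have "\<dots> = (p \<oplus> x [^] j \<otimes> (s \<otimes> x [^] c)) \<ominus> x [^] j \<otimes> (w \<otimes> u)"
      unfolding r(2) nat_pow_mult[OF x, symmetric] using r(4) pc[of j] pc[of c] by (simp add: m_lcomm)
    also have "\<dots> = p \<oplus> x [^] j \<otimes> q" unfolding w(1) using p q pc[of j] w(3) u by algebra
    also have "\<dots> \<in> K" using ideal_add[OF K r(3) ideal_l[OF K w(2) pc]] .
    finally have "r \<ominus> w \<otimes> x [^] j \<in> colon K {u}" using r(1) w(3) pc[of j] by (simp add: colon_mem1)
    moreover have "r = (r \<ominus> w \<otimes> x [^] j) \<oplus> w \<otimes> x [^] j" using r(1) w(3) pc[of j] by algebra
    ultimately show ?thesis using adj_mem[OF _ w(3)] by metis
  qed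
  then show ?thesis by blast
qed

text \<open>The counting behind Krull's theorem. The functional \<open>e\<close> is a length, or a multiplicity that
  behaves like a length. Put \<open>K\<^sub>i = P + (x\<^sup>i)\<close> and \<open>M\<^sub>i = K\<^sub>i + (u)\<close>. Additivity gives \<open>e(M\<^sub>i\<^sub>+\<^sub>1)
  = e(M\<^sub>i) + e(M\<^sub>i\<^sub>+\<^sub>1 : x\<^sup>i)\<close>, so that \<open>e(M\<^sub>i) \<ge> i\<close> if none of the last terms vanishes. On the
  other hand \<open>x\<close> and \<open>u\<close> are nonzerodivisors modulo the prime \<open>P\<close>. Therefore \<open>e(K\<^sub>j\<^sub>+\<^sub>c) = e(K\<^sub>j)
  + c e(K\<^sub>1)\<close>, and \<open>K\<^sub>j\<^sub>+\<^sub>c : u \<subseteq> K\<^sub>j\<close> for a fixed \<open>c\<close>, whence \<open>e(M\<^sub>j\<^sub>+\<^sub>c) = e(K\<^sub>j\<^sub>+\<^sub>c) -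
  e(K\<^sub>j\<^sub>+\<^sub>c : u) \<le> c e(K\<^sub>1)\<close> is bounded.\<close>

lemma additive_functional_vanishes:
  fixes e :: "'a set \<Rightarrow> nat"
  assumes P: "primeideal P R" and x: "x \<in> carrier R" "x \<notin> P" and u: "u \<in> carrier R" "u \<notin> P"
    and F: "\<And>i::nat. F (adj P (x [^] i))" and F_up: "\<And>K J. F K \<Longrightarrow> ideal J R \<Longrightarrow> K \<subseteq> J \<Longrightarrow> F J"
    and e: "\<And>K a. F K \<Longrightarrow> ideal K R \<Longrightarrow> a \<in> carrier R \<Longrightarrow> e K = e (adj K a) + e (colon K {a})"
  shows "\<exists>k::nat. e (colon (adj (adj P (x [^] Suc k)) u) {x [^] k}) = 0"
proof (rule ccontr)
  assume "\<not> ?thesis"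
  then have pos: "e (colon (adj (adj P (x [^] Suc k)) u) {x [^] k}) \<ge> 1" for k :: nat
    by (metis less_one not_le)
  have Pi: "ideal P R" using P prime_ideal by simp
  let ?K = "\<lambda>i::nat. adj P (x [^] i)" and ?M = "\<lambda>i::nat. adj (adj P (x [^] i)) u"
  have pc: "x [^] i \<in> carrier R" for i :: nat using x by simp
  have Ki: "ideal (?K i) R" for i using adj_ideal[OF Pi pc] .
  have Mi: "ideal (?M i) R" for i using adj_ideal[OF Ki u(1)] .
  have FM: "F (?M i)" for i using F_up[OF F Mi adj_sub[OF Ki u(1)]] .
  have Kx: "adj (?K (Suc i)) (x [^] i) = ?K i" for i
    using adj_adj[OF Pi pc pow_Suc_adj[OF Pi x(1)]] .
  have Mx: "adj (?M (Suc i)) (x [^] i) = ?M i" for i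
    using adj_comm[OF Ki u(1) pc, of "Suc i" i] Kx by simp
  \<comment> \<open>\<open>e(M\<^sub>i)\<close> is unbounded.\<close>
  have Mpos: "e (?M i) \<ge> i" for i
  proof (induction i)
    case (Suc i)
    then show ?case using e[OF FM Mi pc, of "Suc i" i] Mx[of i] pos[of i] by simp
  qed simp
  have cx: "colon (?K (Suc i)) {x [^] i} = ?K 1" for i
  proof
    show "colon (?K (Suc i)) {x [^] i} \<subseteq> ?K 1"
    proof
      fix r assume "r \<in> colon (?K (Suc i)) {x [^] i}"
      then obtain p s where r: "r \<in> carrier R" "r \<otimes> x [^] i = p \<oplus> s \<otimes> x [^] Suc i" "p \<in> P" "s \<in> carrier R"
        by (auto simp: colon_mem1 adj_def)
      have p: "p \<in> carrier R" using r Pi ideal_carr by auto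
      have "(r \<ominus> s \<otimes> x) \<otimes> x [^] i = r \<otimes> x [^] i \<ominus> s \<otimes> (x [^] i \<otimes> x)" using r(1,4) x(1) pc[of i] by algebra
      also have "\<dots> = (p \<oplus> s \<otimes> (x [^] i \<otimes> x)) \<ominus> s \<otimes> (x [^] i \<otimes> x)" using r(2) by simp
      also have "\<dots> = p" using r(4) p x(1) pc[of i] by algebra
      finally have "(r \<ominus> s \<otimes> x) \<otimes> x [^] i \<in> P" using r(3) by simp
      then have "r \<ominus> s \<otimes> x \<in> P"
        using prime_mult[OF P _ pc, of "r \<ominus> s \<otimes> x" i] prime_pow[OF P x(1), of i] x r(1,4) by auto
      moreover have "r = (r \<ominus> s \<otimes> x) \<oplus> s \<otimes> x [^] (1::nat)" using r(1,4) x(1) by (simp) algebra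
      ultimately show "r \<in> ?K 1" using adj_mem[OF _ r(4)] by metis
    qed
    show "?K 1 \<subseteq> colon (?K (Suc i)) {x [^] i}"
    proof (rule adj_least)
      show "ideal (colon (?K (Suc i)) {x [^] i}) R" using colon_ideal[OF Ki[of "Suc i"], of "{x [^] i}"] pc by simp
      show "P \<subseteq> colon (?K (Suc i)) {x [^] i}"
        using subsetD[OF adj_sub[OF Pi pc[of "Suc i"]] ideal_r[OF Pi _ pc]] ideal_carr[OF Pi] by (auto simp: colon_mem1)
      have "x \<otimes> x [^] i = x [^] Suc i" using x(1) pc m_comm by simp
      then show "x [^] (1::nat) \<in> colon (?K (Suc i)) {x [^] i}"
        using x(1) adj_gen[OF Pi pc[of "Suc i"]] by (simp add: colon_mem1)
    qed
  qed
  have eK: "e (?K (j + c)) = e (?K j) + c * e (?K 1)" for j c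
  proof (induction c)
    case (Suc c)
    then show ?case using e[OF F Ki pc, of "Suc (j + c)" "j + c"] Kx[of "j + c"] cx[of "j + c"] by simp
  qed simp
  obtain c where "colon (?K (j + c)) {u} \<subseteq> adj (colon P {u}) (x [^] j)" for j
    using colon_adj_power[OF Pi x(1) u(1)] by blast
  moreover have "colon P {u} = P"
    using prime_mult[OF P _ u(1)] u(2) colon_sub[OF Pi, of "{u}"] u(1) by (auto simp: colon_mem1)
  ultimately have sub: "colon (?K (j + c)) {u} \<subseteq> ?K j" for j by simp
  \<comment> \<open>This choice makes \<open>e(M\<^sub>j\<^sub>+\<^sub>c) \<ge> j + c\<close> exceed the upper bound \<open>c e(K\<^sub>1)\<close>.\<close>
  define j where "j = Suc (c * e (?K 1))"
  let ?D = "colon (?K (j + c)) {u}"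
  have Di: "ideal ?D R" "?K (j + c) \<subseteq> ?D" using colon_ideal[OF Ki] colon_sub[OF Ki] u(1) by auto
  have FD: "F ?D" using F_up[OF F Di] .
  have "P \<subseteq> ?D" using Di(2) adj_sub[OF Pi pc] by blast
  then have "adj ?D (x [^] j) = ?K j"
    using adj_least[OF Ki sub adj_gen[OF Pi pc]] adj_mono by blast
  then have "e (?K j) \<le> e ?D" using e[OF FD Di(1) pc, of j] by simp
  moreover have "e (?K (j + c)) = e (?M (j + c)) + e ?D" using e[OF F Ki u(1)] .
  ultimately have "e (?M (j + c)) \<le> c * e (?K 1)" using eK[of j c] by simp
  then show False using Mpos[of "j + c"] by (simp add: j_def)
qed

text \<open>Krull's principal ideal theorem for \<open>R/P\<close>: if \<open>\<nn>\<close> is the only prime over \<open>P + (w)\<close>, then no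
  prime lies strictly between \<open>P\<close> and \<open>\<nn>\<close>. For \<open>u \<in> Q\<close> outside \<open>P\<close>, the counting lemma with \<open>e\<close>
  the length gives \<open>w\<^sup>k \<in> P + (u) + (w\<^sup>k\<^sup>+\<^sup>1)\<close>; hence \<open>w\<^sup>k \<in> P + (u) \<subseteq> Q\<close>.\<close>

lemma krull_principal:
  assumes P: "primeideal P R" and Q: "primeideal Q R" and PQ: "P \<subset> Q" and w: "w \<in> \<nn>"
    and min: "\<And>P'. primeideal P' R \<Longrightarrow> P \<subseteq> P' \<Longrightarrow> w \<in> P' \<Longrightarrow> P' = \<nn>"
  shows "Q = \<nn>"
proof -
  have Pi: "ideal P R" and Qi: "ideal Q R" using P Q prime_ideal by auto
  have wc: "w \<in> carrier R" using w n_carr by simp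
  have "w \<in> Q"
  proof (cases "w \<in> P")
    case False
    obtain u where u: "u \<in> Q" "u \<notin> P" using PQ by auto
    have uc: "u \<in> carrier R" using u Qi ideal_carr by auto
    have "fin (adj P (w [^] i))" for i :: nat
    proof (rule fin_if_primes)
      show "ideal (adj P (w [^] i)) R" using adj_ideal[OF Pi] wc by simp
      fix P' assume "primeideal P' R" "adj P (w [^] i) \<subseteq> P'"
      moreover from this have "w [^] i \<in> P'" using adj_gen[OF Pi, of "w [^] i"] wc by auto
      ultimately show "P' = \<nn>" using min prime_pow[OF _ wc] adj_sub[OF Pi, of "w [^] i"] wc by auto
    qed
    then obtain k :: nat where k: "len (colon (adj (adj P (w [^] Suc k)) u) {w [^] k}) = 0"
      using additive_functional_vanishes[OF P wc False uc u(2), of fin len] fin_mono len_exact by auto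
    let ?A = "adj (adj P (w [^] Suc k)) u"
    have wk: "w [^] k \<in> carrier R" "w [^] Suc k \<in> carrier R" using wc by auto
    have "fin (colon ?A {w [^] k})"
      using fin_colon[OF fin_adj[OF \<open>fin (adj P (w [^] Suc k))\<close> uc]] wk by simp
    then have "\<one> \<in> colon ?A {w [^] k}" using len_0_iff k by simp
    then have "w [^] k \<in> ?A" using wk by (simp add: colon_mem1)
    then have "w [^] k \<in> adj (adj P u) (w [^] Suc k)" using adj_comm[OF Pi wk(2) uc] by simp
    then have "w [^] k \<in> adj P u" using local_absorb_power[OF adj_ideal[OF Pi uc] w] by blast
    then have "w [^] k \<in> Q" using adj_least[OF Qi, of P u] PQ u by auto
    then show ?thesis using prime_pow[OF Q wc] by simp
  qed (use PQ in auto)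
  then show ?thesis using min[OF Q] PQ by auto
qed

text \<open>For an ideal \<open>K\<close> containing a power of \<open>x\<close>, the length of \<open>R/(K + (y\<^sup>j))\<close> is finite, and its
  increments \<open>D K j\<close> decrease with \<open>j\<close>, so they are eventually constant. This constant \<open>e K\<close> is a
  multiplicity: it is additive, because \<open>colon_adj_power\<close> compares \<open>(K + (y\<^sup>j)) : a\<close> with \<open>(K : a)
  + (y\<^sup>j)\<close> up to a bounded shift of \<open>j\<close>; and it vanishes only if \<open>K\<close> contains a power of \<open>y\<close>. It
  takes the role that the length of the localisation at a prime containing \<open>P\<close> and \<open>x\<close> has in the
  usual proof.\<close>

lemma relation_of_parameters:
  assumes P: "primeideal P R" and x: "x \<in> \<nn>" "x \<notin> P" and y: "y \<in> \<nn>" and u: "u \<in> carrier R" "u \<notin> P"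
    and min: "\<And>Q. primeideal Q R \<Longrightarrow> x \<in> Q \<Longrightarrow> y \<in> Q \<Longrightarrow> Q = \<nn>"
  shows "\<exists>k j::nat. y [^] j \<otimes> x [^] k \<in> adj (adj P (x [^] Suc k)) u"
proof -
  have Pi: "ideal P R" using P prime_ideal by simp
  have xc: "x \<in> carrier R" and yc: "y \<in> carrier R" using x y n_carr by auto
  have pc: "y [^] j \<in> carrier R" "x [^] j \<in> carrier R" for j :: nat using xc yc by auto
  define F where "F K \<longleftrightarrow> ideal K R \<and> (\<exists>i::nat. x [^] i \<in> K)" for K
  define g where "g K j = len (adj K (y [^] (j::nat)))" for K j
  define D where "D K j = len (colon (adj K (y [^] Suc j)) {y [^] (j::nat)})" for K j
  define e where "e K = (LEAST v. \<exists>j. D K j = v)" for K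
  have Fi: "ideal K R" if "F K" for K using that F_def by simp
  have fin: "fin (adj K (y [^] j))" if K: "F K" for K and j :: nat
  proof (rule fin_if_primes)
    show "ideal (adj K (y [^] j)) R" using adj_ideal[OF Fi[OF K] pc(1)] .
    fix Q assume Q: "primeideal Q R" "adj K (y [^] j) \<subseteq> Q"
    obtain i where "x [^] (i::nat) \<in> K" using K F_def by auto
    then have "x [^] i \<in> Q" using adj_sub[OF Fi[OF K] pc(1)] Q(2) by blast
    moreover have "y [^] j \<in> Q" using adj_gen[OF Fi[OF K] pc(1)] Q(2) by blast
    ultimately show "Q = \<nn>" using min[OF Q(1)] prime_pow[OF Q(1)] xc yc by blast
  qed
  have gS: "g K (Suc j) = g K j + D K j" if K: "F K" for K j
    using len_exact[OF fin[OF K] pc(1), of "Suc j" j] adj_adj[OF Fi[OF K] pc(1) pow_Suc_adj[OF Fi[OF K] yc]]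
    by (simp only: g_def D_def)
  have DS: "D K (Suc j) \<le> D K j" if K: "F K" for K j
  proof -
    have "colon (adj K (y [^] Suc j)) {y [^] j} \<subseteq> colon (adj K (y [^] Suc (Suc j))) {y [^] Suc j}"
    proof
      fix r assume "r \<in> colon (adj K (y [^] Suc j)) {y [^] j}"
      then obtain k s where r: "r \<in> carrier R" "r \<otimes> y [^] j = k \<oplus> s \<otimes> y [^] Suc j" "k \<in> K" "s \<in> carrier R"
        by (auto simp: colon_mem1 adj_def)
      have kc: "k \<in> carrier R" using r(3) Fi[OF K] ideal_carr by auto
      have "r \<otimes> y [^] Suc j = (r \<otimes> y [^] j) \<otimes> y" using r(1) pc[of j] yc by (simp add: m_assoc)
      also have "\<dots> = k \<otimes> y \<oplus> s \<otimes> y [^] Suc (Suc j)" unfolding r(2)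
        using r(4) kc yc pc[of j] by (simp add: l_distr m_assoc)
      finally show "r \<in> colon (adj K (y [^] Suc (Suc j))) {y [^] Suc j}"
        using adj_mem[OF ideal_r[OF Fi[OF K] r(3) yc] r(4)] r(1) by (simp only: colon_mem1)
    qed
    then show ?thesis unfolding D_def
      using len_anti[OF fin_colon[OF fin[OF K, of "Suc j"], of "{y [^] j}"]
        colon_ideal[OF adj_ideal[OF Fi[OF K] pc(1)[of "Suc (Suc j)"]], of "{y [^] Suc j}"]]
        pc(1)[of j] pc(1)[of "Suc j"] by blast
  qed
  have De: "\<exists>J. \<forall>j\<ge>J. D K j = e K" if K: "F K" for K
  proof -
    have "\<exists>j. D K j = e K" unfolding e_def by (rule LeastI_ex) auto
    then obtain J where J: "D K J = e K" by auto
    have "D K (J + j) \<le> D K J" for j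
      by (induction j) (use DS[OF K] in \<open>auto intro: le_trans\<close>)
    moreover have "e K \<le> D K j" for j unfolding e_def by (rule Least_le) auto
    ultimately have "D K (J + j) = e K" for j using J by (metis le_antisym)
    then show ?thesis by (metis le_add_diff_inverse)
  qed
  have glin: "\<exists>J. \<forall>N\<ge>J. \<forall>j. g K (N + j) = g K N + j * e K" if K: "F K" for K
  proof -
    obtain J where J: "\<And>j. j \<ge> J \<Longrightarrow> D K j = e K" using De[OF K] by blast
    have "g K (N + j) = g K N + j * e K" if "N \<ge> J" for N j
      by (induction j) (use gS[OF K] J that in auto)
    then show ?thesis by blast
  qed
  have F_up: "F J" if "F K" "ideal J R" "K \<subseteq> J" for K J using that F_def by auto
  have add: "e K = e (adj K a) + e (colon K {a})" if K: "F K" and ac: "a \<in> carrier R" for K a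
  proof -
    have Ki: "ideal K R" using Fi[OF K] .
    let ?K' = "adj K a" and ?K'' = "colon K {a}"
    have K'i: "ideal ?K' R" "F ?K'" using adj_ideal[OF Ki ac] F_up[OF K _ adj_sub[OF Ki ac]] by auto
    have K''i: "ideal ?K'' R" "F ?K''" using colon_ideal[OF Ki] F_up[OF K _ colon_sub[OF Ki]] ac by auto
    define t where "t j = len (colon (adj K (y [^] (j::nat))) {a})" for j
    have g1: "g K j = g ?K' j + t j" for j
      using len_exact[OF fin[OF K] ac, of j] adj_comm[OF Ki pc(1) ac] by (simp add: g_def t_def)
    have t1: "t j \<le> g ?K'' j" for j
    proof -
      have "adj ?K'' (y [^] j) \<subseteq> colon (adj K (y [^] j)) {a}"
      proof (rule adj_least)
        show "ideal (colon (adj K (y [^] j)) {a}) R" using colon_ideal[OF adj_ideal[OF Ki pc(1)]] ac by simp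
        show "?K'' \<subseteq> colon (adj K (y [^] j)) {a}" using colon_mono[OF adj_sub[OF Ki pc(1)]] .
        have "a \<otimes> y [^] j \<in> adj K (y [^] j)" using ideal_l[OF adj_ideal[OF Ki pc(1)] adj_gen[OF Ki pc(1)] ac] .
        then show "y [^] j \<in> colon (adj K (y [^] j)) {a}" using pc m_comm[OF ac pc(1)] by (simp add: colon_mem1)
      qed
      then show ?thesis unfolding t_def g_def
        using len_anti[OF fin[OF K''i(2)]] colon_ideal[OF adj_ideal[OF Ki pc(1)]] ac by simp
    qed
    obtain c where c: "colon (adj K (y [^] (j + c))) {a} \<subseteq> adj ?K'' (y [^] j)" for j :: nat
      using colon_adj_power[OF Ki yc ac] by blast
    have t2: "g ?K'' j \<le> t (j + c)" for j
      unfolding t_def g_def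
      using len_anti[OF fin_colon[OF fin[OF K]] adj_ideal[OF K''i(1) pc(1)] c] ac by simp
    obtain J1 J2 J3 where J:
      "\<And>N j. N \<ge> J1 \<Longrightarrow> g K (N + j) = g K N + j * e K"
      "\<And>N j. N \<ge> J2 \<Longrightarrow> g ?K' (N + j) = g ?K' N + j * e ?K'"
      "\<And>N j. N \<ge> J3 \<Longrightarrow> g ?K'' (N + j) = g ?K'' N + j * e ?K''"
      using glin[OF K] glin[OF K'i(2)] glin[OF K''i(2)] by metis
    define N where "N = J1 + J2 + J3"
    have *: "g K (N + c + j) = g K (N + c) + j * e K" "g ?K' (N + c + j) = g ?K' (N + c) + j * e ?K'"
      "g ?K'' (N + c + j) = g ?K'' (N + c) + j * e ?K''" "g ?K'' (N + j) = g ?K'' N + j * e ?K''" for j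
      using J by (auto simp: N_def)
    have up: "g K (N + c) + j * e K \<le> (g ?K' (N + c) + g ?K'' (N + c)) + j * (e ?K' + e ?K'')" for j
      using g1[of "N + c + j"] t1[of "N + c + j"] *[of j] by (simp add: algebra_simps)
    have lo: "(g ?K' (N + c) + g ?K'' N) + j * (e ?K' + e ?K'') \<le> g K (N + c) + j * e K" for j
      using g1[of "N + c + j"] t2[of "N + j"] *[of j] by (simp add: algebra_simps)
    show ?thesis using linear_slope_le[OF up] linear_slope_le[OF lo] by (rule le_antisym)
  qed
  have FP: "F (adj P (x [^] i))" for i :: nat
    using adj_ideal[OF Pi pc(2)] adj_gen[OF Pi pc(2)] F_def by auto
  obtain k :: nat where k: "e (colon (adj (adj P (x [^] Suc k)) u) {x [^] k}) = 0"
    using additive_functional_vanishes[OF P xc x(2) u, of F e] FP F_up add by blast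
  let ?A = "adj (adj P (x [^] Suc k)) u"
  let ?K = "colon ?A {x [^] k}"
  have Ai: "ideal ?A R" using adj_ideal[OF adj_ideal[OF Pi pc(2)] u(1)] .
  have Ki: "ideal ?K R" using colon_ideal[OF Ai] pc by simp
  have FK: "F ?K"
    using F_up[OF F_up[OF FP Ai adj_sub[OF adj_ideal[OF Pi pc(2)] u(1)]] Ki colon_sub[OF Ai]] pc by simp
  obtain j where "D ?K j = 0" using De[OF FK] k by auto
  then have "\<one> \<in> colon (adj ?K (y [^] Suc j)) {y [^] j}"
    using len_0_iff[OF fin_colon[OF fin[OF FK, of "Suc j"], of "{y [^] j}"]] pc(1)[of j]
    unfolding D_def by (metis empty_subsetI insert_subset one_closed)
  then have "y [^] j \<in> adj ?K (y [^] Suc j)" using pc by (simp add: colon_mem1)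
  then have "y [^] j \<in> ?K" using local_absorb_power[OF Ki y] by blast
  then show ?thesis by (auto simp: colon_mem1)
qed

text \<open>Suppose that \<open>\<nn>\<close> is the only prime over \<open>(x, y)\<close>. Then \<open>x \<notin> P\<^sub>1\<close>, since otherwise the principal
  ideal theorem for \<open>y\<close> modulo \<open>P\<^sub>1\<close> would give \<open>P\<^sub>2 = \<nn>\<close>. The relation \<open>y\<^sup>j x\<^sup>k \<in> P\<^sub>0 + (x\<^sup>k\<^sup>+\<^sup>1)
  + (u)\<close> with \<open>u \<in> P\<^sub>1\<close> can be cancelled modulo \<open>P\<^sub>1\<close> to \<open>y\<^sup>j - sx \<in> P\<^sub>1\<close>. So a prime over \<open>P\<^sub>1 +
  (x)\<close> contains \<open>y\<close> and is \<open>\<nn>\<close>, and the principal ideal theorem for \<open>x\<close> gives \<open>P\<^sub>2 = \<nn>\<close> again.\<close>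

lemma krull_height_two:
  assumes P: "primeideal P0 R" "primeideal P1 R" "primeideal P2 R" "P0 \<subset> P1" "P1 \<subset> P2" "P2 \<noteq> \<nn>"
    and x: "x \<in> \<nn>" and y: "y \<in> \<nn>"
  shows "\<exists>Q. primeideal Q R \<and> x \<in> Q \<and> y \<in> Q \<and> Q \<noteq> \<nn>"
proof (rule ccontr)
  assume "\<not> ?thesis"
  then have min: "\<And>Q. primeideal Q R \<Longrightarrow> x \<in> Q \<Longrightarrow> y \<in> Q \<Longrightarrow> Q = \<nn>" by blast
  have xc: "x \<in> carrier R" and yc: "y \<in> carrier R" using x y n_carr by auto
  have P1i: "ideal P1 R" using P(2) prime_ideal by simp
  have "x \<notin> P1"
    using krull_principal[OF P(2,3,5) y] min P(6) by blast
  obtain u where u: "u \<in> P1" "u \<notin> P0" using P(4) by auto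
  have uc: "u \<in> carrier R" using u P1i ideal_carr by auto
  obtain k j :: nat where kj: "y [^] j \<otimes> x [^] k \<in> adj (adj P0 (x [^] Suc k)) u"
    using relation_of_parameters[OF P(1) x _ y uc u(2) min] \<open>x \<notin> P1\<close> P(4) by blast
  then obtain p s t where p: "y [^] j \<otimes> x [^] k = p \<oplus> s \<otimes> x [^] Suc k \<oplus> t \<otimes> u" "p \<in> P0"
    "s \<in> carrier R" "t \<in> carrier R" by (auto simp: adj_def)
  have pP: "p \<in> P1" using p P(4) by auto
  have pc: "p \<in> carrier R" using pP P1i ideal_carr by auto
  have q: "y [^] j \<in> carrier R" "x [^] k \<in> carrier R" using xc yc by auto
  have "(y [^] j \<ominus> s \<otimes> x) \<otimes> x [^] k = y [^] j \<otimes> x [^] k \<ominus> s \<otimes> (x [^] k \<otimes> x)" using q p(3) xc by algebra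
  also have "\<dots> = (p \<oplus> s \<otimes> (x [^] k \<otimes> x) \<oplus> t \<otimes> u) \<ominus> s \<otimes> (x [^] k \<otimes> x)" using p(1) by simp
  also have "\<dots> = p \<oplus> t \<otimes> u" using pc p(3,4) q xc uc by algebra
  also have "\<dots> \<in> P1" using ideal_add[OF P1i pP ideal_l[OF P1i u(1) p(4)]] .
  finally have w: "y [^] j \<ominus> s \<otimes> x \<in> P1"
    using prime_mult[OF P(2) _ q(2), of "y [^] j \<ominus> s \<otimes> x"] prime_pow[OF P(2) xc] \<open>x \<notin> P1\<close> q p(3) xc by auto
  have "P2 = \<nn>"
  proof (rule krull_principal[OF P(2,3,5) x])
    fix Q assume Q: "primeideal Q R" "P1 \<subseteq> Q" "x \<in> Q"
    have Qi: "ideal Q R" using Q prime_ideal by simp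
    have "y [^] j = (y [^] j \<ominus> s \<otimes> x) \<oplus> s \<otimes> x" using q p(3) xc by algebra
    also have "\<dots> \<in> Q" using ideal_add[OF Qi _ ideal_l[OF Qi Q(3) p(3)]] w Q(2) by blast
    finally show "Q = \<nn>" using min[OF Q(1,3)] prime_pow[OF Q(1) yc] by blast
  qed
  then show False using P(6) by simp
qed

end

section \<open>Three generators of a maximal ideal of height three\<close>

context cring
begin

text \<open>The powers of \<open>(x, y, z)\<close>.\<close>

primrec pw :: "'a \<Rightarrow> 'a \<Rightarrow> 'a \<Rightarrow> nat \<Rightarrow> 'a set" where
  "pw x y z 0 = carrier R"
| "pw x y z (Suc t) = {x \<otimes> a \<oplus> y \<otimes> b \<oplus> z \<otimes> c | a b c. a \<in> pw x y z t \<and> b \<in> pw x y z t \<and> c \<in> pw x y z t}"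

text \<open>The powers of \<open>(x, y)\<close>, written as \<open>(x, y)\<^sup>t\<^sup>+\<^sup>1 = x (x, y)\<^sup>t + (y\<^sup>t\<^sup>+\<^sup>1)\<close>. In this form only
  the coefficient of \<open>y\<^sup>t\<^sup>+\<^sup>1\<close> is new in each step, which suits inductions that read off the
  coefficients of a form.\<close>

primrec qw :: "'a \<Rightarrow> 'a \<Rightarrow> nat \<Rightarrow> 'a set" where
  "qw x y 0 = carrier R"
| "qw x y (Suc t) = {x \<otimes> a \<oplus> y [^] Suc t \<otimes> r | a r. a \<in> qw x y t \<and> r \<in> carrier R}"

end

locale three_gens = cring +
  fixes x y z assumes xc [simp]: "x \<in> carrier R" and yc [simp]: "y \<in> carrier R" and zc [simp]: "z \<in> carrier R"
begin

lemma pwE: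
  assumes "a \<in> pw x y z (Suc t)"
  obtains u v w where "a = x \<otimes> u \<oplus> y \<otimes> v \<oplus> z \<otimes> w" "u \<in> pw x y z t" "v \<in> pw x y z t" "w \<in> pw x y z t"
  using assms unfolding pw.simps by blast

lemma qwE:
  assumes "a \<in> qw x y (Suc t)"
  obtains u r where "a = x \<otimes> u \<oplus> y [^] Suc t \<otimes> r" "u \<in> qw x y t" "r \<in> carrier R"
  using assms unfolding qw.simps by blast

lemma qw_mem: "u \<in> qw x y t \<Longrightarrow> r \<in> carrier R \<Longrightarrow> x \<otimes> u \<oplus> y [^] Suc t \<otimes> r \<in> qw x y (Suc t)"
  unfolding qw.simps by blast

lemma pw_mem: "a \<in> pw x y z t \<Longrightarrow> b \<in> pw x y z t \<Longrightarrow> c \<in> pw x y z t \<Longrightarrow> x \<otimes> a \<oplus> y \<otimes> b \<oplus> z \<otimes> c \<in> pw x y z (Suc t)"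
  by auto

lemma step_ideal:
  assumes I: "ideal I R"
  shows "ideal {x \<otimes> a \<oplus> y \<otimes> b \<oplus> z \<otimes> c | a b c. a \<in> I \<and> b \<in> I \<and> c \<in> I} R" (is "ideal ?S R")
proof (rule idealI')
  have mem: "x \<otimes> a \<oplus> y \<otimes> b \<oplus> z \<otimes> c \<in> ?S" if "a \<in> I" "b \<in> I" "c \<in> I" for a b c using that by blast
  show "?S \<subseteq> carrier R" using ideal_carr[OF I] by auto
  show "\<zero> \<in> ?S" using mem[of \<zero> \<zero> \<zero>] ideal_zero[OF I] by simp
  fix u assume "u \<in> ?S"
  then obtain a b c where u: "u = x \<otimes> a \<oplus> y \<otimes> b \<oplus> z \<otimes> c" "a \<in> I" "b \<in> I" "c \<in> I" by auto
  have uc: "a \<in> carrier R" "b \<in> carrier R" "c \<in> carrier R" using u ideal_carr[OF I] by auto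
  { fix v assume "v \<in> ?S"
    then obtain a' b' c' where v: "v = x \<otimes> a' \<oplus> y \<otimes> b' \<oplus> z \<otimes> c'" "a' \<in> I" "b' \<in> I" "c' \<in> I" by auto
    have vc: "a' \<in> carrier R" "b' \<in> carrier R" "c' \<in> carrier R" using v ideal_carr[OF I] by auto
    have "u \<oplus> v = x \<otimes> (a \<oplus> a') \<oplus> y \<otimes> (b \<oplus> b') \<oplus> z \<otimes> (c \<oplus> c')"
      unfolding u(1) v(1) using uc vc xc yc zc by algebra
    then show "u \<oplus> v \<in> ?S" using mem u v ideal_add[OF I] by simp }
  { fix r assume r: "r \<in> carrier R"
    have "r \<otimes> u = x \<otimes> (r \<otimes> a) \<oplus> y \<otimes> (r \<otimes> b) \<oplus> z \<otimes> (r \<otimes> c)"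
      unfolding u(1) using uc r xc yc zc by algebra
    then show "r \<otimes> u \<in> ?S" using mem u ideal_l[OF I _ r] by simp }
qed

lemma step_least:
  assumes K: "ideal K R" and I: "\<And>i. i \<in> I \<Longrightarrow> x \<otimes> i \<in> K \<and> y \<otimes> i \<in> K \<and> z \<otimes> i \<in> K"
  shows "{x \<otimes> a \<oplus> y \<otimes> b \<oplus> z \<otimes> c | a b c. a \<in> I \<and> b \<in> I \<and> c \<in> I} \<subseteq> K"
  using I by (auto intro!: ideal_add[OF K])

lemma step_mem:
  assumes I: "ideal I R" and r: "r \<in> pw x y z (Suc 0)" and i: "i \<in> I"
  shows "r \<otimes> i \<in> {x \<otimes> a \<oplus> y \<otimes> b \<oplus> z \<otimes> c | a b c. a \<in> I \<and> b \<in> I \<and> c \<in> I}"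
proof -
  obtain u v w where u: "r = x \<otimes> u \<oplus> y \<otimes> v \<oplus> z \<otimes> w" "u \<in> carrier R" "v \<in> carrier R" "w \<in> carrier R"
    using r by (auto elim: pwE)
  have "r \<otimes> i = x \<otimes> (u \<otimes> i) \<oplus> y \<otimes> (v \<otimes> i) \<oplus> z \<otimes> (w \<otimes> i)"
    unfolding u(1) using u(2-4) ideal_carr[OF I i] xc yc zc by algebra
  then show ?thesis using ideal_l[OF I i] u(2-4) by blast
qed

lemma pw_ideal: "ideal (pw x y z t) R"
  by (induction t) (use oneideal step_ideal in auto)

lemma pw_carr: "a \<in> pw x y z t \<Longrightarrow> a \<in> carrier R"
  using ideal_carr[OF pw_ideal] .

lemma pw_gens: 
  assumes "a \<in> pw x y z t"
  shows "x \<otimes> a \<in> pw x y z (Suc t)" "y \<otimes> a \<in> pw x y z (Suc t)" "z \<otimes> a \<in> pw x y z (Suc t)"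
  using pw_mem[of a t \<zero> \<zero>] pw_mem[of \<zero> t a \<zero>] pw_mem[of \<zero> t \<zero> a] assms ideal_zero[OF pw_ideal, of t] pw_carr[OF assms]
  by simp_all

lemma pw_decr: "pw x y z (Suc t) \<subseteq> pw x y z t"
  using ideal_add[OF pw_ideal] ideal_l[OF pw_ideal] by auto

lemma pw_anti: "s \<le> t \<Longrightarrow> pw x y z t \<subseteq> pw x y z s"
  by (induction rule: dec_induct) (use pw_decr in blast)+

lemma pw_mult: "b \<in> pw x y z i \<Longrightarrow> c \<in> pw x y z j \<Longrightarrow> b \<otimes> c \<in> pw x y z (i + j)"
proof (induction i arbitrary: b)
  case 0
  then show ?case using ideal_l[OF pw_ideal] by simp
next
  case (Suc i)
  then obtain u v w where u: "b = x \<otimes> u \<oplus> y \<otimes> v \<oplus> z \<otimes> w" "u \<in> pw x y z i" "v \<in> pw x y z i" "w \<in> pw x y z i" by (blast elim: pwE)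
  have "b \<otimes> c = x \<otimes> (u \<otimes> c) \<oplus> y \<otimes> (v \<otimes> c) \<oplus> z \<otimes> (w \<otimes> c)"
    unfolding u(1) using u(2-4)[THEN pw_carr] pw_carr[OF Suc.prems(2)] xc yc zc by algebra
  then show ?case using pw_mem[OF Suc.IH[OF u(2)] Suc.IH[OF u(3)] Suc.IH[OF u(4)]] Suc.prems by simp
qed

lemma pw_pow: "x [^] t \<in> pw x y z t" "y [^] t \<in> pw x y z t"  "z [^] t \<in> pw x y z t"
proof -
  have "x [^] t \<in> pw x y z t \<and> y [^] t \<in> pw x y z t \<and> z [^] t \<in> pw x y z t"
  proof (induction t)
    case (Suc t)
    then show ?case using pw_gens m_comm[of "_ [^] t"] by (simp del: pw.simps)
  qed simp
  then show "x [^] t \<in> pw x y z t" "y [^] t \<in> pw x y z t"  "z [^] t \<in> pw x y z t" by auto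
qed

lemma qw_carr: "a \<in> qw x y t \<Longrightarrow> a \<in> carrier R"
  by (induction t arbitrary: a) auto

lemma qw_add: "a \<in> qw x y t \<Longrightarrow> b \<in> qw x y t \<Longrightarrow> a \<oplus> b \<in> qw x y t"
proof (induction t arbitrary: a b)
  case (Suc t)
  obtain u r where u: "a = x \<otimes> u \<oplus> y [^] Suc t \<otimes> r" "u \<in> qw x y t" "r \<in> carrier R" using Suc.prems by (blast elim: qwE)
  obtain v s where v: "b = x \<otimes> v \<oplus> y [^] Suc t \<otimes> s" "v \<in> qw x y t" "s \<in> carrier R" using Suc.prems by (blast elim: qwE)
  have "y [^] Suc t \<in> carrier R" by simp
  then have "a \<oplus> b = x \<otimes> (u \<oplus> v) \<oplus> y [^] Suc t \<otimes> (r \<oplus> s)"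
    unfolding u(1) v(1) using qw_carr[OF u(2)] qw_carr[OF v(2)] u(3) v(3) xc by algebra
  then show ?case using qw_mem[OF Suc.IH[OF u(2) v(2)]] u(3) v(3) by simp
qed simp

lemma qw_l: "a \<in> qw x y t \<Longrightarrow> s \<in> carrier R \<Longrightarrow> s \<otimes> a \<in> qw x y t"
proof (induction t arbitrary: a)
  case (Suc t)
  obtain u r where u: "a = x \<otimes> u \<oplus> y [^] Suc t \<otimes> r" "u \<in> qw x y t" "r \<in> carrier R" using Suc.prems by (blast elim: qwE)
  have "y [^] Suc t \<in> carrier R" by simp
  then have "s \<otimes> a = x \<otimes> (s \<otimes> u) \<oplus> y [^] Suc t \<otimes> (s \<otimes> r)"
    unfolding u(1) using qw_carr[OF u(2)] u(3) Suc.prems(2) xc by algebra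
  then show ?case using qw_mem[OF Suc.IH[OF u(2) Suc.prems(2)]] u(3) Suc.prems(2) by simp
qed simp

lemma qw_zero: "\<zero> \<in> qw x y t"
proof (induction t)
  case (Suc t)
  have "y [^] Suc t \<in> carrier R" by simp
  then have "\<zero> = x \<otimes> \<zero> \<oplus> y [^] Suc t \<otimes> \<zero>" using xc by algebra
  then show ?case using qw_mem[OF Suc zero_closed] by metis
qed simp

lemma qw_ideal: "ideal (qw x y t) R"
  by (rule idealI') (use qw_carr qw_add qw_l qw_zero in auto)

lemma qw_x: "a \<in> qw x y t \<Longrightarrow> x \<otimes> a \<in> qw x y (Suc t)"
proof -
  assume a: "a \<in> qw x y t"
  have "y [^] Suc t \<in> carrier R" by simp
  then have "x \<otimes> a = x \<otimes> a \<oplus> y [^] Suc t \<otimes> \<zero>" using xc qw_carr[OF a] by algebra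
  then show ?thesis using qw_mem[OF a zero_closed] by metis
qed

lemma qw_pow: "y [^] t \<in> qw x y t"
proof (cases t)
  case (Suc s)
  have "y [^] Suc s \<in> carrier R" by simp
  then have "y [^] Suc s = x \<otimes> \<zero> \<oplus> y [^] Suc s \<otimes> \<one>" using xc by algebra
  then show ?thesis unfolding Suc using qw_mem[OF qw_zero one_closed] by metis
qed simp

lemma qw_y: "a \<in> qw x y t \<Longrightarrow> y \<otimes> a \<in> qw x y (Suc t)"
proof (induction t arbitrary: a)
  case 0
  then have "y \<otimes> a = x \<otimes> \<zero> \<oplus> y [^] Suc 0 \<otimes> a" by simp
  then show ?case using qw_mem[OF qw_zero, of a 0] 0 by (metis qw.simps(1))
next
  case (Suc t)
  obtain u r where u: "a = x \<otimes> u \<oplus> y [^] Suc t \<otimes> r" "u \<in> qw x y t" "r \<in> carrier R" using Suc.prems by (blast elim: qwE)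
  have p: "y [^] Suc t \<in> carrier R" by simp
  then have "y \<otimes> a = x \<otimes> (y \<otimes> u) \<oplus> (y [^] Suc t \<otimes> y) \<otimes> r"
    unfolding u(1) using qw_carr[OF u(2)] u(3) xc yc by algebra
  then have "y \<otimes> a = x \<otimes> (y \<otimes> u) \<oplus> y [^] Suc (Suc t) \<otimes> r" by simp
  then show ?case using qw_mem[OF Suc.IH[OF u(2)] u(3)] by metis
qed

lemma qw_sub_pw: "qw x y t \<subseteq> pw x y z t"
proof (induction t)
  case (Suc t)
  show ?case
  proof
    fix a assume "a \<in> qw x y (Suc t)"
    then obtain u r where u: "a = x \<otimes> u \<oplus> y [^] Suc t \<otimes> r" "u \<in> qw x y t" "r \<in> carrier R" by (rule qwE)
    then show "a \<in> pw x y z (Suc t)"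
      using ideal_add[OF pw_ideal pw_gens(1) ideal_r[OF pw_ideal pw_pow(2)]] Suc by blast
  qed
qed simp

lemma pw_decomp: "a \<in> pw x y z (Suc t) \<Longrightarrow> \<exists>q\<in>qw x y (Suc t). \<exists>b\<in>pw x y z t. a = q \<oplus> z \<otimes> b"
proof (induction t arbitrary: a)
  case 0
  then obtain u v w where u: "a = x \<otimes> u \<oplus> y \<otimes> v \<oplus> z \<otimes> w" "u \<in> carrier R" "v \<in> carrier R" "w \<in> carrier R" by (auto elim: pwE)
  have "x \<otimes> u \<oplus> y \<otimes> v \<in> qw x y (Suc 0)" using qw_add[OF qw_x qw_y] u by (simp del: qw.simps(2))
  then show ?case using u by auto
next
  case (Suc t)
  obtain u v w where u: "a = x \<otimes> u \<oplus> y \<otimes> v \<oplus> z \<otimes> w" "u \<in> pw x y z (Suc t)" "v \<in> pw x y z (Suc t)" "w \<in> pw x y z (Suc t)"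
    using Suc.prems by (blast elim: pwE)
  obtain q1 b1 where 1: "q1 \<in> qw x y (Suc t)" "b1 \<in> pw x y z t" "u = q1 \<oplus> z \<otimes> b1" using Suc.IH[OF u(2)] by blast
  obtain q2 b2 where 2: "q2 \<in> qw x y (Suc t)" "b2 \<in> pw x y z t" "v = q2 \<oplus> z \<otimes> b2" using Suc.IH[OF u(3)] by blast
  have "a = (x \<otimes> q1 \<oplus> y \<otimes> q2) \<oplus> z \<otimes> (x \<otimes> b1 \<oplus> y \<otimes> b2 \<oplus> w)"
    unfolding u(1) 1(3) 2(3) using qw_carr[OF 1(1)] qw_carr[OF 2(1)] pw_carr[OF 1(2)] pw_carr[OF 2(2)] pw_carr[OF u(4)]
      xc yc zc by algebra
  moreover have "x \<otimes> q1 \<oplus> y \<otimes> q2 \<in> qw x y (Suc (Suc t))" using qw_add[OF qw_x[OF 1(1)] qw_y[OF 2(1)]] .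
  moreover have "x \<otimes> b1 \<oplus> y \<otimes> b2 \<oplus> w \<in> pw x y z (Suc t)"
    using ideal_add[OF pw_ideal ideal_add[OF pw_ideal pw_gens(1)[OF 1(2)] pw_gens(2)[OF 2(2)]] u(4)] .
  ultimately show ?case by blast
qed

end

text \<open>Three generators of the maximal ideal, and dimension three in the form that Krull's height
  theorem gives it: two elements of \<open>\<nn>\<close> never generate an ideal with \<open>\<nn>\<close> as its only prime.\<close>

locale height_three = noeth_local R \<nn> + three_gens R x y z for R (structure) and \<nn> x y z +
  assumes gens: "x \<in> \<nn>" "y \<in> \<nn>" "z \<in> \<nn>"
    and generate: "\<nn> \<subseteq> adj (adj (adj {\<zero>} x) y) z"
    and height: "\<And>u v. u \<in> \<nn> \<Longrightarrow> v \<in> \<nn> \<Longrightarrow> \<exists>Q. primeideal Q R \<and> u \<in> Q \<and> v \<in> Q \<and> Q \<noteq> \<nn>"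
begin

abbreviation "Jx \<equiv> adj {\<zero>} x"
abbreviation "Jxy \<equiv> adj Jx y"

lemma Jx_ideal: "ideal Jx R" and Jxy_ideal: "ideal Jxy R"
  using adj_ideal zeroideal by auto

lemma Jx_mem: "a \<in> Jx \<longleftrightarrow> (\<exists>r\<in>carrier R. a = r \<otimes> x)"
proof
  assume "a \<in> Jx"
  then obtain r where r: "a = \<zero> \<oplus> r \<otimes> x" "r \<in> carrier R" by (auto simp: adj_def)
  then show "\<exists>r\<in>carrier R. a = r \<otimes> x" using l_zero[of "r \<otimes> x"] by auto
next
  assume "\<exists>r\<in>carrier R. a = r \<otimes> x"
  then obtain r where r: "r \<in> carrier R" "a = r \<otimes> x" by auto
  then show "a \<in> Jx" using adj_mem[of \<zero> "{\<zero>}" r x] by simp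
qed

lemma prime_n: assumes "primeideal Q R" "x \<in> Q" "y \<in> Q" "z \<in> Q" shows "Q = \<nn>"
proof -
  have Q: "ideal Q R" using assms prime_ideal by simp
  have "\<nn> \<subseteq> Q"
    using generate assms adj_least[OF Q adj_least[OF Q adj_least[OF Q]]] ideal_zero[OF Q] by blast
  then show ?thesis using prime_sub_n[OF assms(1)] by blast
qed

text \<open>Such a prime \<open>Q\<close> does not contain \<open>z\<close>. So \<open>z\<close> is a nonzerodivisor modulo \<open>Q\<close>, and \<open>Q \<subseteq> (x, y) +
  (z)\<close>; cancelling \<open>z\<close> gives \<open>Q \<subseteq> (x, y)\<close>.\<close>

lemma prime_Jxy: assumes Q: "primeideal Q R" "x \<in> Q" "y \<in> Q" "Q \<noteq> \<nn>" shows "Q = Jxy"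
proof
  have Qi: "ideal Q R" using Q prime_ideal by simp
  show s: "Jxy \<subseteq> Q" using adj_least[OF Qi adj_least[OF Qi]] Q ideal_zero[OF Qi] by auto
  have zQ: "z \<notin> Q" using prime_n Q by blast
  show "Q \<subseteq> Jxy"
  proof (rule nakayama_cancel[OF Jxy_ideal Qi s gens(3)])
    show "Q \<subseteq> adj Jxy z" using generate prime_sub_n[OF Q(1)] by blast
    show "r \<in> Q" if "r \<in> carrier R" "r \<otimes> z \<in> Q" for r
      using prime_mult[OF Q(1) that(1) zc that(2)] zQ by blast
  qed
qed

lemma Jxy_prime: "primeideal Jxy R" and z_Jxy: "z \<notin> Jxy"
proof -
  obtain Q where Q: "primeideal Q R" "x \<in> Q" "y \<in> Q" "Q \<noteq> \<nn>" using height[OF gens(1,2)] by auto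
  then have e: "Q = Jxy" by (rule prime_Jxy)
  show "primeideal Jxy R" "z \<notin> Jxy" using Q prime_n[OF Q(1-3)] e by auto
qed

text \<open>Let \<open>\<aa>\<close> consist of the elements multiplied into \<open>(x)\<close> by a power of \<open>y\<close>. For \<open>a \<in> \<aa>\<close> choose a
  prime \<open>Q \<noteq> \<nn>\<close> containing \<open>x\<close> and \<open>y + a\<close>. It contains a product of \<open>a\<close> with a power of \<open>y\<close>,
  hence \<open>a\<close> or \<open>y\<close>, hence both. So \<open>Q = (x, y)\<close> and \<open>\<aa> \<subseteq> (x, y)\<close>. Since \<open>y\<close> is a nonzerodivisor
  modulo \<open>\<aa>\<close>, it follows that \<open>\<aa> = (x)\<close>.\<close>

lemma y_regular: assumes r: "r \<in> carrier R" "y \<otimes> r \<in> Jx" shows "r \<in> Jx"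
proof -
  obtain c where c: "\<And>n. n \<ge> c \<Longrightarrow> colon Jx {y [^] (n::nat)} = colon Jx {y [^] (c::nat)}"
    using colon_power_stable[OF Jx_ideal yc] by blast
  let ?a = "colon Jx {y [^] c}"
  have ai: "ideal ?a R" using colon_ideal[OF Jx_ideal] by simp
  have "?a \<noteq> carrier R"
  proof
    assume "?a = carrier R"
    then have "\<one> \<in> ?a" by simp
    then have "y [^] c \<in> Jx" by (simp add: colon_mem1)
    moreover obtain Q where Q: "primeideal Q R" "x \<in> Q" "z \<in> Q" "Q \<noteq> \<nn>" using height[OF gens(1,3)] by auto
    ultimately have "y [^] c \<in> Q" using ideal_l[OF prime_ideal[OF Q(1)] Q(2)] by (auto simp: Jx_mem)
    then show False using prime_pow[OF Q(1)] prime_n Q by auto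
  qed
  then have an: "?a \<subseteq> \<nn>" using proper_sub_n[OF ai] by simp
  have aXY: "?a \<subseteq> Jxy"
  proof
    fix a assume a: "a \<in> ?a"
    have ac: "a \<in> carrier R" using a by (simp add: colon_mem1)
    obtain Q where Q: "primeideal Q R" "x \<in> Q" "y \<oplus> a \<in> Q" "Q \<noteq> \<nn>"
      using height[OF gens(1) ideal_add[OF n_ideal gens(2)]] a an by blast
    have Qi: "ideal Q R" using Q prime_ideal by simp
    have "a \<otimes> y [^] c \<in> Q" using a ideal_l[OF Qi Q(2)] by (auto simp: colon_mem1 Jx_mem)
    then have "a \<in> Q \<and> y \<in> Q" using prime_sum_mem[OF Q(1,3)] yc ac by blast
    then show "a \<in> Jxy" using prime_Jxy[OF Q(1,2) _ Q(4)] by blast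
  qed
  note cancel = colon_power_cancel[OF c yc]
  have "?a \<subseteq> Jx"
    using nakayama_cancel[OF Jx_ideal ai colon_sub[OF Jx_ideal] gens(2) aXY cancel] by simp
  moreover have "r \<in> ?a"
    using cancel[OF _ r(1)] m_comm[OF r(1) yc] r(2) colon_sub[OF Jx_ideal, of "{y [^] c}"] by auto
  ultimately show ?thesis by blast
qed

text \<open>The same argument with one more layer. Let \<open>\<aa>\<close> consist of the elements annihilated by a power
  of \<open>x\<close>, and \<open>\<cc>\<close> of those multiplied into \<open>\<aa> + (x)\<close> by a power of \<open>y\<close>. Primes containing elements
  \<open>x + a\<close> and \<open>y + b\<close> with \<open>a \<in> \<aa>\<close>, \<open>b \<in> \<cc>\<close> show that \<open>\<cc> \<subseteq> (x, y)\<close>. Cancelling \<open>y\<close> gives \<open>\<cc> =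
  (x)\<close>; then \<open>\<aa> \<subseteq> (x)\<close>, and cancelling \<open>x\<close> gives \<open>\<aa> = 0\<close>.\<close>

lemma x_regular: assumes r: "r \<in> carrier R" "x \<otimes> r = \<zero>" shows "r = \<zero>"
proof -
  have Z: "ideal {\<zero>} R" by (rule zeroideal)
  obtain c where c: "\<And>n. n \<ge> c \<Longrightarrow> colon {\<zero>} {x [^] (n::nat)} = colon {\<zero>} {x [^] (c::nat)}"
    using colon_power_stable[OF Z xc] by blast
  let ?a = "colon {\<zero>} {x [^] c}"
  let ?b = "adj ?a x"
  have ai: "ideal ?a R" using colon_ideal[OF Z] by simp
  have bi: "ideal ?b R" using adj_ideal[OF ai xc] .
  obtain l where l: "\<And>n. n \<ge> l \<Longrightarrow> colon ?b {y [^] (n::nat)} = colon ?b {y [^] (l::nat)}"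
    using colon_power_stable[OF bi yc] by blast
  let ?c = "colon ?b {y [^] l}"
  have ci: "ideal ?c R" using colon_ideal[OF bi] by simp
  have both: "a \<in> Q \<and> x \<in> Q" if Q: "primeideal Q R" "x \<oplus> a \<in> Q" and a: "a \<in> ?a" for Q a
    using prime_sum_mem[OF Q, of c] a ideal_zero[OF prime_ideal[OF Q(1)]] by (simp add: colon_mem1)
  have "?a \<noteq> carrier R"
  proof
    assume "?a = carrier R"
    then have "\<one> \<in> ?a" by simp
    then have "x [^] c = \<zero>" by (simp add: colon_mem1)
    moreover obtain Q where Q: "primeideal Q R" "y \<in> Q" "z \<in> Q" "Q \<noteq> \<nn>" using height[OF gens(2,3)] by auto
    ultimately have "x [^] c \<in> Q" using ideal_zero[OF prime_ideal[OF Q(1)]] by simp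
    then show False using prime_pow[OF Q(1)] prime_n Q by auto
  qed
  then have an: "?a \<subseteq> \<nn>" using proper_sub_n[OF ai] by simp
  have "?c \<noteq> carrier R"
  proof
    assume "?c = carrier R"
    then have "\<one> \<in> ?c" by simp
    then have "y [^] l \<in> ?b" by (simp add: colon_mem1)
    then obtain a s where s: "y [^] l = a \<oplus> s \<otimes> x" "a \<in> ?a" "s \<in> carrier R" by (auto simp: adj_def)
    obtain Q where Q: "primeideal Q R" "x \<oplus> a \<in> Q" "z \<in> Q" "Q \<noteq> \<nn>"
      using height[OF ideal_add[OF n_ideal gens(1)] gens(3)] s an by blast
    have Qi: "ideal Q R" using Q prime_ideal by simp
    have q: "a \<in> Q" "x \<in> Q" using both[OF Q(1,2) s(2)] by auto
    then have "y [^] l \<in> Q" unfolding s(1) using ideal_add[OF Qi _ ideal_l[OF Qi _ s(3)]] by blast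
    then show False using prime_pow[OF Q(1)] prime_n Q q by auto
  qed
  then have cn: "?c \<subseteq> \<nn>" using proper_sub_n[OF ci] by simp
  have cXY: "?c \<subseteq> Jxy"
  proof
    fix b assume b: "b \<in> ?c"
    have bc: "b \<in> carrier R" using b by (simp add: colon_mem1)
    obtain a s where s: "b \<otimes> y [^] l = a \<oplus> s \<otimes> x" "a \<in> ?a" "s \<in> carrier R"
      using b by (auto simp: colon_mem1 adj_def)
    obtain Q where Q: "primeideal Q R" "x \<oplus> a \<in> Q" "y \<oplus> b \<in> Q" "Q \<noteq> \<nn>"
      using height[OF ideal_add[OF n_ideal gens(1)] ideal_add[OF n_ideal gens(2)]] s b an cn by blast
    have Qi: "ideal Q R" using Q prime_ideal by simp
    have q: "a \<in> Q" "x \<in> Q" using both[OF Q(1,2) s(2)] by auto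
    then have "b \<otimes> y [^] l \<in> Q" unfolding s(1) using ideal_add[OF Qi _ ideal_l[OF Qi _ s(3)]] by blast
    then have "b \<in> Q \<and> y \<in> Q" using prime_sum_mem[OF Q(1,3)] yc bc by blast
    then show "b \<in> Jxy" using prime_Jxy[OF Q(1) q(2) _ Q(4)] by blast
  qed
  have Xb: "Jx \<subseteq> ?b" using adj_mono ideal_zero[OF ai] by simp
  have bc: "?b \<subseteq> ?c" using colon_sub[OF bi] by simp
  have cX: "?c \<subseteq> Jx"
    using nakayama_cancel[OF Jx_ideal ci subset_trans[OF Xb bc] gens(2) cXY colon_power_cancel[OF l yc]] by simp
  note cancel = colon_power_cancel[OF c xc]
  have "{\<zero>} \<subseteq> ?a" using colon_sub[OF Z] by simp
  then have "?a \<subseteq> {\<zero>}"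
    using nakayama_cancel[OF Z ai _ gens(1) _ cancel] adj_sub[OF ai xc] bc cX by blast
  moreover have "r \<in> ?a"
    using cancel[OF _ r(1)] m_comm[OF r(1) xc] r(2) ideal_zero[OF ai] by auto
  ultimately show ?thesis by blast
qed

lemma y_pow_regular: "r \<in> carrier R \<Longrightarrow> y [^] (j::nat) \<otimes> r \<in> Jx \<Longrightarrow> r \<in> Jx"
proof (induction j)
  case (Suc j)
  have "y \<otimes> (y [^] j \<otimes> r) \<in> Jx" using Suc.prems by (simp add: m_ac)
  then show ?case using Suc y_regular[of "y [^] j \<otimes> r"] by simp
qed simp

text \<open>Every associated prime of \<open>(x, y\<^sup>j)\<close> is \<open>(x, y)\<close>: one factor \<open>y\<close> is split off at a time, using
  that \<open>y\<close> is a nonzerodivisor modulo \<open>x\<close>.\<close>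

lemma z_regular: "r \<in> carrier R \<Longrightarrow> z \<otimes> r \<in> adj Jx (y [^] (j::nat)) \<Longrightarrow> r \<in> adj Jx (y [^] j)"
proof (induction j arbitrary: r)
  case 0
  have "adj Jx \<one> = carrier R"
    using proper_iff[OF adj_ideal[OF Jx_ideal one_closed]] adj_gen[OF Jx_ideal one_closed] by simp
  then show ?case using 0 by simp
next
  case (Suc j)
  have p: "y [^] j \<in> carrier R" by simp
  obtain k s where s: "z \<otimes> r = k \<oplus> s \<otimes> (y [^] j \<otimes> y)" "k \<in> Jx" "s \<in> carrier R"
    using Suc.prems by (auto elim: adjE)
  have kc: "k \<in> carrier R" using s Jx_ideal ideal_carr by auto
  have "z \<otimes> r = k \<oplus> (s \<otimes> y [^] j) \<otimes> y" unfolding s(1) using s(3) by (simp add: m_assoc)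
  then have "z \<otimes> r \<in> Jxy" using adj_mem[OF s(2), of "s \<otimes> y [^] j" y] s(3) by simp
  then have "r \<in> Jxy" using prime_mult[OF Jxy_prime zc Suc.prems(1)] z_Jxy by blast
  then obtain k' r' where r': "r = k' \<oplus> r' \<otimes> y" "k' \<in> Jx" "r' \<in> carrier R" by (rule adjE)
  have k'c: "k' \<in> carrier R" using r' Jx_ideal ideal_carr by auto
  have "y \<otimes> (z \<otimes> r' \<ominus> s \<otimes> y [^] j) = z \<otimes> (k' \<oplus> r' \<otimes> y) \<ominus> z \<otimes> k' \<ominus> s \<otimes> (y [^] j \<otimes> y)"
    using r'(3) k'c s(3) p yc zc by algebra
  also have "\<dots> = z \<otimes> r \<ominus> z \<otimes> k' \<ominus> s \<otimes> (y [^] j \<otimes> y)" using r'(1) by simp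
  also have "\<dots> = k \<ominus> z \<otimes> k'" unfolding s(1) using kc k'c s(3) p yc zc by algebra
  also have "\<dots> \<in> Jx" using ideal_minus[OF Jx_ideal s(2) ideal_l[OF Jx_ideal r'(2) zc]] .
  finally have *: "z \<otimes> r' \<ominus> s \<otimes> y [^] j \<in> Jx" using y_regular r'(3) s(3) by simp
  have "z \<otimes> r' = (z \<otimes> r' \<ominus> s \<otimes> y [^] j) \<oplus> s \<otimes> y [^] j" using r'(3) s(3) p zc by algebra
  then have "z \<otimes> r' \<in> adj Jx (y [^] j)" using adj_mem[OF * s(3)] by metis
  then have "r' \<in> adj Jx (y [^] j)" using Suc.IH r'(3) by simp
  then obtain k'' w where w: "r' = k'' \<oplus> w \<otimes> y [^] j" "k'' \<in> Jx" "w \<in> carrier R" by (rule adjE)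
  have k''c: "k'' \<in> carrier R" using w Jx_ideal ideal_carr by auto
  have "r = (k' \<oplus> y \<otimes> k'') \<oplus> w \<otimes> (y [^] j \<otimes> y)" unfolding r'(1) w(1) using k'c k''c w(3) p yc by algebra
  then show ?case using adj_mem[OF ideal_add[OF Jx_ideal r'(2) ideal_l[OF Jx_ideal w(2) yc]] w(3), of "y [^] Suc j"] by simp
qed

text \<open>The powers of \<open>(x, y)\<close> are unmixed. Modulo \<open>x\<close> the claim is \<open>z_regular\<close>; the remaining multiple
  of \<open>x\<close> is divided by \<open>x\<close>, which reduces \<open>t\<close> by one.\<close>

lemma z_qw: "r \<in> carrier R \<Longrightarrow> z \<otimes> r \<in> qw x y t \<Longrightarrow> r \<in> qw x y t"
proof (induction t arbitrary: r)
  case (Suc t)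
  let ?p = "y [^] Suc t"
  have p: "?p \<in> carrier R" by simp
  obtain b s where s: "z \<otimes> r = x \<otimes> b \<oplus> ?p \<otimes> s" "b \<in> qw x y t" "s \<in> carrier R" using Suc.prems by (blast elim: qwE)
  have bc: "b \<in> carrier R" using qw_carr[OF s(2)] .
  have "x \<otimes> b \<in> Jx" using Jx_mem bc m_comm[OF xc bc] by auto
  then have "z \<otimes> r \<in> adj Jx ?p" using adj_mem[OF _ s(3), of "x \<otimes> b" Jx ?p] m_comm[OF p s(3)] s(1) by simp
  then have "r \<in> adj Jx ?p" using z_regular Suc.prems by blast
  then obtain u v where u: "r = u \<otimes> x \<oplus> v \<otimes> ?p" "u \<in> carrier R" "v \<in> carrier R"
    using Jx_mem adjE[of r Jx ?p] by metis
  have "?p \<otimes> (z \<otimes> v \<ominus> s) = z \<otimes> (u \<otimes> x \<oplus> v \<otimes> ?p) \<ominus> x \<otimes> (z \<otimes> u) \<ominus> ?p \<otimes> s"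
    using u(2,3) s(3) p xc zc by algebra
  also have "\<dots> = z \<otimes> r \<ominus> x \<otimes> (z \<otimes> u) \<ominus> ?p \<otimes> s" using u(1) by simp
  also have "\<dots> = (b \<ominus> z \<otimes> u) \<otimes> x" unfolding s(1) using u(2,3) s(3) p xc zc bc by algebra
  also have "\<dots> \<in> Jx" using Jx_mem bc u by auto
  finally have "z \<otimes> v \<ominus> s \<in> Jx" using y_pow_regular[of "z \<otimes> v \<ominus> s" "Suc t"] u s by auto
  then obtain g where g: "z \<otimes> v \<ominus> s = g \<otimes> x" "g \<in> carrier R" using Jx_mem by auto
  have "x \<otimes> (z \<otimes> u \<ominus> b \<oplus> ?p \<otimes> g) = (z \<otimes> (u \<otimes> x \<oplus> v \<otimes> ?p) \<ominus> x \<otimes> b \<ominus> ?p \<otimes> s) \<ominus> ?p \<otimes> (z \<otimes> v \<ominus> s) \<oplus> ?p \<otimes> (g \<otimes> x)"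
    using u(2,3) s(3) p xc zc bc g(2) by algebra
  also have "\<dots> = (z \<otimes> r \<ominus> x \<otimes> b \<ominus> ?p \<otimes> s) \<ominus> ?p \<otimes> (g \<otimes> x) \<oplus> ?p \<otimes> (g \<otimes> x)"
    by (simp only: u(1) g(1))
  also have "\<dots> = \<zero>" unfolding s(1) using s(3) p xc bc g(2) by algebra
  finally have z0: "z \<otimes> u \<ominus> b \<oplus> ?p \<otimes> g = \<zero>" using x_regular[of "z \<otimes> u \<ominus> b \<oplus> ?p \<otimes> g"] u bc g p zc by simp
  have "z \<otimes> u = (z \<otimes> u \<ominus> b \<oplus> ?p \<otimes> g) \<oplus> b \<ominus> ?p \<otimes> g" using u(2) bc p g(2) zc by algebra
  also have "\<dots> = b \<ominus> ?p \<otimes> g" unfolding z0 using bc p g(2) by algebra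
  also have "\<dots> \<in> qw x y t"
  proof -
    have "?p \<otimes> g = (y \<otimes> g) \<otimes> y [^] t" using g(2) by (simp add: m_ac)
    then show ?thesis using ideal_minus[OF qw_ideal s(2) ideal_l[OF qw_ideal qw_pow]] g(2) by simp
  qed
  finally have "u \<in> qw x y t" using Suc.IH u(2) by simp
  moreover have "r = x \<otimes> u \<oplus> ?p \<otimes> v" unfolding u(1) using u(2,3) p xc by algebra
  ultimately show ?case using qw_mem[of u t v] u(3) by simp
qed simp

text \<open>An element of \<open>\<nn>\<^sup>t\<^sup>+\<^sup>1\<close> is \<open>q + zb\<close> with \<open>q \<in> (x, y)\<^sup>t\<^sup>+\<^sup>1\<close> and \<open>b \<in> \<nn>\<^sup>t\<close>. If it equals \<open>zr\<close>,
  then \<open>z (r - b) = q\<close> and therefore \<open>r - b \<in> (x, y)\<^sup>t\<^sup>+\<^sup>1\<close>.\<close>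

lemma colon_pw_z: "colon (pw x y z (Suc t)) {z} = pw x y z t"
proof
  show "pw x y z t \<subseteq> colon (pw x y z (Suc t)) {z}"
    using pw_gens(3) pw_carr m_comm[OF zc] by (auto simp: colon_mem1 simp del: pw.simps)
  show "colon (pw x y z (Suc t)) {z} \<subseteq> pw x y z t"
  proof
    fix r assume "r \<in> colon (pw x y z (Suc t)) {z}"
    then have r: "r \<in> carrier R" "z \<otimes> r \<in> pw x y z (Suc t)" using m_comm[OF zc] by (auto simp: colon_mem1 simp del: pw.simps)
    obtain q b where b: "q \<in> qw x y (Suc t)" "b \<in> pw x y z t" "z \<otimes> r = q \<oplus> z \<otimes> b" using pw_decomp[OF r(2)] by blast
    have bc: "b \<in> carrier R" "q \<in> carrier R" using pw_carr[OF b(2)] qw_carr[OF b(1)] by auto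
    have "z \<otimes> (r \<ominus> b) = z \<otimes> r \<ominus> z \<otimes> b" using r(1) bc zc by algebra
    also have "\<dots> = q" unfolding b(3) using bc zc by algebra
    finally have "r \<ominus> b \<in> qw x y (Suc t)" using z_qw[of "r \<ominus> b" "Suc t"] r(1) bc b(1) by simp
    then have "r \<ominus> b \<in> pw x y z t" using qw_sub_pw[of "Suc t"] pw_decr[of t] by blast
    then show "r \<in> pw x y z t" using ideal_minus_iff[OF pw_ideal _ r(1) bc(1)] b(2) by blast
  qed
qed

text \<open>Otherwise \<open>x\<^sup>t\<close> would lie in \<open>(y, z) + (x\<^sup>t\<^sup>+\<^sup>1)\<close>, hence in \<open>(y, z)\<close>, and \<open>\<nn>\<close> would be the only
  prime over \<open>(y, z)\<close>.\<close>

lemma pw_not_sub: "\<not> pw x y z t \<subseteq> adj (pw x y z (Suc t)) z"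
proof
  let ?Y = "adj (adj {\<zero>} y) z"
  have Yi: "ideal ?Y R" using adj_ideal zeroideal by simp
  have Z: "ideal (adj {\<zero>} y) R" using adj_ideal zeroideal by simp
  have yY: "y \<in> ?Y" "z \<in> ?Y" using adj_gen[OF zeroideal yc] adj_sub[OF Z zc] adj_gen[OF Z zc] by blast+
  have p: "x [^] s \<in> carrier R" for s :: nat by simp
  have Ai: "ideal (adj ?Y (x [^] s)) R" for s :: nat using adj_ideal[OF Yi p] .
  have sub: "pw x y z s \<subseteq> adj ?Y (x [^] s)" for s
  proof (induction s)
    case 0
    then show ?case using proper_iff[OF Ai[of 0]] adj_gen[OF Yi p[of 0]] by simp
  next
    case (Suc s)
    show ?case
    proof
      fix a assume "a \<in> pw x y z (Suc s)"
      then obtain u v w where u: "a = x \<otimes> u \<oplus> y \<otimes> v \<oplus> z \<otimes> w" "u \<in> pw x y z s" "v \<in> carrier R" "w \<in> carrier R"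
        using pw_carr by (blast elim: pwE)
      obtain k r where k: "u = k \<oplus> r \<otimes> x [^] s" "k \<in> ?Y" "r \<in> carrier R" using u(2) Suc by (blast elim: adjE)
      have kc: "k \<in> carrier R" using k Yi ideal_carr by auto
      have "a = (x \<otimes> k \<oplus> v \<otimes> y \<oplus> w \<otimes> z) \<oplus> r \<otimes> (x [^] s \<otimes> x)"
        unfolding u(1) k(1) using kc k(3) u(3,4) p[of s] xc yc zc by algebra
      moreover have "x \<otimes> k \<oplus> v \<otimes> y \<oplus> w \<otimes> z \<in> ?Y"
        using ideal_add[OF Yi ideal_add[OF Yi ideal_l[OF Yi k(2) xc] ideal_l[OF Yi yY(1) u(3)]] ideal_l[OF Yi yY(2) u(4)]] .
      ultimately show "a \<in> adj ?Y (x [^] Suc s)" using adj_mem[OF _ k(3), of _ ?Y "x [^] Suc s"] by simp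
    qed
  qed
  assume "pw x y z t \<subseteq> adj (pw x y z (Suc t)) z"
  then have "x [^] t \<in> adj (pw x y z (Suc t)) z" using pw_pow(1) by blast
  moreover have "adj (pw x y z (Suc t)) z \<subseteq> adj ?Y (x [^] Suc t)"
    using adj_least[OF Ai sub] yY(2) adj_sub[OF Yi p] by blast
  ultimately have "x [^] t \<in> adj ?Y (x [^] Suc t)" by blast
  then have xY: "x [^] t \<in> ?Y" using local_absorb_power[OF Yi gens(1)] by blast
  obtain Q where Q: "primeideal Q R" "y \<in> Q" "z \<in> Q" "Q \<noteq> \<nn>" using height[OF gens(2,3)] by auto
  have Qi: "ideal Q R" using Q prime_ideal by simp
  have "?Y \<subseteq> Q" using adj_least[OF Qi adj_least[OF Qi]] Q ideal_zero[OF Qi] by auto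
  then have "x \<in> Q" using xY prime_pow[OF Q(1) xc] by blast
  then show False using prime_n Q by blast
qed

lemma pw_fin: "fin (pw x y z t)"
proof (rule fin_if_primes[OF pw_ideal])
  fix P assume "primeideal P R" "pw x y z t \<subseteq> P"
  then show "P = \<nn>" using pw_pow prime_pow xc yc zc prime_n by (metis subsetD)
qed

theorem socle_degree_bound:
  assumes I: "fin I" "simple_socle I \<omega>" and t: "I \<subseteq> pw x y z (Suc t)"
  shows "\<not> pw x y z (2 * t) \<subseteq> I"
proof
  assume sub: "pw x y z (2 * t) \<subseteq> I"
  have "pw x y z t \<subseteq> adj (pw x y z (Suc t)) z"
  proof (rule gorenstein_order_bound[OF pw_ideal pw_ideal pw_decr I(1) t I(2) zc colon_pw_z])
    fix b c assume "b \<in> pw x y z t" "c \<in> pw x y z t"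
    then have "b \<otimes> c \<in> pw x y z (2 * t)" using pw_mult[of b t c t] by (simp add: mult_2)
    then show "b \<otimes> c \<in> I" using sub by blast
  qed
  then show False using pw_not_sub by blast
qed

end

section \<open>Extension of the residue field\<close>

lemma (in cring) exists_maximal_above:
  assumes J: "ideal J R" "\<one> \<notin> J"
  obtains M where "maximalideal M R" "J \<subseteq> M"
proof -
  let ?A = "{K. ideal K R \<and> J \<subseteq> K \<and> \<one> \<notin> K}"
  have "\<exists>M\<in>?A. \<forall>K\<in>?A. M \<subseteq> K \<longrightarrow> K = M"
  proof (rule subset_Zorn_nonempty)
    show "?A \<noteq> {}" using J by blast
    fix C assume C: "C \<noteq> {}" "subset.chain ?A C"
    then have "subset.chain {I. ideal I R} C" by (auto simp: pred_on.chain_def)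
    then have "ideal (\<Union>C) R" using chain_Union_is_ideal[of C] C(1) by simp
    then show "\<Union>C \<in> ?A" using C by (auto simp: pred_on.chain_def)
  qed
  then obtain M where MA: "M \<in> ?A" and max': "\<forall>K\<in>?A. M \<subseteq> K \<longrightarrow> K = M" by (elim bexE)
  have M: "ideal M R" "J \<subseteq> M" "\<one> \<notin> M" using MA by simp_all
  have max: "K = M" if "K \<in> ?A" "M \<subseteq> K" for K using bspec[OF max' that(1)] that(2) by (rule mp)
  have "maximalideal M R"
  proof (rule maximalidealI[OF M(1)])
    show "carrier R \<noteq> M" using M(3) by auto
    fix K assume K: "ideal K R" "M \<subseteq> K" "K \<subseteq> carrier R"
    show "K = M \<or> K = carrier R"
    proof (cases "\<one> \<in> K")
      case True
      then show ?thesis using ideal.one_imp_carrier[OF K(1)] by simp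
    next
      case False
      then have "K \<in> ?A" using K(1,2) M(2) by simp
      then show ?thesis using max[OF _ K(2)] by simp
    qed
  qed
  then show thesis using that M(2) by blast
qed

lemma (in cring) ideal_finsum:
  assumes K: "ideal K R" and f: "\<And>i. i \<in> A \<Longrightarrow> f i \<in> K"
  shows "finsum R f A \<in> K"
  using f
proof (induction A rule: infinite_finite_induct)
  case (insert x F)
  have "f \<in> F \<rightarrow> carrier R" "f x \<in> carrier R" using insert.prems ideal_carr[OF K] by auto
  then show ?case using insert ideal_add[OF K] by (simp add: finsum_insert)
qed (use ideal_zero[OF K] in auto)

context UP_cring
begin

abbreviation cf where "cf f i \<equiv> up_ring.coeff P f i"

text \<open>The ideal \<open>K[Y]\<close> of polynomials with coefficients in \<open>K\<close>.\<close>

definition coeffs_in :: "'a set \<Rightarrow> (nat \<Rightarrow> 'a) set" where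
  "coeffs_in K = {f \<in> carrier P. \<forall>i. cf f i \<in> K}"

text \<open>The ideal \<open>K[Y] + (p)\<close>. For a monic \<open>p\<close> that is irreducible modulo the maximal ideal,
  \<open>R[Y]/(p)\<close> is a free extension of \<open>R\<close> that enlarges the residue field, and this is the extension
  of \<open>K\<close> to it, pulled back to \<open>R[Y]\<close>.\<close>

definition ext :: "(nat \<Rightarrow> 'a) \<Rightarrow> 'a set \<Rightarrow> (nat \<Rightarrow> 'a) set" where
  "ext p K = P.adj (coeffs_in K) p"

definition monic :: "(nat \<Rightarrow> 'a) \<Rightarrow> nat \<Rightarrow> bool" where
  "monic p e \<longleftrightarrow> p \<in> carrier P \<and> cf p e = \<one> \<and> (\<forall>i>e. cf p i = \<zero>)"

lemma coeffs_in_mult: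
  assumes K: "ideal K R" and f: "f \<in> carrier P" and g: "g \<in> carrier P"
    and fg: "\<And>i j. cf f i \<otimes> cf g j \<in> K"
  shows "f \<otimes>\<^bsub>P\<^esub> g \<in> coeffs_in K"
proof -
  have "cf (f \<otimes>\<^bsub>P\<^esub> g) i \<in> K" for i
    unfolding coeff_mult[OF f g] by (rule R.ideal_finsum[OF K fg])
  then show ?thesis using f g by (simp add: coeffs_in_def)
qed

lemma coeffs_in_ideal: assumes K: "ideal K R" shows "ideal (coeffs_in K) P"
proof (rule P.idealI')
  fix a r assume a: "a \<in> coeffs_in K" and r: "r \<in> carrier P"
  show "r \<otimes>\<^bsub>P\<^esub> a \<in> coeffs_in K"
    by (rule coeffs_in_mult[OF K r]) (use a r R.ideal_l[OF K] in \<open>auto simp: coeffs_in_def\<close>)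
qed (use R.ideal_zero[OF K] R.ideal_add[OF K] in \<open>auto simp: coeffs_in_def\<close>)

lemma coeffs_in_mono: "K \<subseteq> L \<Longrightarrow> coeffs_in K \<subseteq> coeffs_in L"
  by (auto simp: coeffs_in_def)

lemma coeffs_in_carrier: "coeffs_in (carrier R) = carrier P"
  by (auto simp: coeffs_in_def)

lemma monom_0_in: "ideal K R \<Longrightarrow> a \<in> K \<Longrightarrow> up_ring.monom P a 0 \<in> coeffs_in K"
  using R.ideal_zero R.ideal_carr by (auto simp: coeffs_in_def)

lemma coeffs_in_least:
  assumes J: "ideal J P" and K: "K \<subseteq> carrier R" "\<And>a. a \<in> K \<Longrightarrow> up_ring.monom P a 0 \<in> J"
  shows "coeffs_in K \<subseteq> J"
proof
  fix f assume f: "f \<in> coeffs_in K"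
  then have fP: "f \<in> carrier P" and fi: "\<And>i. cf f i \<in> K" by (auto simp: coeffs_in_def)
  have "up_ring.monom P (cf f i) i \<in> J" for i
  proof -
    have "up_ring.monom P (cf f i) i = up_ring.monom P (\<one> \<otimes> cf f i) (i + 0)" using fP by simp
    also have "\<dots> = up_ring.monom P \<one> i \<otimes>\<^bsub>P\<^esub> up_ring.monom P (cf f i) 0" using fP by (intro monom_mult) auto
    finally show ?thesis using P.ideal_l[OF J K(2)[OF fi], of "up_ring.monom P \<one> i"] by simp
  qed
  then have "(\<Oplus>\<^bsub>P\<^esub> i \<in> {..deg R f}. up_ring.monom P (cf f i) i) \<in> J"
    by (intro P.ideal_finsum[OF J]) auto
  then show "f \<in> J" using up_repr[OF fP] by simp
qed

lemma coeff_monom_mult':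
  assumes "c \<in> carrier R" "f \<in> carrier P"
  shows "cf (up_ring.monom P c n \<otimes>\<^bsub>P\<^esub> f) i = (if n \<le> i then c \<otimes> cf f (i - n) else \<zero>)"
proof (cases "n \<le> i")
  case True then show ?thesis using coeff_monom_mult[OF assms, of n "i - n"] by simp
next
  case False
  have "cf (up_ring.monom P c n \<otimes>\<^bsub>P\<^esub> f) i = (\<Oplus>j\<in>{..i}. \<zero>)"
    using assms False by (simp cong: R.finsum_cong)
  then show ?thesis using False by simp
qed

lemma const_mult_coeff:
  "c \<in> carrier R \<Longrightarrow> f \<in> carrier P \<Longrightarrow> cf (up_ring.monom P c 0 \<otimes>\<^bsub>P\<^esub> f) i = c \<otimes> cf f i"
  using coeff_monom_mult'[of c f 0 i] by simp

lemma exists_top: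
  assumes f: "f \<in> carrier P" and K: "ideal K R" and nK: "f \<notin> coeffs_in K"
  obtains d where "cf f d \<notin> K" "\<And>i. i > d \<Longrightarrow> cf f i \<in> K"
proof -
  let ?D = "{d. cf f d \<notin> K}"
  have "?D \<subseteq> {..deg R f}"
  proof
    fix d assume d: "d \<in> ?D"
    show "d \<in> {..deg R f}"
      using deg_aboveD[OF _ f, of d] d R.ideal_zero[OF K] by (cases "d \<le> deg R f") auto
  qed
  then have fin: "finite ?D" by (rule finite_subset) simp
  have "?D \<noteq> {}" using f nK by (auto simp: coeffs_in_def)
  then have "Max ?D \<in> ?D" using Max_in[OF fin] by blast
  moreover have "i \<notin> ?D" if "i > Max ?D" for i using Max_ge[OF fin, of i] that by auto
  ultimately show thesis using that[of "Max ?D"] by blast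
qed

text \<open>Modulo \<open>K\<close>, only one term of the convolution remains.\<close>

lemma coeff_mult_top:
  assumes K: "ideal K R" and f: "f \<in> carrier P" and g: "g \<in> carrier P"
    and fd: "\<And>i. i > d \<Longrightarrow> cf f i \<in> K" and ge: "\<And>i. i > e \<Longrightarrow> cf g i \<in> K"
  shows "cf (f \<otimes>\<^bsub>P\<^esub> g) (d + e) \<in> K \<longleftrightarrow> cf f d \<otimes> cf g e \<in> K"
proof -
  let ?h = "\<lambda>i. cf f i \<otimes> cf g (d + e - i)"
  have ins: "{..d + e} = insert d ({..d + e} - {d})" by auto
  have "finsum R ?h {..d + e} = finsum R ?h (insert d ({..d + e} - {d}))" using ins by simp
  also have "\<dots> = ?h d \<oplus> finsum R ?h ({..d + e} - {d})" using f g by (intro R.finsum_insert) auto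
  finally have eq: "cf (f \<otimes>\<^bsub>P\<^esub> g) (d + e) = finsum R ?h ({..d + e} - {d}) \<oplus> cf f d \<otimes> cf g e"
    using f g by (simp add: R.a_comm)
  have "finsum R ?h ({..d + e} - {d}) \<in> K"
  proof (rule R.ideal_finsum[OF K])
    fix i assume i: "i \<in> {..d + e} - {d}"
    show "?h i \<in> K"
    proof (cases "i < d")
      case True
      then show ?thesis using R.ideal_l[OF K ge[of "d + e - i"]] f by simp
    next
      case False
      then show ?thesis using R.ideal_r[OF K fd[of i]] i g by simp
    qed
  qed
  then show ?thesis unfolding eq using R.ideal_add_iff[OF K] f g by simp
qed

text \<open>The remainder of division by \<open>p\<close> is unique: if \<open>r = f + gp\<close> with \<open>f \<in> K[Y]\<close> and \<open>g\<close> had a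
  coefficient outside \<open>K\<close>, then \<open>r\<close> would have one in degree at least \<open>e\<close>.\<close>

lemma monic_contract:
  assumes p: "monic p e" and K: "ideal K R" and r: "r \<in> carrier P" "\<And>i. i \<ge> e \<Longrightarrow> cf r i = \<zero>"
    and rK: "r \<in> ext p K"
  shows "r \<in> coeffs_in K"
proof -
  have pP: "p \<in> carrier P" using p by (simp add: monic_def)
  note ci = coeffs_in_ideal[OF K]
  obtain f g where fg: "r = f \<oplus>\<^bsub>P\<^esub> g \<otimes>\<^bsub>P\<^esub> p" "f \<in> coeffs_in K" "g \<in> carrier P"
    using rK unfolding ext_def by (rule P.adjE)
  have fP: "f \<in> carrier P" using fg by (simp add: coeffs_in_def)
  have "g \<in> coeffs_in K"
  proof (rule ccontr)
    assume "g \<notin> coeffs_in K"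
    then obtain d where d: "cf g d \<notin> K" "\<And>i. i > d \<Longrightarrow> cf g i \<in> K"
      using exists_top[OF fg(3) K] by blast
    have "cf (g \<otimes>\<^bsub>P\<^esub> p) (d + e) \<notin> K"
      using coeff_mult_top[OF K fg(3) pP d(2), of d e] p d(1) fg(3) R.ideal_zero[OF K]
      by (auto simp: monic_def simp del: coeff_mult)
    moreover have "cf r (d + e) = cf f (d + e) \<oplus> cf (g \<otimes>\<^bsub>P\<^esub> p) (d + e)"
      unfolding fg(1) using fP fg(3) pP by (simp del: coeff_mult)
    then have "cf f (d + e) \<oplus> cf (g \<otimes>\<^bsub>P\<^esub> p) (d + e) \<in> K" using r(2)[of "d + e"] R.ideal_zero[OF K] by simp
    then have "cf (g \<otimes>\<^bsub>P\<^esub> p) (d + e) \<in> K"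
      using R.ideal_add_iff[OF K] fg(2,3) pP by (simp add: coeffs_in_def del: coeff_mult)
    ultimately show False by simp
  qed
  then show ?thesis unfolding fg(1) using P.ideal_add[OF ci fg(2) P.ideal_r[OF ci _ pP]] by simp
qed

lemma monic_division:
  assumes p: "monic p e" and f: "f \<in> carrier P" and one: "\<one> \<noteq> \<zero>"
  obtains q r where "q \<in> carrier P" "r \<in> carrier P" "f = r \<oplus>\<^bsub>P\<^esub> q \<otimes>\<^bsub>P\<^esub> p" "\<And>i. i \<ge> e \<Longrightarrow> cf r i = \<zero>"
proof -
  have pP: "p \<in> carrier P" using p by (simp add: monic_def)
  have d: "deg R p = e"
  proof (rule le_antisym)
    show "deg R p \<le> e" using p deg_aboveI[OF _ pP] by (simp add: monic_def)
    show "e \<le> deg R p" using p deg_belowI[OF _ pP, of e] one by (simp add: monic_def)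
  qed
  have "p \<noteq> \<zero>\<^bsub>P\<^esub>" using p one by (auto simp: monic_def)
  then obtain q r k where qr: "q \<in> carrier P" "r \<in> carrier P"
    "cf p (deg R p) [^]\<^bsub>R\<^esub> (k::nat) \<odot>\<^bsub>P\<^esub> f = p \<otimes>\<^bsub>P\<^esub> q \<oplus>\<^bsub>P\<^esub> r" "r = \<zero>\<^bsub>P\<^esub> \<or> deg R r < deg R p"
    using long_div_theorem[OF pP f] by blast
  have "f = p \<otimes>\<^bsub>P\<^esub> q \<oplus>\<^bsub>P\<^esub> r" using qr(3) p d f by (simp add: monic_def)
  also have "\<dots> = r \<oplus>\<^bsub>P\<^esub> q \<otimes>\<^bsub>P\<^esub> p" using qr(1,2) pP by (simp add: P.m_comm P.a_comm)
  finally have "f = r \<oplus>\<^bsub>P\<^esub> q \<otimes>\<^bsub>P\<^esub> p" .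
  moreover have "cf r i = \<zero>" if "i \<ge> e" for i
    using qr(4) deg_aboveD[OF _ qr(2), of i] d that by auto
  ultimately show thesis using that qr(1,2) by blast
qed

text \<open>Modulo \<open>\<nn>\<close> the coefficients form a field. So \<open>f\<close> can be divided by its leading coefficient
  modulo \<open>\<nn>\<close> and cut off above it, without leaving \<open>M\<close>.\<close>

lemma monicize:
  assumes n: "max_ring R \<nn>" and M: "ideal M P" "coeffs_in \<nn> \<subseteq> M" and f: "f \<in> M" "f \<notin> coeffs_in \<nn>"
    and b: "\<And>i. i \<ge> b \<Longrightarrow> cf f i \<in> \<nn>"
  shows "\<exists>p e. monic p e \<and> e < b \<and> p \<in> M"
proof -
  interpret n: max_ring R \<nn> by (rule n)
  have fP: "f \<in> carrier P" using f M P.ideal_carr by auto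
  obtain e where e: "cf f e \<notin> \<nn>" "\<And>i. i > e \<Longrightarrow> cf f i \<in> \<nn>"
    using exists_top[OF fP n.n_ideal f(2)] by blast
  obtain u v where uv: "u \<in> carrier R" "v \<in> \<nn>" "\<one> = v \<oplus> u \<otimes> cf f e"
    using n.n_unit[OF _ e(1)] fP by auto
  define p where "p i = (if i < e then u \<otimes> cf f i else if i = e then \<one> else \<zero>)" for i
  have "bound \<zero> e p" by (rule bound.intro) (simp add: p_def)
  moreover have "p i \<in> carrier R" for i using fP uv(1) by (simp add: p_def)
  ultimately have up: "p \<in> up R" by (intro mem_upI) blast+
  then have pP: "p \<in> carrier P" unfolding P_def UP_def by simp
  have pc: "cf p i = p i" for i using up unfolding P_def UP_def by simp
  have m: "monic p e" using pP pc by (simp add: monic_def p_def)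
  let ?g = "up_ring.monom P u 0 \<otimes>\<^bsub>P\<^esub> f"
  have gP: "?g \<in> carrier P" using uv(1) fP by simp
  have "p \<ominus>\<^bsub>P\<^esub> ?g \<in> coeffs_in \<nn>"
  proof -
    have c: "cf (p \<ominus>\<^bsub>P\<^esub> ?g) i = p i \<ominus> u \<otimes> cf f i" for i
      using pP gP pc const_mult_coeff[OF uv(1) fP] by (simp del: coeff_mult)
    have "p i \<ominus> u \<otimes> cf f i \<in> \<nn>" for i
    proof -
      consider "i < e" | "i = e" | "i > e" by linarith
      then show ?thesis
      proof cases
        case 1
        then have "p i \<ominus> u \<otimes> cf f i = \<zero>" using uv(1) fP by (simp add: p_def R.minus_eq R.r_neg)
        then show ?thesis using R.ideal_zero[OF n.n_ideal] by simp
      next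
        case 2
        have fe: "cf f e \<in> carrier R" "v \<in> carrier R" using fP uv(2) n.n_carr by auto
        have "p i \<ominus> u \<otimes> cf f i = (v \<oplus> u \<otimes> cf f e) \<ominus> u \<otimes> cf f e"
          using 2 uv(3) by (simp add: p_def)
        also have "\<dots> = v" using fe uv(1) by algebra
        finally show ?thesis using uv(2) by simp
      next
        case 3
        then show ?thesis
          using R.ideal_minus[OF n.n_ideal R.ideal_zero[OF n.n_ideal] R.ideal_l[OF n.n_ideal e(2)[OF 3] uv(1)]]
          by (simp add: p_def)
      qed
    qed
    then show ?thesis using c pP gP by (simp add: coeffs_in_def)
  qed
  then have "p \<in> M" using P.ideal_minus_iff[OF M(1) _ pP gP] M(2) P.ideal_l[OF M(1) f(1)] uv(1) by auto
  moreover have "e < b" using e(1) b[of e] by (meson not_le)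
  ultimately show ?thesis using m by blast
qed

text \<open>The polynomial \<open>1 + Yc\<close> has positive degree modulo \<open>\<nn>\<close>, hence it lies in a maximal ideal \<open>M\<close>
  over \<open>\<nn>[Y]\<close>, and \<open>M\<close> cannot contain \<open>c\<close>. A monic polynomial \<open>p\<close> of least degree in \<open>M\<close> generates
  \<open>M\<close> modulo \<open>\<nn>[Y]\<close>, as in a polynomial ring over a field.\<close>

theorem exists_residue_extension:
  assumes n: "max_ring R \<nn>" and c: "c \<in> carrier P" "c \<notin> coeffs_in \<nn>"
  obtains M p e where "max_ring P M" "monic p e" "e > 0" "M = ext p \<nn>" "c \<notin> M"
proof -
  interpret n: max_ring R \<nn> by (rule n)
  note ci = coeffs_in_ideal[OF n.n_ideal]
  have prime: "a \<in> \<nn> \<or> b \<in> \<nn>" if "a \<in> carrier R" "b \<in> carrier R" "a \<otimes> b \<in> \<nn>" for a b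
    using R.prime_mult[OF R.maximalideal_prime[OF n.max] that] .
  have one: "\<one> \<notin> \<nn>" using n.n_proper n.proper_iff[OF n.n_ideal] by simp
  let ?y = "up_ring.monom P \<one> (Suc 0)"
  let ?h = "\<one>\<^bsub>P\<^esub> \<oplus>\<^bsub>P\<^esub> ?y \<otimes>\<^bsub>P\<^esub> c"
  have hP: "?h \<in> carrier P" "?y \<in> carrier P" using c(1) by auto
  obtain k where k: "cf c k \<notin> \<nn>" "\<And>i. i > k \<Longrightarrow> cf c i \<in> \<nn>"
    using exists_top[OF c(1) n.n_ideal c(2)] by blast
  have hc: "cf ?h (Suc i) = cf c i" for i
    using c(1) coeff_monom_mult'[OF R.one_closed c(1), of "Suc 0" "Suc i"] by (simp del: coeff_mult)
  have htop: "cf ?h i \<in> \<nn>" if "i > Suc k" for i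
    using that hc[of "i - 1"] k(2)[of "i - 1"] by simp
  have hn: "?h \<notin> coeffs_in \<nn>" unfolding coeffs_in_def mem_Collect_eq hc[of k, symmetric] using k(1) hc[of k] by metis
  define h where "h = ?h"
  note hP = hP[folded h_def] and hc = hc[folded h_def] and htop = htop[folded h_def] and hn = hn[folded h_def]
  let ?J = "P.adj (coeffs_in \<nn>) h"
  have Ji: "ideal ?J P" using P.adj_ideal[OF ci hP(1)] .
  have "\<one>\<^bsub>P\<^esub> \<notin> ?J"
  proof
    assume "\<one>\<^bsub>P\<^esub> \<in> ?J"
    then obtain f g where fg: "\<one>\<^bsub>P\<^esub> = f \<oplus>\<^bsub>P\<^esub> g \<otimes>\<^bsub>P\<^esub> h" "f \<in> coeffs_in \<nn>" "g \<in> carrier P" by (rule P.adjE)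
    have fP: "f \<in> carrier P" using fg by (simp add: coeffs_in_def)
    have "g \<notin> coeffs_in \<nn>"
    proof
      assume "g \<in> coeffs_in \<nn>"
      then have "f \<oplus>\<^bsub>P\<^esub> g \<otimes>\<^bsub>P\<^esub> h \<in> coeffs_in \<nn>"
        using P.ideal_add[OF ci fg(2) P.ideal_r[OF ci _ hP(1)]] by blast
      then have "\<one>\<^bsub>P\<^esub> \<in> coeffs_in \<nn>" unfolding fg(1) .
      then have "cf \<one>\<^bsub>P\<^esub> 0 \<in> \<nn>" unfolding coeffs_in_def mem_Collect_eq by (elim conjE spec)
      then show False using one coeff_one[of 0] by simp
    qed
    then obtain d where d: "cf g d \<notin> \<nn>" "\<And>i. i > d \<Longrightarrow> cf g i \<in> \<nn>"
      using exists_top[OF fg(3) n.n_ideal] by blast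
    have "cf g d \<otimes> cf h (Suc k) \<notin> \<nn>"
      unfolding hc[of k]
      using prime[OF coeff_closed[OF fg(3)] coeff_closed[OF c(1)], of d k] d(1) k(1) by blast
    then have "cf (g \<otimes>\<^bsub>P\<^esub> h) (d + Suc k) \<notin> \<nn>"
      using coeff_mult_top[OF n.n_ideal fg(3) hP(1), of d "Suc k"] d(2) htop by blast
    moreover have "cf (f \<oplus>\<^bsub>P\<^esub> g \<otimes>\<^bsub>P\<^esub> h) (d + Suc k) =
        cf f (d + Suc k) \<oplus> cf (g \<otimes>\<^bsub>P\<^esub> h) (d + Suc k)"
      by (rule coeff_add) (use fP fg(3) hP(1) in \<open>blast intro: UP_mult_closed\<close>)+
    then have eq: "cf \<one>\<^bsub>P\<^esub> (d + Suc k) = cf f (d + Suc k) \<oplus> cf (g \<otimes>\<^bsub>P\<^esub> h) (d + Suc k)"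
      unfolding fg(1) .
    have one0: "cf \<one>\<^bsub>P\<^esub> (d + Suc k) = \<zero>" by simp
    have "cf f (d + Suc k) \<oplus> cf (g \<otimes>\<^bsub>P\<^esub> h) (d + Suc k) \<in> \<nn>"
      unfolding eq[symmetric] one0 using R.ideal_zero[OF n.n_ideal] .
    then have "cf (g \<otimes>\<^bsub>P\<^esub> h) (d + Suc k) \<in> \<nn>"
      using R.ideal_add_iff[OF n.n_ideal, of "cf f (d + Suc k)"] fg(2)
        coeff_closed[OF UP_mult_closed[OF fg(3) hP(1)], of "d + Suc k"] unfolding coeffs_in_def by blast
    ultimately show False by simp
  qed
  then obtain M where M: "maximalideal M P" "?J \<subseteq> M" using P.exists_maximal_above[OF Ji] by blast
  interpret M: max_ring P M by (intro max_ring.intro max_ring_axioms.intro P.is_cring M(1))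
  have Mi: "ideal M P" and M1: "\<one>\<^bsub>P\<^esub> \<notin> M"
    using M.n_ideal M.n_proper M.proper_iff[OF M.n_ideal] by auto
  have ciM: "coeffs_in \<nn> \<subseteq> M" using M(2) P.adj_sub[OF ci hP(1)] by blast
  have hM: "h \<in> M" using M(2) P.adj_gen[OF ci hP(1)] by blast
  have cM: "c \<notin> M"
  proof
    assume "c \<in> M"
    then have "?y \<otimes>\<^bsub>P\<^esub> c \<in> M" using P.ideal_l[OF Mi _ hP(2)] by blast
    then have "\<one>\<^bsub>P\<^esub> \<in> M"
      using P.ideal_add_iff[OF Mi, of "?y \<otimes>\<^bsub>P\<^esub> c" "\<one>\<^bsub>P\<^esub>"] hM hP(2) c(1) by (simp add: P.a_comm h_def)
    then show False using M1 by simp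
  qed
  have "\<exists>e p. monic p e \<and> p \<in> M"
    using monicize[OF n Mi ciM hM hn, of "Suc (Suc k)"] htop by auto
  then obtain e where e: "\<exists>p. monic p e \<and> p \<in> M" and min: "\<And>e' p. e' < e \<Longrightarrow> monic p e' \<Longrightarrow> p \<notin> M"
    using exists_least_iff[of "\<lambda>e. \<exists>p. monic p e \<and> p \<in> M"] by blast
  obtain p where p: "monic p e" "p \<in> M" using e by blast
  have pP: "p \<in> carrier P" using p by (simp add: monic_def)
  have "e \<noteq> 0"
  proof
    assume "e = 0"
    then have "cf p i = cf \<one>\<^bsub>P\<^esub> i" for i using p(1) by (auto simp: monic_def)
    then have "p = \<one>\<^bsub>P\<^esub>" using pP by (intro up_eqI) auto
    then show False using p(2) M1 by simp
  qed
  moreover have "M = ext p \<nn>"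
  proof
    show "ext p \<nn> \<subseteq> M" unfolding ext_def using P.adj_least[OF Mi ciM p(2)] .
    show "M \<subseteq> ext p \<nn>"
    proof
      fix f assume f: "f \<in> M"
      have fP: "f \<in> carrier P" using f Mi P.ideal_carr by auto
      have "\<one> \<noteq> \<zero>" using one R.ideal_zero[OF n.n_ideal] by auto
      then obtain q r where qr: "q \<in> carrier P" "r \<in> carrier P" "f = r \<oplus>\<^bsub>P\<^esub> q \<otimes>\<^bsub>P\<^esub> p"
        "\<And>i. i \<ge> e \<Longrightarrow> cf r i = \<zero>"
        using monic_division[OF p(1) fP] by blast
      have "q \<otimes>\<^bsub>P\<^esub> p \<in> M" using P.ideal_l[OF Mi p(2) qr(1)] .
      then have "r \<in> M"
        using P.ideal_add_iff[OF Mi, of "q \<otimes>\<^bsub>P\<^esub> p" r] f qr(1-3) pP by (simp add: P.a_comm)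
      have "r \<in> coeffs_in \<nn>"
      proof (rule ccontr)
        assume "r \<notin> coeffs_in \<nn>"
        then obtain p' e' where "monic p' e'" "e' < e" "p' \<in> M"
          using monicize[OF n Mi ciM \<open>r \<in> M\<close>, of e] qr(4) R.ideal_zero[OF n.n_ideal] by auto
        then show False using min by blast
      qed
      then show "f \<in> ext p \<nn>" unfolding ext_def qr(3) using P.adj_mem[OF _ qr(1)] by blast
    qed
  qed
  ultimately show thesis using that[OF M.max_ring_axioms p(1) _ _ cM] by simp
qed

end

locale residue_extension = UP_cring R P + n: max_ring R \<nn> + M: max_ring P M
  for R (structure) and P (structure) and \<nn> M +
  fixes p e
  assumes p: "monic p e" and e: "e > 0" and M_eq: "M = ext p \<nn>"
begin

abbreviation C where "C a \<equiv> up_ring.monom P a 0"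

lemma pP: "p \<in> carrier P" using p by (simp add: monic_def)

lemma ext_ideal: "ideal K R \<Longrightarrow> ideal (ext p K) P"
  unfolding ext_def using P.adj_ideal[OF coeffs_in_ideal pP] .

lemma ext_coeffs: "ideal K R \<Longrightarrow> coeffs_in K \<subseteq> ext p K"
  unfolding ext_def using P.adj_sub[OF coeffs_in_ideal pP] .

lemma ext_p: "ideal K R \<Longrightarrow> p \<in> ext p K"
  unfolding ext_def using P.adj_gen[OF coeffs_in_ideal pP] .

lemma ext_C: "ideal K R \<Longrightarrow> a \<in> K \<Longrightarrow> C a \<in> ext p K"
  using ext_coeffs monom_0_in by blast

lemma ext_mono: "K \<subseteq> L \<Longrightarrow> ext p K \<subseteq> ext p L"
  unfolding ext_def using P.adj_mono coeffs_in_mono by blast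

lemma ext_least:
  assumes J: "ideal J P" and K: "ideal K R" "\<And>a. a \<in> K \<Longrightarrow> C a \<in> J" and "p \<in> J"
  shows "ext p K \<subseteq> J"
  unfolding ext_def
  using P.adj_least[OF J coeffs_in_least[OF J R.ideal_sub[OF K(1)] K(2)] assms(4)] by blast

lemma extE:
  assumes "f \<in> ext p K"
  obtains g h where "f = g \<oplus>\<^bsub>P\<^esub> h \<otimes>\<^bsub>P\<^esub> p" "g \<in> coeffs_in K" "h \<in> carrier P"
  using assms unfolding ext_def by (rule P.adjE)

lemma ext_contract: assumes K: "ideal K R" and a: "a \<in> carrier R" "C a \<in> ext p K" shows "a \<in> K"
proof -
  have "C a \<in> coeffs_in K" using monic_contract[OF p K _ _ a(2)] a(1) e by simp
  then have "cf (C a) 0 \<in> K" unfolding coeffs_in_def mem_Collect_eq by (elim conjE spec)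
  then show ?thesis using a(1) by simp
qed

lemma ext_mult:
  assumes K: "ideal K R" and J: "ideal J R" and I: "ideal I R" and KJ: "\<And>a b. a \<in> K \<Longrightarrow> b \<in> J \<Longrightarrow> a \<otimes> b \<in> I"
    and u: "u \<in> ext p K" and v: "v \<in> ext p J"
  shows "u \<otimes>\<^bsub>P\<^esub> v \<in> ext p I"
proof -
  obtain f g where f: "u = f \<oplus>\<^bsub>P\<^esub> g \<otimes>\<^bsub>P\<^esub> p" "f \<in> coeffs_in K" "g \<in> carrier P" using u by (rule extE)
  obtain f' g' where f': "v = f' \<oplus>\<^bsub>P\<^esub> g' \<otimes>\<^bsub>P\<^esub> p" "f' \<in> coeffs_in J" "g' \<in> carrier P" using v by (rule extE)
  have c: "f \<in> carrier P" "f' \<in> carrier P" using f f' by (auto simp: coeffs_in_def)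
  have "f \<otimes>\<^bsub>P\<^esub> f' \<in> coeffs_in I"
    by (rule coeffs_in_mult[OF I c]) (use f f' KJ in \<open>auto simp: coeffs_in_def\<close>)
  then have 1: "f \<otimes>\<^bsub>P\<^esub> f' \<in> ext p I" using ext_coeffs[OF I] by blast
  have "u \<otimes>\<^bsub>P\<^esub> v = f \<otimes>\<^bsub>P\<^esub> f' \<oplus>\<^bsub>P\<^esub> (f \<otimes>\<^bsub>P\<^esub> g' \<oplus>\<^bsub>P\<^esub> g \<otimes>\<^bsub>P\<^esub> f' \<oplus>\<^bsub>P\<^esub> g \<otimes>\<^bsub>P\<^esub> g' \<otimes>\<^bsub>P\<^esub> p) \<otimes>\<^bsub>P\<^esub> p"
    unfolding f(1) f'(1) using c f(3) f'(3) pP by algebra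
  then show ?thesis
    using P.ideal_add[OF ext_ideal[OF I] 1 P.ideal_l[OF ext_ideal[OF I] ext_p[OF I]]] c f(3) f'(3) pP by simp
qed

lemma ext_adj:
  assumes K: "ideal K R" and a: "a \<in> carrier R"
  shows "P.adj (ext p K) (C a) = ext p (R.adj K a)"
proof
  have Ka: "ideal (R.adj K a) R" using R.adj_ideal[OF K a] .
  show "P.adj (ext p K) (C a) \<subseteq> ext p (R.adj K a)"
    using P.adj_least[OF ext_ideal[OF Ka] ext_mono[OF R.adj_sub[OF K a]] ext_C[OF Ka R.adj_gen[OF K a]]] .
  have Ca: "C a \<in> carrier P" using a by simp
  have Ji: "ideal (P.adj (ext p K) (C a)) P" using P.adj_ideal[OF ext_ideal[OF K] Ca] .
  note sub = P.adj_sub[OF ext_ideal[OF K] Ca]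
  show "ext p (R.adj K a) \<subseteq> P.adj (ext p K) (C a)"
  proof (rule ext_least[OF Ji Ka])
    show "p \<in> P.adj (ext p K) (C a)" using sub ext_p[OF K] by blast
    fix b assume "b \<in> R.adj K a"
    then obtain k r where k: "b = k \<oplus> r \<otimes> a" "k \<in> K" "r \<in> carrier R" by (rule R.adjE)
    have kc: "k \<in> carrier R" using k K R.ideal_carr by auto
    have "C b = C k \<oplus>\<^bsub>P\<^esub> C r \<otimes>\<^bsub>P\<^esub> C a"
      unfolding k(1) using kc k(3) a monom_mult[of r a 0 0] by simp
    then show "C b \<in> P.adj (ext p K) (C a)" using P.adj_mem[OF ext_C[OF K k(2)], of "C r" "C a"] k(3) by simp
  qed
qed

text \<open>Extension turns a composition series over \<open>\<nn>\<close> into one over \<open>M\<close>, with the same elements: a step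
  stays proper by \<open>ext_contract\<close>, and stays simple because \<open>M = \<nn>[Y] + (p)\<close>.\<close>

lemma ext_colength: "n.colength K l \<Longrightarrow> M.colength (ext p K) l"
proof (induction rule: n.colength.induct)
  case top
  have "ext p (carrier R) = carrier P"
    using ext_coeffs[OF R.oneideal] coeffs_in_carrier P.ideal_sub[OF ext_ideal[OF R.oneideal]] by auto
  then show ?case using M.colength.top by simp
next
  case (step K a l)
  have Ca: "C a \<in> carrier P" using step(2) by simp
  have nK: "C a \<notin> ext p K" using ext_contract[OF step(1,2)] step(3) by blast
  have "v \<otimes>\<^bsub>P\<^esub> C a \<in> ext p K" if v: "v \<in> M" for v
  proof (rule ext_mult[OF n.n_ideal R.cgenideal_ideal[OF step(2)] step(1)])
    show "v \<in> ext p \<nn>" using v M_eq by simp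
    show "C a \<in> ext p (PIdl a)" using ext_C[OF R.cgenideal_ideal[OF step(2)]] R.cgenideal_self[OF step(2)] by blast
    fix r b assume r: "r \<in> \<nn>" and "b \<in> PIdl a"
    then obtain s where s: "b = s \<otimes> a" "s \<in> carrier R" by (auto simp: cgenideal_def)
    have "r \<otimes> b = s \<otimes> (r \<otimes> a)" unfolding s(1) using n.n_carr[OF r] s(2) step(2) by algebra
    then show "r \<otimes> b \<in> K" using R.ideal_l[OF step(1) step(4)[OF r] s(2)] by simp
  qed
  then show ?case
    using M.colength.step[OF ext_ideal[OF step(1)] Ca nK] step.IH unfolding ext_adj[OF step(1,2)] by blast
qed

lemma ext_fin: "n.fin K \<Longrightarrow> M.fin (ext p K)" and ext_len: "n.fin K \<Longrightarrow> M.len (ext p K) = n.len K"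
  using ext_colength[of K "n.len K"] n.fin_len[of K] M.len_eq M.fin_def by blast+

text \<open>A socle element may be reduced modulo \<open>p\<close> to a polynomial of degree less than \<open>e\<close>. The
  coefficients of this remainder are killed by \<open>\<nn>\<close> modulo \<open>I\<close>, by \<open>monic_contract\<close>, so each of
  them is a multiple of \<open>\<omega>\<close>.\<close>

lemma ext_simple_socle:
  assumes I: "ideal I R" and s: "n.simple_socle I \<omega>"
  shows "M.simple_socle (ext p I) (C \<omega>)"
  unfolding M.simple_socle_def
proof (intro conjI ballI impI)
  have wc: "\<omega> \<in> carrier R" and wI: "\<omega> \<notin> I" and nw: "\<And>r. r \<in> \<nn> \<Longrightarrow> r \<otimes> \<omega> \<in> I"
    and soc: "\<And>t. t \<in> carrier R \<Longrightarrow> (\<And>r. r \<in> \<nn> \<Longrightarrow> r \<otimes> t \<in> I) \<Longrightarrow> t \<in> R.adj I \<omega>"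
    using s by (auto simp: n.simple_socle_def)
  show "C \<omega> \<in> carrier P" using wc by simp
  show "C \<omega> \<notin> ext p I" using ext_contract[OF I wc] wI by blast
  have wi: "ideal (R.adj I \<omega>) R" using R.adj_ideal[OF I wc] .
  show "v \<otimes>\<^bsub>P\<^esub> C \<omega> \<in> ext p I" if v: "v \<in> M" for v
  proof (rule ext_mult[OF n.n_ideal wi I])
    show "v \<in> ext p \<nn>" using v M_eq by simp
    show "C \<omega> \<in> ext p (R.adj I \<omega>)" using ext_C[OF wi R.adj_gen[OF I wc]] .
    fix r b assume r: "r \<in> \<nn>" and "b \<in> R.adj I \<omega>"
    then obtain k t where k: "b = k \<oplus> t \<otimes> \<omega>" "k \<in> I" "t \<in> carrier R" by (auto elim: R.adjE)
    have kc: "k \<in> carrier R" using k I R.ideal_carr by auto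
    have "r \<otimes> b = r \<otimes> k \<oplus> t \<otimes> (r \<otimes> \<omega>)" unfolding k(1) using n.n_carr[OF r] k(3) kc wc by algebra
    then show "r \<otimes> b \<in> I"
      using R.ideal_add[OF I R.ideal_l[OF I k(2) n.n_carr[OF r]] R.ideal_l[OF I nw[OF r] k(3)]] by simp
  qed
  fix t assume t: "t \<in> carrier P" "\<forall>r\<in>M. r \<otimes>\<^bsub>P\<^esub> t \<in> ext p I"
  have "\<one> \<notin> \<nn>" using n.n_proper n.proper_iff[OF n.n_ideal] by simp
  then have "\<one> \<noteq> \<zero>" using R.ideal_zero[OF n.n_ideal] by auto
  then obtain q r where qr: "q \<in> carrier P" "r \<in> carrier P" "t = r \<oplus>\<^bsub>P\<^esub> q \<otimes>\<^bsub>P\<^esub> p" "\<And>i. i \<ge> e \<Longrightarrow> cf r i = \<zero>"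
    using monic_division[OF p t(1)] by blast
  have "v \<otimes> cf r j \<in> I" if v: "v \<in> \<nn>" for v j
  proof -
    have vc: "v \<in> carrier R" using n.n_carr[OF v] .
    have "C v \<in> M" unfolding M_eq using ext_C[OF n.n_ideal v] .
    then have "C v \<otimes>\<^bsub>P\<^esub> t \<in> ext p I" using t(2) by blast
    moreover have "C v \<otimes>\<^bsub>P\<^esub> t = (C v \<otimes>\<^bsub>P\<^esub> q) \<otimes>\<^bsub>P\<^esub> p \<oplus>\<^bsub>P\<^esub> C v \<otimes>\<^bsub>P\<^esub> r"
    proof -
      have "C v \<in> carrier P" using vc by simp
      then show ?thesis unfolding qr(3) using qr(1,2) pP by algebra
    qed
    moreover have "(C v \<otimes>\<^bsub>P\<^esub> q) \<otimes>\<^bsub>P\<^esub> p \<in> ext p I"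
      using P.ideal_l[OF ext_ideal[OF I] ext_p[OF I], of "C v \<otimes>\<^bsub>P\<^esub> q"] vc qr(1) by simp
    ultimately have "C v \<otimes>\<^bsub>P\<^esub> r \<in> ext p I"
      using P.ideal_add_iff[OF ext_ideal[OF I], of "(C v \<otimes>\<^bsub>P\<^esub> q) \<otimes>\<^bsub>P\<^esub> p" "C v \<otimes>\<^bsub>P\<^esub> r"] vc qr(2) by simp
    then have "C v \<otimes>\<^bsub>P\<^esub> r \<in> coeffs_in I"
      using monic_contract[OF p I, of "C v \<otimes>\<^bsub>P\<^esub> r"] vc qr(2,4) const_mult_coeff[OF vc qr(2)] by (simp del: coeff_mult)
    then have "cf (C v \<otimes>\<^bsub>P\<^esub> r) j \<in> I" unfolding coeffs_in_def mem_Collect_eq by (elim conjE spec)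
    then show ?thesis unfolding const_mult_coeff[OF vc qr(2)] .
  qed
  then have "r \<in> coeffs_in (R.adj I \<omega>)" using soc qr(2) by (simp add: coeffs_in_def)
  then have "r \<in> P.adj (ext p I) (C \<omega>)" unfolding ext_adj[OF I wc] using ext_coeffs[OF wi] by blast
  moreover have Ai: "ideal (P.adj (ext p I) (C \<omega>)) P" unfolding ext_adj[OF I wc] using ext_ideal[OF wi] .
  moreover have "p \<in> P.adj (ext p I) (C \<omega>)" unfolding ext_adj[OF I wc] using ext_p[OF wi] .
  ultimately show "t \<in> P.adj (ext p I) (C \<omega>)"
    unfolding qr(3) using P.ideal_add[OF Ai _ P.ideal_l[OF Ai _ qr(1)]] by blast
qed

end

section \<open>Generic coordinates\<close>

locale generic_form = UP_cring R P + n: max_ring R \<nn> + T: three_gens R x y z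
  for R (structure) and P (structure) and \<nn> x y z +
  assumes xn: "x \<in> \<nn>" and yn: "y \<in> \<nn>" and zn: "z \<in> \<nn>" and n_gen: "\<nn> \<subseteq> R.pw x y z (Suc 0)"
begin

abbreviation C where "C a \<equiv> up_ring.monom P a 0"
abbreviation Y where "Y k \<equiv> up_ring.monom P \<one> k"

lemma C_add: "a \<in> carrier R \<Longrightarrow> b \<in> carrier R \<Longrightarrow> C (a \<oplus> b) = C a \<oplus>\<^bsub>P\<^esub> C b"
  by simp

lemma C_mult: "a \<in> carrier R \<Longrightarrow> b \<in> carrier R \<Longrightarrow> C (a \<otimes> b) = C a \<otimes>\<^bsub>P\<^esub> C b"
  using monom_mult[of a b 0 0] by simp

lemma C_closed: "a \<in> carrier R \<Longrightarrow> C a \<in> carrier P" by simp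

lemma Y_closed: "Y k \<in> carrier P" by simp

text \<open>Substituting \<open>x = Yy\<close> into a form \<open>\<Sum> d\<^sub>k x\<^sup>k y\<^sup>t\<^sup>-\<^sup>k\<close> turns it into \<open>c y\<^sup>t\<close>, where \<open>c = \<Sum> d\<^sub>k
  Y\<^sup>k\<close>. No information is lost: if all coefficients of \<open>c\<close> lie in \<open>\<nn>\<close>, then the form lies in the
  next power of \<open>\<nn>\<close>. The bound on the degree of \<open>c\<close> leaves room for a second substitution.\<close>

lemma generic_two:
  assumes "q \<in> R.qw x y t"
  shows "\<exists>c\<in>carrier P. (\<forall>i>t. cf c i = \<zero>) \<and> (c \<in> coeffs_in \<nn> \<longrightarrow> q \<in> R.pw x y z (Suc t)) \<and>
    (\<forall>J. ideal J P \<longrightarrow> C x \<ominus>\<^bsub>P\<^esub> Y 1 \<otimes>\<^bsub>P\<^esub> C y \<in> J \<longrightarrow> C q \<ominus>\<^bsub>P\<^esub> c \<otimes>\<^bsub>P\<^esub> C (y [^]\<^bsub>R\<^esub> t) \<in> J)"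
  using assms
proof (induction t arbitrary: q)
  case 0
  then have q: "q \<in> carrier R" by simp
  have "C q \<in> coeffs_in \<nn> \<Longrightarrow> q \<in> \<nn>"
  proof -
    assume "C q \<in> coeffs_in \<nn>"
    then have "cf (C q) 0 \<in> \<nn>" unfolding coeffs_in_def mem_Collect_eq by (elim conjE spec)
    then show "q \<in> \<nn>" using q by simp
  qed
  then have "C q \<in> coeffs_in \<nn> \<longrightarrow> q \<in> R.pw x y z (Suc 0)" using n_gen by blast
  moreover have "C q \<ominus>\<^bsub>P\<^esub> C q \<otimes>\<^bsub>P\<^esub> C (y [^]\<^bsub>R\<^esub> (0::nat)) = \<zero>\<^bsub>P\<^esub>" 
    using q by (simp add: P.minus_eq P.r_neg)
  then have "\<forall>J. ideal J P \<longrightarrow> C q \<ominus>\<^bsub>P\<^esub> C q \<otimes>\<^bsub>P\<^esub> C (y [^]\<^bsub>R\<^esub> (0::nat)) \<in> J"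
    using P.ideal_zero by simp
  moreover have "\<forall>i>0. cf (C q) i = \<zero>" using q by simp
  ultimately show ?case using C_closed[OF q] by blast
next
  case (Suc t)
  obtain u r where u: "q = x \<otimes> u \<oplus> y [^] Suc t \<otimes> r" "u \<in> R.qw x y t" "r \<in> carrier R" using Suc.prems by (rule T.qwE)
  have uc: "u \<in> carrier R" using T.qw_carr[OF u(2)] .
  obtain c where c: "c \<in> carrier P" "\<forall>i>t. cf c i = \<zero>" "c \<in> coeffs_in \<nn> \<longrightarrow> u \<in> R.pw x y z (Suc t)"
    and cJ: "\<And>J. ideal J P \<Longrightarrow> C x \<ominus>\<^bsub>P\<^esub> Y 1 \<otimes>\<^bsub>P\<^esub> C y \<in> J \<Longrightarrow> C u \<ominus>\<^bsub>P\<^esub> c \<otimes>\<^bsub>P\<^esub> C (y [^]\<^bsub>R\<^esub> t) \<in> J"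
    using Suc.IH[OF u(2)] by blast
  let ?c = "Y 1 \<otimes>\<^bsub>P\<^esub> c \<oplus>\<^bsub>P\<^esub> C r"
  have cc: "?c \<in> carrier P" using c(1) u(3) by simp
  have co: "cf ?c i = (if i = 0 then r else cf c (i - 1))" for i
    using c(1) u(3) coeff_monom_mult'[OF R.one_closed c(1), of 1 i] by (simp del: coeff_mult)
  have "q \<in> R.pw x y z (Suc (Suc t))" if "?c \<in> coeffs_in \<nn>"
  proof -
    have *: "cf ?c i \<in> \<nn>" for i using that unfolding coeffs_in_def mem_Collect_eq by (elim conjE spec)
    have "r \<in> \<nn>" using *[of 0] co[of 0] by simp
    moreover have "cf c i \<in> \<nn>" for i using *[of "Suc i"] co[of "Suc i"] by simp
    then have "u \<in> R.pw x y z (Suc t)" using c by (simp add: coeffs_in_def)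
    then have "x \<otimes> u \<in> R.pw x y z (Suc (Suc t))" by (rule T.pw_gens)
    moreover have "y [^] Suc t \<otimes> r \<in> R.pw x y z (Suc (Suc t))"
      using T.pw_mult[OF T.pw_pow(2)[of "Suc t"], of r "Suc 0"] n_gen \<open>r \<in> \<nn>\<close> by (simp del: R.pw.simps R.nat_pow_Suc add: subset_iff)
    ultimately show ?thesis unfolding u(1) using R.ideal_add[OF T.pw_ideal] by blast
  qed
  moreover have "C q \<ominus>\<^bsub>P\<^esub> ?c \<otimes>\<^bsub>P\<^esub> C (y [^]\<^bsub>R\<^esub> Suc t) \<in> J"
    if J: "ideal J P" "C x \<ominus>\<^bsub>P\<^esub> Y 1 \<otimes>\<^bsub>P\<^esub> C y \<in> J" for J
  proof -
    have ys: "C (y [^]\<^bsub>R\<^esub> Suc t) = C (y [^]\<^bsub>R\<^esub> t) \<otimes>\<^bsub>P\<^esub> C y" using C_mult[of "y [^] t" y] by simp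
    have q: "C q = C x \<otimes>\<^bsub>P\<^esub> C u \<oplus>\<^bsub>P\<^esub> (C (y [^]\<^bsub>R\<^esub> t) \<otimes>\<^bsub>P\<^esub> C y) \<otimes>\<^bsub>P\<^esub> C r"
      unfolding u(1) ys[symmetric] using C_add[of "x \<otimes> u" "y [^] Suc t \<otimes> r"] C_mult[of x u] C_mult[of "y [^] Suc t" r] uc u(3)
      by (simp only: T.xc T.yc R.m_closed R.nat_pow_closed simp_thms)
    define cx cy cu cr ct where "cx = C x" "cy = C y" "cu = C u" "cr = C r" "ct = C (y [^]\<^bsub>R\<^esub> t)"
    note defs = this
    have cl: "cx \<in> carrier P" "cy \<in> carrier P" "cu \<in> carrier P" "cr \<in> carrier P" "ct \<in> carrier P" "Y 1 \<in> carrier P"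
      unfolding defs using uc u(3) by simp_all
    have "C q \<ominus>\<^bsub>P\<^esub> ?c \<otimes>\<^bsub>P\<^esub> C (y [^]\<^bsub>R\<^esub> Suc t) =
      (cx \<otimes>\<^bsub>P\<^esub> cu \<oplus>\<^bsub>P\<^esub> (ct \<otimes>\<^bsub>P\<^esub> cy) \<otimes>\<^bsub>P\<^esub> cr) \<ominus>\<^bsub>P\<^esub> (Y 1 \<otimes>\<^bsub>P\<^esub> c \<oplus>\<^bsub>P\<^esub> cr) \<otimes>\<^bsub>P\<^esub> (ct \<otimes>\<^bsub>P\<^esub> cy)"
      unfolding q ys defs ..
    also have "\<dots> = cu \<otimes>\<^bsub>P\<^esub> (cx \<ominus>\<^bsub>P\<^esub> Y 1 \<otimes>\<^bsub>P\<^esub> cy) \<oplus>\<^bsub>P\<^esub> (Y 1 \<otimes>\<^bsub>P\<^esub> cy) \<otimes>\<^bsub>P\<^esub> (cu \<ominus>\<^bsub>P\<^esub> c \<otimes>\<^bsub>P\<^esub> ct)"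
      using cl c(1) by algebra
    also have "\<dots> \<in> J"
      by (intro P.ideal_add[OF J(1)] P.ideal_l[OF J(1)])
         (use cl J(2) cJ[OF J] in \<open>simp_all add: defs[symmetric]\<close>)
    finally show ?thesis .
  qed
  moreover have "\<forall>i>Suc t. cf ?c i = \<zero>" using co c(2) by auto
  ultimately show ?case using cc by blast
qed

text \<open>The form is \<open>\<Sum> z\<^sup>j q\<^sub>j\<close> with forms \<open>q\<^sub>j\<close> in \<open>x, y\<close> of degree \<open>t - j\<close>. Substituting \<open>z = Y\<^sup>N y\<close>
  and \<open>x = Yy\<close> gives \<open>c = \<Sum> Y\<^sup>N\<^sup>j c\<^sub>j\<close>, where \<open>c\<^sub>j\<close> belongs to \<open>q\<^sub>j\<close> and has degree at most \<open>t - j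
  < N\<close>. So the summands do not overlap, and \<open>c\<close> determines all \<open>c\<^sub>j\<close>.\<close>

lemma generic_three:
  assumes "f \<in> R.pw x y z t" "t < N"
  shows "\<exists>c\<in>carrier P. (c \<in> coeffs_in \<nn> \<longrightarrow> f \<in> R.pw x y z (Suc t)) \<and>
    (\<forall>J. ideal J P \<longrightarrow> C x \<ominus>\<^bsub>P\<^esub> Y 1 \<otimes>\<^bsub>P\<^esub> C y \<in> J \<longrightarrow> C z \<ominus>\<^bsub>P\<^esub> Y N \<otimes>\<^bsub>P\<^esub> C y \<in> J \<longrightarrow>
      C f \<ominus>\<^bsub>P\<^esub> c \<otimes>\<^bsub>P\<^esub> C (y [^]\<^bsub>R\<^esub> t) \<in> J)"
  using assms
proof (induction t arbitrary: f)
  case 0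
  then have "f \<in> R.qw x y 0" by simp
  from generic_two[OF this] show ?case by blast
next
  case (Suc t)
  obtain q b where b: "q \<in> R.qw x y (Suc t)" "b \<in> R.pw x y z t" "f = q \<oplus> z \<otimes> b"
    using T.pw_decomp[OF Suc.prems(1)] by blast
  have bc: "b \<in> carrier R" "q \<in> carrier R" using T.pw_carr[OF b(2)] T.qw_carr[OF b(1)] by auto
  obtain c1 where c1: "c1 \<in> carrier P" "\<forall>i>Suc t. cf c1 i = \<zero>" "c1 \<in> coeffs_in \<nn> \<longrightarrow> q \<in> R.pw x y z (Suc (Suc t))"
    and c1J: "\<And>J. ideal J P \<Longrightarrow> C x \<ominus>\<^bsub>P\<^esub> Y 1 \<otimes>\<^bsub>P\<^esub> C y \<in> J \<Longrightarrow> C q \<ominus>\<^bsub>P\<^esub> c1 \<otimes>\<^bsub>P\<^esub> C (y [^]\<^bsub>R\<^esub> Suc t) \<in> J"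
    using generic_two[OF b(1)] by blast
  obtain c2 where c2: "c2 \<in> carrier P" "c2 \<in> coeffs_in \<nn> \<longrightarrow> b \<in> R.pw x y z (Suc t)"
    and c2J: "\<And>J. ideal J P \<Longrightarrow> C x \<ominus>\<^bsub>P\<^esub> Y 1 \<otimes>\<^bsub>P\<^esub> C y \<in> J \<Longrightarrow> C z \<ominus>\<^bsub>P\<^esub> Y N \<otimes>\<^bsub>P\<^esub> C y \<in> J \<Longrightarrow>
      C b \<ominus>\<^bsub>P\<^esub> c2 \<otimes>\<^bsub>P\<^esub> C (y [^]\<^bsub>R\<^esub> t) \<in> J"
    using Suc.IH[OF b(2)] Suc.prems(2) by auto
  let ?c = "c1 \<oplus>\<^bsub>P\<^esub> Y N \<otimes>\<^bsub>P\<^esub> c2"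
  have cc: "?c \<in> carrier P" using c1(1) c2(1) by simp
  have co: "cf ?c i = cf c1 i \<oplus> (if N \<le> i then cf c2 (i - N) else \<zero>)" for i
    using c1(1) c2(1) coeff_monom_mult'[OF R.one_closed c2(1), of N i] by (simp del: coeff_mult)
  have "f \<in> R.pw x y z (Suc (Suc t))" if "?c \<in> coeffs_in \<nn>"
  proof -
    have *: "cf ?c i \<in> \<nn>" for i using that unfolding coeffs_in_def mem_Collect_eq by (elim conjE spec)
    have "cf c1 i \<in> \<nn>" for i
    proof (cases "i < N")
      case True
      then show ?thesis using *[of i] co[of i] c1(1) by simp
    next
      case False
      then show ?thesis using c1(2) Suc.prems(2) R.ideal_zero[OF n.n_ideal] by simp
    qed
    then have c1n: "c1 \<in> coeffs_in \<nn>" using c1(1) by (simp add: coeffs_in_def)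
    have "cf c2 i \<in> \<nn>" for i
    proof -
      have "cf c1 (N + i) = \<zero>" using c1(2) Suc.prems(2) by simp
      then show ?thesis using *[of "N + i"] co[of "N + i"] c2(1) by simp
    qed
    then have "b \<in> R.pw x y z (Suc t)" using c2 by (simp add: coeffs_in_def)
    then have "z \<otimes> b \<in> R.pw x y z (Suc (Suc t))" by (rule T.pw_gens)
    then show ?thesis unfolding b(3) using R.ideal_add[OF T.pw_ideal] c1(3) c1n by blast
  qed
  moreover have "C f \<ominus>\<^bsub>P\<^esub> ?c \<otimes>\<^bsub>P\<^esub> C (y [^]\<^bsub>R\<^esub> Suc t) \<in> J"
    if J: "ideal J P" "C x \<ominus>\<^bsub>P\<^esub> Y 1 \<otimes>\<^bsub>P\<^esub> C y \<in> J" "C z \<ominus>\<^bsub>P\<^esub> Y N \<otimes>\<^bsub>P\<^esub> C y \<in> J" for J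
  proof -
    have ys: "C (y [^]\<^bsub>R\<^esub> Suc t) = C (y [^]\<^bsub>R\<^esub> t) \<otimes>\<^bsub>P\<^esub> C y" using C_mult[of "y [^] t" y] by simp
    have f: "C f = C q \<oplus>\<^bsub>P\<^esub> C z \<otimes>\<^bsub>P\<^esub> C b"
      unfolding b(3) using C_add[of q "z \<otimes> b"] C_mult[of z b] bc by (simp only: T.zc R.m_closed simp_thms)
    define cz cy cq cb ct where "cz = C z" "cy = C y" "cq = C q" "cb = C b" "ct = C (y [^]\<^bsub>R\<^esub> t)"
    note defs = this
    have cl: "cz \<in> carrier P" "cy \<in> carrier P" "cq \<in> carrier P" "cb \<in> carrier P" "ct \<in> carrier P" "Y N \<in> carrier P"
      unfolding defs using bc by simp_all
    have "C f \<ominus>\<^bsub>P\<^esub> ?c \<otimes>\<^bsub>P\<^esub> C (y [^]\<^bsub>R\<^esub> Suc t) =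
      (cq \<oplus>\<^bsub>P\<^esub> cz \<otimes>\<^bsub>P\<^esub> cb) \<ominus>\<^bsub>P\<^esub> (c1 \<oplus>\<^bsub>P\<^esub> Y N \<otimes>\<^bsub>P\<^esub> c2) \<otimes>\<^bsub>P\<^esub> (ct \<otimes>\<^bsub>P\<^esub> cy)"
      unfolding f ys defs ..
    also have "\<dots> = (cq \<ominus>\<^bsub>P\<^esub> c1 \<otimes>\<^bsub>P\<^esub> (ct \<otimes>\<^bsub>P\<^esub> cy)) \<oplus>\<^bsub>P\<^esub> (cb \<otimes>\<^bsub>P\<^esub> (cz \<ominus>\<^bsub>P\<^esub> Y N \<otimes>\<^bsub>P\<^esub> cy) \<oplus>\<^bsub>P\<^esub> (Y N \<otimes>\<^bsub>P\<^esub> cy) \<otimes>\<^bsub>P\<^esub> (cb \<ominus>\<^bsub>P\<^esub> c2 \<otimes>\<^bsub>P\<^esub> ct))"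
      using cl c1(1) c2(1) by algebra
    also have "\<dots> \<in> J"
      by (intro P.ideal_add[OF J(1)] P.ideal_l[OF J(1)])
         (use cl J(3) c1J[OF J(1,2)] c2J[OF J] ys in \<open>simp_all add: defs[symmetric]\<close>)
    finally show ?thesis .
  qed
  ultimately show ?case using cc by blast
qed

text \<open>In the coordinates \<open>x - Yy\<close>, \<open>z - Y\<^sup>N y\<close>, \<open>y\<close> with \<open>N = a + 1\<close>, the element \<open>f\<close> becomes \<open>c
  y\<^sup>a\<close>. Since \<open>c\<close> lies outside \<open>M\<close>, it is a unit modulo the ideal generated by the extension of
  \<open>I\<close> and the first two coordinates; so \<open>y\<^sup>a\<close> belongs to this ideal, as
  \<open>gorenstein_generators_bound\<close> requires.\<close>

theorem generators_bound:
  assumes I: "ideal I R" and s: "n.simple_socle I \<omega>" and f: "f \<in> I" "f \<in> R.pw x y z a" "f \<notin> R.pw x y z (Suc a)"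
    and fin: "n.fin {x \<otimes> u \<oplus> y \<otimes> v \<oplus> z \<otimes> w | u v w. u \<in> I \<and> v \<in> I \<and> w \<in> I}" (is "n.fin ?D")
  shows "n.len ?D \<le> n.len I + (2 * a + 1)"
proof -
  obtain c where c: "c \<in> carrier P" "c \<notin> coeffs_in \<nn>" and cJ: "\<And>J. ideal J P \<Longrightarrow> C x \<ominus>\<^bsub>P\<^esub> Y 1 \<otimes>\<^bsub>P\<^esub> C y \<in> J \<Longrightarrow>
      C z \<ominus>\<^bsub>P\<^esub> Y (Suc a) \<otimes>\<^bsub>P\<^esub> C y \<in> J \<Longrightarrow> C f \<ominus>\<^bsub>P\<^esub> c \<otimes>\<^bsub>P\<^esub> C (y [^]\<^bsub>R\<^esub> a) \<in> J"
    using generic_three[OF f(2) lessI] f(3) by blast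
  obtain M p e where M: "max_ring P M" "monic p e" "e > 0" "M = ext p \<nn>" "c \<notin> M"
    using exists_residue_extension[OF n.max_ring_axioms c] by blast
  interpret M: max_ring P M by (rule M)
  interpret E: residue_extension R P \<nn> M p e
    by (intro residue_extension.intro residue_extension_axioms.intro UP_cring_axioms n.max_ring_axioms M
        M(1)[unfolded P_def]) (fact P_def)
  have Di: "ideal ?D R" using T.step_ideal[OF I] .
  have DI: "?D \<subseteq> I" using T.step_least[OF I] R.ideal_l[OF I] by simp
  have nI: "r \<otimes> i \<in> ?D" if r: "r \<in> \<nn>" and i: "i \<in> I" for r i
    using T.step_mem[OF I _ i] r n_gen by blast
  let ?x = "C x \<ominus>\<^bsub>P\<^esub> Y 1 \<otimes>\<^bsub>P\<^esub> C y" and ?z = "C z \<ominus>\<^bsub>P\<^esub> Y (Suc a) \<otimes>\<^bsub>P\<^esub> C y"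
  have CM: "C u \<in> M" if "u \<in> \<nn>" for u unfolding M(4) using E.ext_C[OF n.n_ideal that] .
  have xzM: "?x \<in> M" "?z \<in> M"
    using P.ideal_minus[OF M.n_ideal CM[OF xn] P.ideal_l[OF M.n_ideal CM[OF yn] Y_closed]]
      P.ideal_minus[OF M.n_ideal CM[OF zn] P.ideal_l[OF M.n_ideal CM[OF yn] Y_closed]] by auto
  have cl: "?x \<in> carrier P" "?z \<in> carrier P" "C y \<in> carrier P" "C x \<in> carrier P" "C z \<in> carrier P" by simp_all
  let ?D' = "ext p ?D" and ?I' = "ext p I"
  have fD: "M.fin ?D'" using E.ext_fin[OF fin] .
  have fI: "M.fin ?I'" using E.ext_fin[OF n.fin_mono[OF fin I DI]] .
  have I'i: "ideal ?I' P" and D'i: "ideal ?D' P" using E.ext_ideal I Di by auto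
  let ?Q = "P.adj (P.adj ?I' ?x) ?z"
  let ?J1 = "P.adj ?D' ?x" let ?J2 = "P.adj ?J1 ?z" let ?J = "P.adj ?J2 (C y)"
  have J: "ideal ?J1 P" "ideal ?J2 P" "ideal ?J P" using P.adj_ideal D'i cl by auto
  have fQ: "M.fin ?Q" "M.fin (P.adj ?I' ?x)" using M.fin_adj fI cl by auto
  have Qi: "ideal ?Q P" "ideal (P.adj ?I' ?x) P" using fQ M.fin_ideal by auto
  have subJ: "?D' \<subseteq> ?J" using P.adj_sub[OF D'i cl(1)] P.adj_sub[OF J(1) cl(2)] P.adj_sub[OF J(2) cl(3)] by blast
  have xzJ: "?x \<in> ?J" "?z \<in> ?J" "C y \<in> ?J"
    using P.adj_gen[OF D'i cl(1)] P.adj_sub[OF J(1) cl(2)] P.adj_gen[OF J(1) cl(2)] P.adj_sub[OF J(2) cl(3)]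
      P.adj_gen[OF J(2) cl(3)] by blast+
  have CJ: "C x \<in> ?J" "C z \<in> ?J"
    using P.ideal_minus_iff[OF J(3) xzJ(1)] P.ideal_minus_iff[OF J(3) xzJ(2)] P.ideal_l[OF J(3) xzJ(3) Y_closed] cl by auto
  have MJ: "M \<subseteq> ?J"
    unfolding M(4)
  proof (rule E.ext_least[OF J(3) n.n_ideal])
    show "p \<in> ?J" using E.ext_p[OF Di] subJ by blast
    fix r assume "r \<in> \<nn>"
    then have "r \<in> R.pw x y z (Suc 0)" using n_gen by blast
    then obtain u v w where u: "r = x \<otimes> u \<oplus> y \<otimes> v \<oplus> z \<otimes> w" "u \<in> carrier R" "v \<in> carrier R" "w \<in> carrier R"
      by (auto elim: T.pwE)
    have "C r = C x \<otimes>\<^bsub>P\<^esub> C u \<oplus>\<^bsub>P\<^esub> C y \<otimes>\<^bsub>P\<^esub> C v \<oplus>\<^bsub>P\<^esub> C z \<otimes>\<^bsub>P\<^esub> C w"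
      unfolding u(1) using u(2-4) C_add C_mult by simp
    then show "C r \<in> ?J"
      using P.ideal_add[OF J(3) P.ideal_add[OF J(3) P.ideal_r[OF J(3) CJ(1)] P.ideal_r[OF J(3) xzJ(3)]] P.ideal_r[OF J(3) CJ(2)]]
        C_closed u(2-4) by simp
  qed
  have ya: "C y [^]\<^bsub>P\<^esub> a = C (y [^]\<^bsub>R\<^esub> a)"
    using monom_pow[OF T.yc, of 0 a] by simp
  have yac: "C (y [^]\<^bsub>R\<^esub> a) \<in> carrier P" by simp
  have xzQ: "?x \<in> ?Q" "?z \<in> ?Q"
    using P.adj_gen[OF I'i cl(1)] P.adj_sub[OF Qi(2) cl(2)] P.adj_gen[OF Qi(2) cl(2)] by blast+
  have "C f \<in> ?Q"
    using E.ext_C[OF I f(1)] P.adj_sub[OF I'i cl(1)] P.adj_sub[OF Qi(2) cl(2)] by blast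
  then have "c \<otimes>\<^bsub>P\<^esub> C (y [^]\<^bsub>R\<^esub> a) \<in> ?Q"
    using P.ideal_minus_iff[OF Qi(1) cJ[OF Qi(1) xzQ]] C_closed[OF R.ideal_carr[OF I f(1)]] c(1) yac by blast
  then have "c \<in> P.colon ?Q {C (y [^]\<^bsub>R\<^esub> a)}" using c(1) by (simp add: P.colon_mem1)
  then have "P.colon ?Q {C (y [^]\<^bsub>R\<^esub> a)} = carrier P"
    using M.fin_sub_n[OF M.fin_colon[OF fQ(1), of "{C (y [^]\<^bsub>R\<^esub> a)}"]] M(5) yac by blast
  then have "\<one>\<^bsub>P\<^esub> \<in> P.colon ?Q {C (y [^]\<^bsub>R\<^esub> a)}" by simp
  then have yQ: "C y [^]\<^bsub>P\<^esub> a \<in> ?Q" unfolding ya using yac by (simp add: P.colon_mem1)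
  have "M.len ?D' \<le> M.len ?I' + (2 * a + 1)"
  proof (rule M.gorenstein_generators_bound[OF fD I'i E.ext_mono[OF DI] _ xzM CM[OF yn] MJ E.ext_simple_socle[OF I s] yQ])
    fix r i assume "r \<in> M" "i \<in> ?I'"
    then show "r \<otimes>\<^bsub>P\<^esub> i \<in> ?D'" using E.ext_mult[OF n.n_ideal I Di nI] M(4) by blast
  qed
  then show ?thesis using E.ext_len[OF fin] E.ext_len[OF n.fin_mono[OF fin I DI]] by simp
qed

end

section \<open>Finite injective dimension\<close>

lemma mod_homD:
  assumes "f \<in> mod_hom R M N"
  shows "x \<in> carrier M \<Longrightarrow> f x \<in> carrier N"
    and "x \<in> carrier M \<Longrightarrow> y \<in> carrier M \<Longrightarrow> f (x \<oplus>\<^bsub>M\<^esub> y) = f x \<oplus>\<^bsub>N\<^esub> f y"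
    and "r \<in> carrier R \<Longrightarrow> x \<in> carrier M \<Longrightarrow> f (r \<odot>\<^bsub>M\<^esub> x) = r \<odot>\<^bsub>N\<^esub> f x"
  using assms by (auto simp: mod_hom_def)

lemma mod_hom_minus:
  assumes "f \<in> mod_hom R M N" "module R M" "module R N" "x \<in> carrier M" "y \<in> carrier M"
  shows "f (x \<ominus>\<^bsub>M\<^esub> y) = f x \<ominus>\<^bsub>N\<^esub> f y"
proof -
  interpret M: module R M by fact
  interpret N: module R N by fact
  have "f (x \<ominus>\<^bsub>M\<^esub> y) \<oplus>\<^bsub>N\<^esub> f y = f ((x \<ominus>\<^bsub>M\<^esub> y) \<oplus>\<^bsub>M\<^esub> y)"
    using mod_homD(2)[OF assms(1)] assms(4,5) by simp
  also have "(x \<ominus>\<^bsub>M\<^esub> y) \<oplus>\<^bsub>M\<^esub> y = x" using assms(4,5) by (simp add: M.minus_eq M.a_assoc M.l_neg)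
  finally have "f x \<ominus>\<^bsub>N\<^esub> f y = (f (x \<ominus>\<^bsub>M\<^esub> y) \<oplus>\<^bsub>N\<^esub> f y) \<ominus>\<^bsub>N\<^esub> f y" by simp
  also have "\<dots> = f (x \<ominus>\<^bsub>M\<^esub> y)"
    using mod_homD(1)[OF assms(1)] assms(4,5) by (simp add: N.minus_eq N.a_assoc N.r_neg)
  finally show ?thesis by simp
qed

context cring
begin

text \<open>An element \<open>b\<close> killed by \<open>J : a\<close> is a homomorphism from the submodule \<open>(J + (a))/J\<close> of \<open>R/J\<close>
  that sends \<open>a\<close> to \<open>b\<close>, and \<open>e\<close> is an extension of it to \<open>R/J\<close>. So this is injectivity of the
  submodule \<open>D\<close>, tested on ideals \<open>J \<subseteq> J + (a)\<close>. It is stated by elements because \<open>D\<close> will be a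
  kernel inside \<open>M\<close>.\<close>

definition lifts :: "('a, 'm, 'u) module_scheme \<Rightarrow> 'm set \<Rightarrow> bool" where
  "lifts M D \<longleftrightarrow> (\<forall>J a b. ideal J R \<longrightarrow> a \<in> carrier R \<longrightarrow> b \<in> D \<longrightarrow> (\<forall>r\<in>colon J {a}. r \<odot>\<^bsub>M\<^esub> b = \<zero>\<^bsub>M\<^esub>) \<longrightarrow>
     (\<exists>e\<in>D. (\<forall>j\<in>J. j \<odot>\<^bsub>M\<^esub> e = \<zero>\<^bsub>M\<^esub>) \<and> a \<odot>\<^bsub>M\<^esub> e = b))"

lemma liftsD:
  assumes "lifts M D" "ideal J R" "a \<in> carrier R" "b \<in> D" "\<And>r. r \<in> colon J {a} \<Longrightarrow> r \<odot>\<^bsub>M\<^esub> b = \<zero>\<^bsub>M\<^esub>"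
  obtains e where "e \<in> D" "\<And>j. j \<in> J \<Longrightarrow> j \<odot>\<^bsub>M\<^esub> e = \<zero>\<^bsub>M\<^esub>" "a \<odot>\<^bsub>M\<^esub> e = b"
  using assms unfolding lifts_def by blast

text \<open>A copy of the ideal \<open>K\<close> as a module of constant sequences; injectivity of a module is tested on
  modules of sequences. The multiplication and the unit are fillers that have to be given for a
  record of this type.\<close>

definition const_module :: "'a set \<Rightarrow> ('a, nat \<Rightarrow> 'a) module" where
  "const_module K = \<lparr>carrier = (\<lambda>u _. u) ` K, monoid.mult = (\<lambda>f g _. f 0 \<otimes> g 0), one = (\<lambda>_. \<one>),
     ring.zero = (\<lambda>_. \<zero>), ring.add = (\<lambda>f g _. f 0 \<oplus> g 0), smult = (\<lambda>r f _. r \<otimes> f 0)\<rparr>"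

lemma const_module: assumes K: "ideal K R" shows "module R (const_module K)"
proof (rule moduleI)
  have c: "u \<in> carrier R" if "u \<in> K" for u using ideal_carr[OF K that] .
  show "abelian_group (const_module K)"
  proof (rule abelian_groupI)
    fix x assume "x \<in> carrier (const_module K)"
    then obtain u where u: "x = (\<lambda>_. u)" "u \<in> K" by (auto simp: const_module_def)
    then show "\<exists>y\<in>carrier (const_module K). y \<oplus>\<^bsub>const_module K\<^esub> x = \<zero>\<^bsub>const_module K\<^esub>"
      using ideal_neg[OF K u(2)] c[OF u(2)] by (auto simp: const_module_def l_neg intro!: bexI[of _ "\<ominus> u"])
  qed (use ideal_add[OF K] ideal_zero[OF K] c in \<open>auto simp: const_module_def a_ac\<close>)
  fix x assume x: "x \<in> carrier (const_module K)"
  show "\<one> \<odot>\<^bsub>const_module K\<^esub> x = x" using x c by (auto simp: const_module_def)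
  fix r s y assume r: "r \<in> carrier R"
  show "r \<odot>\<^bsub>const_module K\<^esub> x \<in> carrier (const_module K)" using r x ideal_l[OF K] by (auto simp: const_module_def)
  { assume s: "s \<in> carrier R"
    show "(r \<oplus> s) \<odot>\<^bsub>const_module K\<^esub> x = r \<odot>\<^bsub>const_module K\<^esub> x \<oplus>\<^bsub>const_module K\<^esub> s \<odot>\<^bsub>const_module K\<^esub> x"
      using r s x c by (auto simp: const_module_def l_distr)
    show "r \<otimes> s \<odot>\<^bsub>const_module K\<^esub> x = r \<odot>\<^bsub>const_module K\<^esub> (s \<odot>\<^bsub>const_module K\<^esub> x)"
      using r s x c by (auto simp: const_module_def m_assoc) }
  { assume y: "y \<in> carrier (const_module K)"
    show "r \<odot>\<^bsub>const_module K\<^esub> (x \<oplus>\<^bsub>const_module K\<^esub> y) = r \<odot>\<^bsub>const_module K\<^esub> x \<oplus>\<^bsub>const_module K\<^esub> r \<odot>\<^bsub>const_module K\<^esub> y"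
      using r x y c by (auto simp: const_module_def r_distr) }
qed (rule is_cring)

text \<open>The homomorphism \<open>j + ra \<mapsto> rb\<close> on \<open>J + (a)\<close> extends to \<open>R\<close>, and \<open>e\<close> is the image of \<open>1\<close>.\<close>

lemma injective_lifts:
  assumes inj: "injective_module R E"
  shows "lifts E (carrier E)"
  unfolding lifts_def
proof (intro allI impI)
  fix J a b assume J: "ideal J R" and a: "a \<in> carrier R" and b: "b \<in> carrier E"
    and kill: "\<forall>r\<in>colon J {a}. r \<odot>\<^bsub>E\<^esub> b = \<zero>\<^bsub>E\<^esub>"
  interpret E: module R E using inj by (simp add: injective_module_def)
  let ?K = "adj J a"
  have K: "ideal ?K R" using adj_ideal[OF J a] .
  define f where "f g = (SOME r. r \<in> carrier R \<and> g (0::nat) \<ominus> r \<otimes> a \<in> J) \<odot>\<^bsub>E\<^esub> b" for g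
  \<comment> \<open>The value does not depend on the chosen \<open>r\<close>, because two choices differ by an element of \<open>J : a\<close>.\<close>
  have f: "f g = r \<odot>\<^bsub>E\<^esub> b" if r: "r \<in> carrier R" "g 0 \<ominus> r \<otimes> a \<in> J" and g: "g 0 \<in> carrier R" for g r
  proof -
    define s where "s = (SOME r. r \<in> carrier R \<and> g (0::nat) \<ominus> r \<otimes> a \<in> J)"
    have s: "s \<in> carrier R \<and> g 0 \<ominus> s \<otimes> a \<in> J" unfolding s_def by (rule someI[of _ r]) (use r in simp)
    have sc: "s \<in> carrier R" using s by simp
    define g0 where "g0 = g 0"
    have "(s \<ominus> r) \<otimes> a = (g0 \<ominus> r \<otimes> a) \<ominus> (g0 \<ominus> s \<otimes> a)" using sc r(1) g[folded g0_def] a by algebra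
    then have "s \<ominus> r \<in> colon J {a}" using ideal_minus[OF J r(2)] s r(1) by (simp add: colon_mem1 g0_def)
    then have "(s \<ominus> r) \<odot>\<^bsub>E\<^esub> b = \<zero>\<^bsub>E\<^esub>" using kill by blast
    moreover have "s = (s \<ominus> r) \<oplus> r" using sc r(1) by algebra
    then have "s \<odot>\<^bsub>E\<^esub> b = (s \<ominus> r) \<odot>\<^bsub>E\<^esub> b \<oplus>\<^bsub>E\<^esub> r \<odot>\<^bsub>E\<^esub> b" using E.smult_l_distr[of "s \<ominus> r" r b] sc r(1) b by simp
    ultimately show ?thesis using r(1) b by (simp add: f_def s_def[symmetric])
  qed
  have rep: "\<exists>r. r \<in> carrier R \<and> g 0 \<ominus> r \<otimes> a \<in> J \<and> g 0 \<in> carrier R" if gK: "g \<in> carrier (const_module ?K)" for g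
  proof -
    obtain u where u: "g = (\<lambda>_. u)" "u \<in> ?K" using gK by (auto simp: const_module_def)
    then obtain j r where r: "u = j \<oplus> r \<otimes> a" "j \<in> J" "r \<in> carrier R" by (auto simp: adj_def)
    have jc: "j \<in> carrier R" using ideal_carr[OF J r(2)] .
    have "u \<ominus> r \<otimes> a = j" unfolding r(1) using jc r(3) a by algebra
    then show ?thesis using u r ideal_carr[OF K u(2)] by auto
  qed
  have fhom: "f \<in> mod_hom R (const_module ?K) E"
    unfolding mod_hom_def mem_Collect_eq
  proof (intro conjI ballI)
    show "f \<in> carrier (const_module ?K) \<rightarrow> carrier E" using rep f b by fastforce
    fix g assume g: "g \<in> carrier (const_module ?K)"
    obtain r where r: "r \<in> carrier R" "g 0 \<ominus> r \<otimes> a \<in> J" "g 0 \<in> carrier R" using rep[OF g] by blast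
    { fix h assume h: "h \<in> carrier (const_module ?K)"
      obtain s where s: "s \<in> carrier R" "h 0 \<ominus> s \<otimes> a \<in> J" "h 0 \<in> carrier R" using rep[OF h] by blast
      have "(u \<oplus> v) \<ominus> (r \<oplus> s) \<otimes> a = (u \<ominus> r \<otimes> a) \<oplus> (v \<ominus> s \<otimes> a)" if "u \<in> carrier R" "v \<in> carrier R" for u v
        using that r(1) s(1) a by algebra
      then have "(g 0 \<oplus> h 0) \<ominus> (r \<oplus> s) \<otimes> a \<in> J" using ideal_add[OF J r(2) s(2)] r(3) s(3) by simp
      then have "f (g \<oplus>\<^bsub>const_module ?K\<^esub> h) = (r \<oplus> s) \<odot>\<^bsub>E\<^esub> b" using f[of "r \<oplus> s"] r s by (simp add: const_module_def)
      then show "f (g \<oplus>\<^bsub>const_module ?K\<^esub> h) = f g \<oplus>\<^bsub>E\<^esub> f h"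
        using f[of r g, OF r] f[of s h, OF s] E.smult_l_distr r(1) s(1) b by simp }
    { fix t assume t: "t \<in> carrier R"
      have "t \<otimes> u \<ominus> (t \<otimes> r) \<otimes> a = t \<otimes> (u \<ominus> r \<otimes> a)" if "u \<in> carrier R" for u
        using that r(1) t a by algebra
      then have "t \<otimes> g 0 \<ominus> (t \<otimes> r) \<otimes> a \<in> J" using ideal_l[OF J r(2) t] r(3) by simp
      then have "f (t \<odot>\<^bsub>const_module ?K\<^esub> g) = (t \<otimes> r) \<odot>\<^bsub>E\<^esub> b" using f[of "t \<otimes> r"] r t by (simp add: const_module_def)
      then show "f (t \<odot>\<^bsub>const_module ?K\<^esub> g) = t \<odot>\<^bsub>E\<^esub> f g"
        using f[of r g, OF r] E.smult_assoc1 r(1) t b by simp }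
  qed
  have id: "(\<lambda>x. x) \<in> mod_hom R (const_module ?K) (const_module (carrier R))"
    using ideal_carr[OF K] by (auto simp: mod_hom_def const_module_def)
  have inj_id: "inj_on (\<lambda>x. x) (carrier (const_module ?K))" by (simp add: inj_on_def)
  have "\<exists>g\<in>mod_hom R (const_module (carrier R)) E. \<forall>x\<in>carrier (const_module ?K). g x = f x"
    using conjunct2[OF inj[unfolded injective_module_def], rule_format, of "const_module ?K" "const_module (carrier R)" "\<lambda>x. x" f]
      const_module[OF K] const_module[OF oneideal] id inj_id fhom by blast
  then obtain g where g: "g \<in> mod_hom R (const_module (carrier R)) E" "\<forall>x\<in>carrier (const_module ?K). g x = f x"
    by blast
  let ?e = "g (\<lambda>_. \<one>)"
  have one: "(\<lambda>_. \<one>) \<in> carrier (const_module (carrier R))" by (simp add: const_module_def)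
  have e: "?e \<in> carrier E" using mod_homD(1)[OF g(1) one] .
  have ge: "r \<odot>\<^bsub>E\<^esub> ?e = f (\<lambda>_. r)" if r: "r \<in> ?K" for r
  proof -
    have rc: "r \<in> carrier R" using ideal_carr[OF K r] .
    have "r \<odot>\<^bsub>E\<^esub> ?e = g (r \<odot>\<^bsub>const_module (carrier R)\<^esub> (\<lambda>_. \<one>))" using mod_homD(3)[OF g(1) rc one] by simp
    also have "r \<odot>\<^bsub>const_module (carrier R)\<^esub> (\<lambda>_. \<one>) = (\<lambda>_. r)" using rc by (simp add: const_module_def)
    also have "g (\<lambda>_. r) = f (\<lambda>_. r)" using g(2) r by (auto simp: const_module_def)
    finally show ?thesis .
  qed
  have "j \<odot>\<^bsub>E\<^esub> ?e = \<zero>\<^bsub>E\<^esub>" if j: "j \<in> J" for j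
  proof -
    have "j \<ominus> \<zero> \<otimes> a = j" using ideal_carr[OF J j] a by algebra
    then have "f (\<lambda>_. j) = \<zero> \<odot>\<^bsub>E\<^esub> b" using f[of \<zero> "\<lambda>_. j"] j ideal_carr[OF J j] by simp
    then show ?thesis using ge[of j] adj_sub[OF J a] j b by auto
  qed
  moreover have "a \<odot>\<^bsub>E\<^esub> ?e = b"
  proof -
    have "a \<ominus> \<one> \<otimes> a = \<zero>" using a by algebra
    then have "f (\<lambda>_. a) = \<one> \<odot>\<^bsub>E\<^esub> b" using f[of \<one> "\<lambda>_. a"] a ideal_zero[OF J] by (simp add: minus_eq r_neg)
    then show ?thesis using ge[OF adj_gen[OF J a]] b by simp
  qed
  ultimately show "\<exists>e\<in>carrier E. (\<forall>j\<in>J. j \<odot>\<^bsub>E\<^esub> e = \<zero>\<^bsub>E\<^esub>) \<and> a \<odot>\<^bsub>E\<^esub> e = b" using e by blast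
qed

end

context max_ring
begin

text \<open>The map from \<open>Hom(R/K, M)\<close> to \<open>Hom(R/K, D)\<close> is onto, if \<open>M\<close> and its image \<open>D\<close> are injective.
  This is proved along a composition series of \<open>R/K\<close>. The element \<open>ax\<close> is killed by \<open>\<nn>\<close>, the
  annihilator of a socle element \<open>w\<close> of \<open>R\<close>; hence \<open>ax = w \<delta>(g)\<close> for some \<open>g\<close> in \<open>M\<close>. Now \<open>wg\<close> is
  killed by \<open>\<nn> = K : a\<close>, so \<open>wg = a e\<^sub>1\<close> for some \<open>e\<^sub>1\<close> killed by \<open>K\<close>. Subtracting \<open>\<delta>(e\<^sub>1)\<close> from
  \<open>x\<close> leaves an element killed by \<open>K + (a)\<close>.\<close>

lemma annihilated_lift:
  assumes M: "module R M" "module R N" and d: "\<delta> \<in> mod_hom R M N" and D: "\<delta> ` carrier M = D"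
    and lM: "lifts M (carrier M)" and lN: "lifts N D" and f0: "fin {\<zero>}" and nz: "\<one> \<noteq> \<zero>"
  shows "colength K l \<Longrightarrow> x \<in> D \<Longrightarrow> (\<And>k. k \<in> K \<Longrightarrow> k \<odot>\<^bsub>N\<^esub> x = \<zero>\<^bsub>N\<^esub>) \<Longrightarrow>
    \<exists>e\<in>carrier M. (\<forall>k\<in>K. k \<odot>\<^bsub>M\<^esub> e = \<zero>\<^bsub>M\<^esub>) \<and> \<delta> e = x"
proof -
  interpret M: module R M by (rule M)
  interpret N: module R N by (rule M)
  have d0: "\<delta> \<zero>\<^bsub>M\<^esub> = \<zero>\<^bsub>N\<^esub>"
    using mod_homD(3)[OF d, of \<zero> "\<zero>\<^bsub>M\<^esub>"] mod_homD(1)[OF d, of "\<zero>\<^bsub>M\<^esub>"] by simp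
  show "colength K l \<Longrightarrow> x \<in> D \<Longrightarrow> (\<And>k. k \<in> K \<Longrightarrow> k \<odot>\<^bsub>N\<^esub> x = \<zero>\<^bsub>N\<^esub>) \<Longrightarrow>
    \<exists>e\<in>carrier M. (\<forall>k\<in>K. k \<odot>\<^bsub>M\<^esub> e = \<zero>\<^bsub>M\<^esub>) \<and> \<delta> e = x"
  proof (induction arbitrary: x rule: colength.induct)
    case top
    have "x \<in> carrier N" using top(1) D mod_homD(1)[OF d] by auto
    then have "x = \<zero>\<^bsub>N\<^esub>" using top(2)[of \<one>] by simp
    then show ?case using d0 by (intro bexI[of _ "\<zero>\<^bsub>M\<^esub>"]) auto
  next
    case (step K a l)
    note K = step.hyps(1) and a = step.hyps(2)
    obtain w where w: "w \<in> carrier R" "w \<noteq> \<zero>" "\<And>r. r \<in> \<nn> \<Longrightarrow> r \<otimes> w = \<zero>"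
      using socle_between[OF f0 oneideal] nz by (metis empty_subsetI insert_subset one_closed psubsetI singletonD singletonI zero_closed)
    have cw: "colon {\<zero>} {w} = \<nn>" using n_colon[OF zeroideal w(1)] w(2,3) by simp
    have ca: "colon K {a} = \<nn>" using n_colon[OF step.hyps(1-4)] .
    obtain x0 where x0: "x0 \<in> carrier M" "x = \<delta> x0" using step.prems(1) D by auto
    have xN: "x \<in> carrier N" using x0 mod_homD(1)[OF d] by simp
    have "a \<odot>\<^bsub>N\<^esub> x = \<delta> (a \<odot>\<^bsub>M\<^esub> x0)" using mod_homD(3)[OF d a x0(1)] x0(2) by simp
    then have axD: "a \<odot>\<^bsub>N\<^esub> x \<in> D" using D x0(1) a by auto
    have nax: "r \<odot>\<^bsub>N\<^esub> (a \<odot>\<^bsub>N\<^esub> x) = \<zero>\<^bsub>N\<^esub>" if r: "r \<in> \<nn>" for r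
      using step.prems(2)[OF step.hyps(4)[OF r]] N.smult_assoc1[OF n_carr[OF r] a xN] by simp
    obtain g' where g': "g' \<in> D" "w \<odot>\<^bsub>N\<^esub> g' = a \<odot>\<^bsub>N\<^esub> x"
      using liftsD[OF lN zeroideal w(1) axD] nax cw by metis
    obtain g where g: "g \<in> carrier M" "\<delta> g = g'" using g'(1) D by auto
    have wg: "w \<odot>\<^bsub>M\<^esub> g \<in> carrier M" using w(1) g(1) by simp
    have dwg: "\<delta> (w \<odot>\<^bsub>M\<^esub> g) = a \<odot>\<^bsub>N\<^esub> x" using mod_homD(3)[OF d w(1) g(1)] g g' by simp
    have nwg: "r \<odot>\<^bsub>M\<^esub> (w \<odot>\<^bsub>M\<^esub> g) = \<zero>\<^bsub>M\<^esub>" if r: "r \<in> \<nn>" for r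
      using M.smult_assoc1[OF n_carr[OF r] w(1) g(1)] w(3)[OF r] g(1) by simp
    obtain e1 where e1: "e1 \<in> carrier M" "\<And>k. k \<in> K \<Longrightarrow> k \<odot>\<^bsub>M\<^esub> e1 = \<zero>\<^bsub>M\<^esub>" "a \<odot>\<^bsub>M\<^esub> e1 = w \<odot>\<^bsub>M\<^esub> g"
      using liftsD[OF lM K a wg] nwg ca by metis
    let ?x = "x \<ominus>\<^bsub>N\<^esub> \<delta> e1"
    have de1: "\<delta> e1 \<in> carrier N" using mod_homD(1)[OF d e1(1)] .
    have "?x = \<delta> (x0 \<ominus>\<^bsub>M\<^esub> e1)" using mod_hom_minus[OF d M x0(1) e1(1)] x0(2) by simp
    then have xD: "?x \<in> D" using D x0(1) e1(1) by auto
    have act: "s \<odot>\<^bsub>N\<^esub> ?x = s \<odot>\<^bsub>N\<^esub> x \<ominus>\<^bsub>N\<^esub> \<delta> (s \<odot>\<^bsub>M\<^esub> e1)" if s: "s \<in> carrier R" for s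
      using mod_homD(3)[OF d s e1(1)] s xN de1 by (simp add: N.minus_eq N.smult_r_distr N.smult_r_minus)
    have kx: "k \<odot>\<^bsub>N\<^esub> ?x = \<zero>\<^bsub>N\<^esub>" if k: "k \<in> K" for k
      using act[OF ideal_carr[OF K k]] step.prems(2)[OF k] e1(2)[OF k] d0 by (simp add: N.minus_eq)
    have "a \<odot>\<^bsub>N\<^esub> ?x = \<zero>\<^bsub>N\<^esub>" using act[OF a] e1(3) dwg a xN by (simp add: N.minus_eq N.r_neg)
    have "b \<odot>\<^bsub>N\<^esub> ?x = \<zero>\<^bsub>N\<^esub>" if "b \<in> adj K a" for b
    proof -
      obtain k r where k: "b = k \<oplus> r \<otimes> a" "k \<in> K" "r \<in> carrier R" using \<open>b \<in> adj K a\<close> by (auto simp: adj_def)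
      have c: "k \<in> carrier R" "?x \<in> carrier N" using ideal_carr[OF K k(2)] xN de1 by auto
      show ?thesis unfolding k(1) using c k(3) a kx[OF k(2)] \<open>a \<odot>\<^bsub>N\<^esub> ?x = \<zero>\<^bsub>N\<^esub>\<close>
        by (simp add: N.smult_l_distr N.smult_assoc1)
    qed
    then obtain e2 where e2: "e2 \<in> carrier M" "\<forall>k\<in>adj K a. k \<odot>\<^bsub>M\<^esub> e2 = \<zero>\<^bsub>M\<^esub>" "\<delta> e2 = ?x"
      using step.IH[OF xD] by blast
    have "\<delta> (e1 \<oplus>\<^bsub>M\<^esub> e2) = x"
      using mod_homD(2)[OF d e1(1) e2(1)] e2(3) xN de1 by (simp add: N.minus_eq N.a_ac N.r_neg)
    moreover have "k \<odot>\<^bsub>M\<^esub> (e1 \<oplus>\<^bsub>M\<^esub> e2) = \<zero>\<^bsub>M\<^esub>" if k: "k \<in> K" for k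
    proof -
      have "k \<in> adj K a" using adj_sub[OF K a] k by blast
      then show ?thesis using e1(1) e1(2)[OF k] e2(1,2) ideal_carr[OF K k] by (simp add: M.smult_r_distr)
    qed
    ultimately show ?case using e1(1) e2(1) by blast
  qed
qed

text \<open>Dimension shifting: if \<open>M\<close> and the image \<open>D\<close> are injective, so is the kernel. A lift \<open>e\<close> of \<open>b\<close>
  in \<open>M\<close> is corrected by a preimage of \<open>\<delta>(e)\<close> that is killed by \<open>J + (a)\<close>.\<close>

lemma kernel_lifts:
  assumes M: "module R M" "module R N" and d: "\<delta> \<in> mod_hom R M N" and D: "\<delta> ` carrier M = D"
    and lM: "lifts M (carrier M)" and lN: "lifts N D" and f0: "fin {\<zero>}" and nz: "\<one> \<noteq> \<zero>"
  shows "lifts M (mod_ker M N \<delta>)"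
  unfolding lifts_def
proof (intro allI impI)
  interpret M: module R M by (rule M)
  interpret N: module R N by (rule M)
  fix J a b assume J: "ideal J R" and a: "a \<in> carrier R" and b: "b \<in> mod_ker M N \<delta>"
    and kill: "\<forall>r\<in>colon J {a}. r \<odot>\<^bsub>M\<^esub> b = \<zero>\<^bsub>M\<^esub>"
  have bM: "b \<in> carrier M" "\<delta> b = \<zero>\<^bsub>N\<^esub>" using b by (auto simp: mod_ker_def)
  have d0: "\<delta> \<zero>\<^bsub>M\<^esub> = \<zero>\<^bsub>N\<^esub>"
    using mod_homD(3)[OF d, of \<zero> "\<zero>\<^bsub>M\<^esub>"] mod_homD(1)[OF d, of "\<zero>\<^bsub>M\<^esub>"] by simp
  obtain e where e: "e \<in> carrier M" "\<And>j. j \<in> J \<Longrightarrow> j \<odot>\<^bsub>M\<^esub> e = \<zero>\<^bsub>M\<^esub>" "a \<odot>\<^bsub>M\<^esub> e = b"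
    using liftsD[OF lM J a bM(1)] kill by metis
  have de: "\<delta> e \<in> carrier N" "\<delta> e \<in> D" using mod_homD(1)[OF d e(1)] D e(1) by auto
  have je: "j \<odot>\<^bsub>N\<^esub> \<delta> e = \<zero>\<^bsub>N\<^esub>" if j: "j \<in> J" for j
    using mod_homD(3)[OF d ideal_carr[OF J j] e(1)] e(2)[OF j] d0 by simp
  have ae: "a \<odot>\<^bsub>N\<^esub> \<delta> e = \<zero>\<^bsub>N\<^esub>" using mod_homD(3)[OF d a e(1)] e(3) bM by simp
  have "k \<odot>\<^bsub>N\<^esub> \<delta> e = \<zero>\<^bsub>N\<^esub>" if "k \<in> adj J a" for k
  proof -
    obtain j r where k: "k = j \<oplus> r \<otimes> a" "j \<in> J" "r \<in> carrier R" using \<open>k \<in> adj J a\<close> by (auto simp: adj_def)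
    show ?thesis unfolding k(1) using ideal_carr[OF J k(2)] k(3) a je[OF k(2)] ae de
      by (simp add: N.smult_l_distr N.smult_assoc1)
  qed
  moreover have "fin (adj J a)"
    using fin_mono[OF f0 adj_ideal[OF J a]] ideal_zero[OF adj_ideal[OF J a]] by simp
  then have "colength (adj J a) (len (adj J a))" using fin_len by blast
  ultimately obtain e2 where e2: "e2 \<in> carrier M" "\<forall>k\<in>adj J a. k \<odot>\<^bsub>M\<^esub> e2 = \<zero>\<^bsub>M\<^esub>" "\<delta> e2 = \<delta> e"
    using annihilated_lift[OF M d D lM lN f0 nz _ de(2)] by blast
  have act: "s \<odot>\<^bsub>M\<^esub> (e \<ominus>\<^bsub>M\<^esub> e2) = s \<odot>\<^bsub>M\<^esub> e \<ominus>\<^bsub>M\<^esub> s \<odot>\<^bsub>M\<^esub> e2" if "s \<in> carrier R" for s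
    using that e(1) e2(1) by (simp add: M.minus_eq M.smult_r_distr M.smult_r_minus)
  have "e \<ominus>\<^bsub>M\<^esub> e2 \<in> mod_ker M N \<delta>"
    using mod_hom_minus[OF d M e(1) e2(1)] e(1) e2 de by (simp add: mod_ker_def N.minus_eq N.r_neg)
  moreover have "a \<odot>\<^bsub>M\<^esub> (e \<ominus>\<^bsub>M\<^esub> e2) = b"
    using act[OF a] e(3) e2(2) adj_gen[OF J a] bM(1) by (simp add: M.minus_eq)
  moreover have "j \<odot>\<^bsub>M\<^esub> (e \<ominus>\<^bsub>M\<^esub> e2) = \<zero>\<^bsub>M\<^esub>" if j: "j \<in> J" for j
  proof -
    have "j \<in> adj J a" using adj_sub[OF J a] j by blast
    then show ?thesis using act[OF ideal_carr[OF J j]] e(2)[OF j] e2(2) by (simp add: M.minus_eq)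
  qed
  ultimately show "\<exists>e\<in>mod_ker M N \<delta>. (\<forall>j\<in>J. j \<odot>\<^bsub>M\<^esub> e = \<zero>\<^bsub>M\<^esub>) \<and> a \<odot>\<^bsub>M\<^esub> e = b" by blast
qed

text \<open>Starting at the zero module at the end of the resolution, \<open>kernel_lifts\<close> moves injectivity down
  through the syzygies to \<open>R\<close>. In \<open>R\<close>, an element \<open>b\<close> that is killed by the annihilator of \<open>a\<close> is
  then a multiple of \<open>a\<close>.\<close>

theorem finite_injective_dim_self_injective:
  assumes fid: "finite_injective_dim R (self_module R)" and f0: "fin {\<zero>}" and nz: "\<one> \<noteq> \<zero>"
    and a: "a \<in> carrier R" and b: "b \<in> carrier R" and ab: "\<And>r. r \<in> carrier R \<Longrightarrow> r \<otimes> a = \<zero> \<Longrightarrow> r \<otimes> b = \<zero>"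
  shows "\<exists>s\<in>carrier R. b = s \<otimes> a"
proof -
  obtain E \<epsilon> \<delta> n where res: "injective_resolution R (self_module R) E \<epsilon> \<delta>"
    and n: "\<And>i. i > n \<Longrightarrow> carrier (E i) = {\<zero>\<^bsub>E i\<^esub>}"
    using fid unfolding finite_injective_dim_def by blast
  have inj: "injective_module R (E i)" and d: "\<delta> i \<in> mod_hom R (E i) (E (Suc i))"
    and ex: "\<delta> i ` carrier (E i) = mod_ker (E (Suc i)) (E (Suc (Suc i))) (\<delta> (Suc i))" for i
    using res by (auto simp: injective_resolution_def)
  have eh: "\<epsilon> \<in> mod_hom R (self_module R) (E 0)" and einj: "inj_on \<epsilon> (carrier (self_module R))"
    and e0: "\<epsilon> ` carrier (self_module R) = mod_ker (E 0) (E (Suc 0)) (\<delta> 0)"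
    using res by (auto simp: injective_resolution_def)
  have mod: "module R (E i)" for i using inj by (simp add: injective_module_def)
  let ?D = "\<lambda>i. mod_ker (E i) (E (Suc i)) (\<delta> i)"
  have step: "lifts (E i) (?D i)" if "lifts (E (Suc i)) (?D (Suc i))" for i
    using kernel_lifts[OF mod mod d ex injective_lifts[OF inj] that f0 nz] .
  have base: "lifts (E (Suc n)) (?D (Suc n))"
  proof -
    interpret M: module R "E (Suc n)" by (rule mod)
    have "?D (Suc n) \<subseteq> {\<zero>\<^bsub>E (Suc n)\<^esub>}" using n[of "Suc n"] by (auto simp: mod_ker_def)
    then have D0: "b = \<zero>\<^bsub>E (Suc n)\<^esub>" if "b \<in> ?D (Suc n)" for b using that by auto
    show ?thesis unfolding lifts_def
    proof (intro allI impI)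
      fix J a b assume J: "ideal J R" "a \<in> carrier R" "b \<in> ?D (Suc n)"
      have "r \<odot>\<^bsub>E (Suc n)\<^esub> b = \<zero>\<^bsub>E (Suc n)\<^esub>" if "r \<in> carrier R" for r using D0[OF J(3)] that by simp
      then show "\<exists>e\<in>?D (Suc n). (\<forall>j\<in>J. j \<odot>\<^bsub>E (Suc n)\<^esub> e = \<zero>\<^bsub>E (Suc n)\<^esub>) \<and> a \<odot>\<^bsub>E (Suc n)\<^esub> e = b"
        using J(2,3) D0[OF J(3)] ideal_carr[OF J(1)] by (intro bexI[of _ b]) auto
    qed
  qed
  have "lifts (E (Suc n - i)) (?D (Suc n - i))" if "i \<le> Suc n" for i
    using that
  proof (induction i)
    case (Suc i)
    then have "Suc n - i = Suc (Suc n - Suc i)" by simp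
    then show ?case using step Suc by simp
  qed (use base in simp)
  from this[of "Suc n"] have l0: "lifts (E 0) (?D 0)" by simp
  have sm: "carrier (self_module R) = carrier R" "r \<odot>\<^bsub>self_module R\<^esub> s = r \<otimes> s" "\<zero>\<^bsub>self_module R\<^esub> = \<zero>" for r s
    by (simp_all add: self_module_def)
  interpret M: module R "E 0" by (rule mod)
  have ez: "\<epsilon> \<zero> = \<zero>\<^bsub>E 0\<^esub>"
    using mod_homD(3)[OF eh, of \<zero> \<zero>] mod_homD(1)[OF eh, of \<zero>] by (simp add: sm)
  have eb: "\<epsilon> b \<in> ?D 0" using e0 b by (auto simp: sm)
  have "r \<odot>\<^bsub>E 0\<^esub> \<epsilon> b = \<zero>\<^bsub>E 0\<^esub>" if "r \<in> colon {\<zero>} {a}" for r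
  proof -
    have r: "r \<in> carrier R" "r \<otimes> a = \<zero>" using that by (auto simp: colon_mem1)
    show ?thesis using mod_homD(3)[OF eh r(1), of b] ab[OF r] b ez by (simp add: sm)
  qed
  then obtain x where x: "x \<in> ?D 0" "a \<odot>\<^bsub>E 0\<^esub> x = \<epsilon> b" using liftsD[OF l0 zeroideal a eb] by metis
  obtain s where s: "s \<in> carrier R" "x = \<epsilon> s" using x(1) e0 by (auto simp: sm)
  have "\<epsilon> (a \<otimes> s) = \<epsilon> b" using mod_homD(3)[OF eh a, of s] s x(2) by (simp add: sm)
  then have "a \<otimes> s = b" using einj a b s(1) by (simp add: inj_on_def sm)
  then show ?thesis using s(1) m_comm[OF a s(1)] by metis
qed

end

section \<open>Number of generators and order\<close>

lemma noetherian_local_ring_imp_noeth_local: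
  assumes "noetherian_local_ring R \<nn>" shows "noeth_local R \<nn>"
proof -
  have "cring R" "maximalideal \<nn> R" "\<And>J. maximalideal J R \<Longrightarrow> J = \<nn>" "noetherian_ring R"
    using assms by (auto simp: noetherian_local_ring_def local_ring_def)
  then show ?thesis
    by (intro noeth_local.intro noeth_local_axioms.intro max_ring.intro max_ring_axioms.intro)
qed

context noeth_local
begin

text \<open>The length of \<open>I/K\<close> is the number of steps that lead from \<open>K\<close> up to \<open>I\<close>, and each step adds one
  generator.\<close>

lemma few_generators:
  assumes I: "ideal I R"
  shows "fin K \<Longrightarrow> K \<subseteq> I \<Longrightarrow> (\<And>r i. r \<in> \<nn> \<Longrightarrow> i \<in> I \<Longrightarrow> r \<otimes> i \<in> K) \<Longrightarrow>
    \<exists>G\<subseteq>I. finite G \<and> card G \<le> len K - len I \<and> (\<forall>N. ideal N R \<longrightarrow> K \<subseteq> N \<longrightarrow> G \<subseteq> N \<longrightarrow> I \<subseteq> N)"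
proof (induction "len K" arbitrary: K rule: less_induct)
  case less
  show ?case
  proof (cases "K = I")
    case True
    then show ?thesis by (intro exI[of _ "{}"]) simp
  next
    case False
    then obtain b where b: "b \<in> I" "b \<notin> K" using less.prems(2) by blast
    have bc: "b \<in> carrier R" using ideal_carr[OF I b(1)] .
    have Ki: "ideal K R" using less.prems(1) fin_ideal by simp
    let ?L = "adj K b"
    have L: "len K = Suc (len ?L)" using len_adj_simple(2)[OF less.prems(1) bc less.prems(3)[OF _ b(1)] b(2)] .
    have fL: "fin ?L" using fin_adj[OF less.prems(1) bc] .
    have LI: "?L \<subseteq> I" using adj_least[OF I less.prems(2) b(1)] .
    have nL: "r \<otimes> i \<in> ?L" if "r \<in> \<nn>" "i \<in> I" for r i
      using less.prems(3)[OF that] adj_sub[OF Ki bc] by blast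
    have "len I \<le> len ?L" using len_anti[OF fL I LI] .
    obtain G where G: "G \<subseteq> I" "finite G" "card G \<le> len ?L - len I"
      "\<And>N. ideal N R \<Longrightarrow> ?L \<subseteq> N \<Longrightarrow> G \<subseteq> N \<Longrightarrow> I \<subseteq> N"
      using less.hyps[OF _ fL LI nL] L by auto
    have "card (insert b G) \<le> len K - len I"
      using card_insert_le_m1[of "len K - len I" G b] G(3) L \<open>len I \<le> len ?L\<close> by simp
    moreover have "I \<subseteq> N" if "ideal N R" "K \<subseteq> N" "insert b G \<subseteq> N" for N
      using G(4)[OF that(1) adj_least[OF that(1,2)]] that(3) by simp
    ultimately show ?thesis using G(1,2) b(1) by (intro exI[of _ "insert b G"]) simp
  qed
qed

text \<open>\<open>K\<close> is \<open>\<nn>I\<close>, and generators of \<open>I\<close> modulo \<open>\<nn>I\<close> are generators by Nakayama's lemma.\<close>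

lemma min_gens_le:
  assumes I: "ideal I R" and K: "fin K" "K \<subseteq> I" and nI: "\<And>r i. r \<in> \<nn> \<Longrightarrow> i \<in> I \<Longrightarrow> r \<otimes> i \<in> K"
    and least: "\<And>N. ideal N R \<Longrightarrow> (\<And>r i. r \<in> \<nn> \<Longrightarrow> i \<in> I \<Longrightarrow> r \<otimes> i \<in> N) \<Longrightarrow> K \<subseteq> N"
  shows "min_gens R I \<le> len K - len I"
proof -
  obtain G where G: "G \<subseteq> I" "finite G" "card G \<le> len K - len I"
    "\<And>N. ideal N R \<Longrightarrow> K \<subseteq> N \<Longrightarrow> G \<subseteq> N \<Longrightarrow> I \<subseteq> N"
    using few_generators[OF I K nI] by auto
  have Gc: "G \<subseteq> carrier R" using G(1) ideal_sub[OF I] by blast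
  have "I \<subseteq> Idl G"
  proof (rule nakayama[OF genideal_ideal[OF Gc] I])
    fix N assume N: "ideal N R" "Idl G \<subseteq> N" "\<And>r h. r \<in> \<nn> \<Longrightarrow> h \<in> I \<Longrightarrow> r \<otimes> h \<in> N"
    have "K \<subseteq> N" using least[OF N(1,3)] .
    then show "I \<subseteq> N" using G(4)[OF N(1)] genideal_self[OF Gc] N(2) by blast
  qed
  then have "I = Idl G" using genideal_minimal[OF I G(1)] by blast
  then have "min_gens R I \<le> card G" unfolding min_gens_def using G(2) Gc by (intro Least_le) blast
  then show ?thesis using G(3) by simp
qed

text \<open>Two socle elements of the artinian ring \<open>R/I\<close> have the same annihilator, unless one of them is
  zero. By self-injectivity, each of them is a multiple of the other.\<close>

lemma gorenstein_simple_socle: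
  assumes I: "fin I" and proper: "I \<noteq> carrier R" and gor: "gorenstein_local_ring (R Quot I)"
  shows "\<exists>\<omega>. simple_socle I \<omega>"
proof -
  have Ii: "ideal I R" using I fin_ideal by simp
  interpret I: ideal I R by (rule Ii)
  let ?A = "R Quot I"
  have zA: "\<zero>\<^bsub>?A\<^esub> = I" unfolding FactRing_def by simp
  have rep: "\<exists>s\<in>carrier R. r = I +> s" if "r \<in> carrier ?A" for r
    using that unfolding FactRing_def A_RCOSETS_def' by auto
  have z: "I +> s = \<zero>\<^bsub>?A\<^esub> \<longleftrightarrow> s \<in> I" if "s \<in> carrier R" for s
    unfolding zA using I.rcos_const_imp_mem[OF that] a_rcos_zero[OF Ii] by blast
  obtain \<mm> where m: "noetherian_local_ring ?A \<mm>" and fid: "finite_injective_dim ?A (self_module ?A)"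
    using gor by (auto simp: gorenstein_local_ring_def)
  interpret A: noeth_local ?A \<mm>
    by (rule noetherian_local_ring_imp_noeth_local[OF m])
  interpret h: ring_hom_cring R ?A "(+>) I" by (rule I.rcos_ring_hom_cring[OF is_cring])
  have fA: "A.fin {\<zero>\<^bsub>?A\<^esub>}"
  proof (rule A.fin_if_primes[OF A.zeroideal])
    have main: "Q = (\<lambda>s. I +> s) ` \<nn>" if Q: "primeideal Q ?A" for Q
    proof
      have Qi: "ideal Q ?A" using A.prime_ideal[OF Q] .
      show n: "(\<lambda>s. I +> s) ` \<nn> \<subseteq> Q"
      proof
        fix r assume "r \<in> (\<lambda>s. I +> s) ` \<nn>"
        then obtain s where s: "r = I +> s" "s \<in> \<nn>" by auto
        have sc: "s \<in> carrier R" using n_carr s(2) by simp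
        have "s [^] len I \<in> I" using fin_power[OF I s(2)] .
        then have "(I +> s) [^]\<^bsub>?A\<^esub> len I = \<zero>\<^bsub>?A\<^esub>" using z[of "s [^] len I"] h.hom_pow[OF sc] sc by simp
        then show "r \<in> Q" unfolding s(1)
          using A.prime_pow[OF Q h.hom_closed[OF sc], of "len I"] A.ideal_zero[OF Qi] by simp
      qed
      show "Q \<subseteq> (\<lambda>s. I +> s) ` \<nn>"
      proof
        fix r assume r: "r \<in> Q"
        obtain s where s: "s \<in> carrier R" "r = I +> s" using rep A.ideal_carr[OF Qi r] by blast
        have "s \<in> \<nn>"
        proof (rule ccontr)
          assume "s \<notin> \<nn>"
          then obtain u v where uv: "u \<in> carrier R" "v \<in> \<nn>" "\<one> = v \<oplus> u \<otimes> s" using n_unit s(1) by metis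
          have vc: "v \<in> carrier R" using n_carr uv(2) by simp
          have "I +> \<one> = (I +> v) \<oplus>\<^bsub>?A\<^esub> (I +> u) \<otimes>\<^bsub>?A\<^esub> (I +> s)"
            using arg_cong[OF uv(3), of "\<lambda>w. I +> w"] uv(1) vc s(1) by simp
          also have "\<dots> \<in> Q"
            using A.ideal_add[OF Qi _ A.ideal_l[OF Qi]] n uv(1,2) r s by auto
          finally show False using A.prime_one[OF Q] by simp
        qed
        then show "r \<in> (\<lambda>s. I +> s) ` \<nn>" using s(2) by blast
      qed
    qed
    fix Q assume "primeideal Q ?A"
    moreover have "primeideal \<mm> ?A" using A.maximalideal_prime[OF A.max] .
    ultimately show "Q = \<mm>" using main by blast
  qed
  have I1: "\<one> \<notin> I" using proper proper_iff[OF Ii] by simp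
  then have nz: "\<one>\<^bsub>?A\<^esub> \<noteq> \<zero>\<^bsub>?A\<^esub>" using z[OF one_closed] by simp
  obtain \<omega> where w: "\<omega> \<in> carrier R" "\<omega> \<notin> I" "\<And>r. r \<in> \<nn> \<Longrightarrow> r \<otimes> \<omega> \<in> I"
    using socle_between[OF I oneideal] ideal_sub[OF Ii] proper by (metis psubsetI)
  have "t \<in> adj I \<omega>" if t: "t \<in> carrier R" "\<forall>r\<in>\<nn>. r \<otimes> t \<in> I" for t
  proof -
    have "\<exists>s\<in>carrier ?A. I +> t = s \<otimes>\<^bsub>?A\<^esub> (I +> \<omega>)"
    proof (rule A.finite_injective_dim_self_injective[OF fid fA nz])
      fix r assume r: "r \<in> carrier ?A" "r \<otimes>\<^bsub>?A\<^esub> (I +> \<omega>) = \<zero>\<^bsub>?A\<^esub>"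
      obtain s where s: "s \<in> carrier R" "r = I +> s" using rep[OF r(1)] by blast
      have "s \<otimes> \<omega> \<in> I" using r(2) z[of "s \<otimes> \<omega>"] s w(1) by simp
      then have "s \<in> colon I {\<omega>}" using s(1) by (simp add: colon_mem1)
      then have "s \<in> \<nn>" using n_colon[OF Ii w] by simp
      then have "s \<otimes> t \<in> I" using t(2) by blast
      then show "r \<otimes>\<^bsub>?A\<^esub> (I +> t) = \<zero>\<^bsub>?A\<^esub>" using z[of "s \<otimes> t"] s t(1) by simp
    qed (use w(1) t(1) in auto)
    then obtain s where s: "s \<in> carrier R" "I +> t = (I +> s) \<otimes>\<^bsub>?A\<^esub> (I +> \<omega>)" using rep by blast
    then have "I +> t = I +> (s \<otimes> \<omega>)" using w(1) by simp
    then have "t \<ominus> s \<otimes> \<omega> \<in> I" using quotient_eq_iff_same_a_r_cos[OF Ii t(1), of "s \<otimes> \<omega>"] s(1) w(1) by simp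
    moreover have "t = (t \<ominus> s \<otimes> \<omega>) \<oplus> s \<otimes> \<omega>" using t(1) s(1) w(1) by algebra
    ultimately show ?thesis using adj_mem[OF _ s(1)] by metis
  qed
  then show ?thesis using w unfolding simple_socle_def by blast
qed

end

context height_three
begin

text \<open>Each factor of a composition series of \<open>R/K\<close> is killed by \<open>\<nn>\<close>.\<close>

lemma colength_pw: "colength K l \<Longrightarrow> pw x y z l \<subseteq> K"
proof (induction rule: colength.induct)
  case (step K a l)
  have g: "g \<otimes> u \<in> K" if g: "g \<in> \<nn>" and u: "u \<in> pw x y z l" for g u
  proof -
    obtain k r where k: "u = k \<oplus> r \<otimes> a" "k \<in> K" "r \<in> carrier R" using step.IH u by (blast elim: adjE)
    have "g \<otimes> u = g \<otimes> k \<oplus> r \<otimes> (g \<otimes> a)"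
      unfolding k(1) using n_carr[OF g] ideal_carr[OF step(1) k(2)] k(3) step(2) by algebra
    then show ?thesis
      using ideal_add[OF step(1) ideal_l[OF step(1) k(2) n_carr[OF g]] ideal_l[OF step(1) step(4)[OF g] k(3)]] by simp
  qed
  show ?case
  proof
    fix u assume "u \<in> pw x y z (Suc l)"
    then obtain a b c where "u = x \<otimes> a \<oplus> y \<otimes> b \<oplus> z \<otimes> c" "a \<in> pw x y z l" "b \<in> pw x y z l" "c \<in> pw x y z l"
      by (rule pwE)
    then show "u \<in> K" using ideal_add[OF step(1) ideal_add[OF step(1)]] g gens by simp
  qed
qed simp

lemma n_pw: "\<nn> \<subseteq> pw x y z (Suc 0)"
proof -
  have "adj (adj (adj {\<zero>} x) y) z \<subseteq> pw x y z (Suc 0)"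
    by (intro adj_least[OF pw_ideal])
       (use pw_pow[of "Suc 0"] ideal_zero[OF pw_ideal, of "Suc 0"] in \<open>simp_all del: pw.simps\<close>)
  then show ?thesis using generate by blast
qed

lemma pw_power: "pw x y z t \<subseteq> \<nn> [^]\<^bsub>ideals_set R\<^esub> t"
proof (induction t)
  case 0
  then show ?case by (simp add: nat_pow_def ideals_set_def)
next
  case (Suc t)
  let ?M = "\<nn> [^]\<^bsub>ideals_set R\<^esub> t"
  have M: "\<nn> [^]\<^bsub>ideals_set R\<^esub> Suc t = ideal_prod R ?M \<nn>" by (simp add: nat_pow_def ideals_set_def)
  show ?case unfolding M
  proof
    fix u assume "u \<in> pw x y z (Suc t)"
    then obtain a b c where u: "u = x \<otimes> a \<oplus> y \<otimes> b \<oplus> z \<otimes> c" "a \<in> pw x y z t" "b \<in> pw x y z t" "c \<in> pw x y z t"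
      by (rule pwE)
    then have "u = a \<otimes> x \<oplus> b \<otimes> y \<oplus> c \<otimes> z" using pw_carr m_comm by simp
    then show "u \<in> ideal_prod R ?M \<nn>"
      using u(2-4) Suc gens by (auto intro!: ideal_prod.intros)
  qed
qed

text \<open>With \<open>a = t + 1\<close> the order of \<open>I\<close>, the number of generators is at most \<open>2t + 3\<close>, and \<open>\<nn>\<^sup>2\<^sup>t\<close> is
  not contained in \<open>I\<close>.\<close>

theorem power_not_contained:
  assumes I: "fin I" "I \<noteq> carrier R" and s: "simple_socle I \<omega>" and d: "d = min_gens R I - 3"
  shows "\<not> \<nn> [^]\<^bsub>ideals_set R\<^esub> d \<subseteq> I"
proof
  assume dI: "\<nn> [^]\<^bsub>ideals_set R\<^esub> d \<subseteq> I"
  have Ii: "ideal I R" using I fin_ideal by simp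
  have N: "pw x y z (len I) \<subseteq> I" using colength_pw I(1) fin_len by blast
  \<comment> \<open>The order of \<open>I\<close> exists: \<open>I\<close> contains a power of \<open>\<nn>\<close>, and no power of \<open>\<nn>\<close> lies in the next one.\<close>
  have "\<exists>a. I \<subseteq> pw x y z a \<and> \<not> I \<subseteq> pw x y z (Suc a)"
  proof (rule ccontr)
    assume "\<not> ?thesis"
    then have st: "I \<subseteq> pw x y z a \<Longrightarrow> I \<subseteq> pw x y z (Suc a)" for a by blast
    have "I \<subseteq> pw x y z a" for a
    proof (induction a)
      case 0 show ?case using ideal_sub[OF Ii] by simp
    qed (rule st)
    then have "pw x y z (len I) \<subseteq> pw x y z (Suc (len I))" using N by blast
    then show False using pw_not_sub[of "len I"] adj_sub[OF pw_ideal zc] by blast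
  qed
  then obtain a where a: "I \<subseteq> pw x y z a" "\<not> I \<subseteq> pw x y z (Suc a)" by blast
  have "a \<noteq> 0" using a(2) subset_trans[OF fin_sub_n[OF I] n_pw] by metis
  then obtain t where t: "a = Suc t" by (cases a) auto
  let ?D = "{x \<otimes> u \<oplus> y \<otimes> v \<oplus> z \<otimes> w | u v w. u \<in> I \<and> v \<in> I \<and> w \<in> I}"
  have Di: "ideal ?D R" using step_ideal[OF Ii] .
  have "pw x y z (Suc (len I)) \<subseteq> ?D" using N by auto
  then have fD: "fin ?D" using fin_mono[OF pw_fin Di] by blast
  have DN: "?D \<subseteq> K" if K: "ideal K R" "\<And>r i. r \<in> \<nn> \<Longrightarrow> i \<in> I \<Longrightarrow> r \<otimes> i \<in> K" for K
    using step_least[OF K(1)] K(2) gens by simp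
  have DI: "?D \<subseteq> I" using DN[OF Ii] ideal_l[OF Ii] n_carr by blast
  have nI: "r \<otimes> i \<in> ?D" if r: "r \<in> \<nn>" and i: "i \<in> I" for r i
    using step_mem[OF Ii _ i] r n_pw by blast
  interpret U: generic_form R "UP R" \<nn> x y z
    by (intro generic_form.intro generic_form_axioms.intro UP_cring.intro is_cring max_ring_axioms
        three_gens_axioms gens n_pw)
  obtain f where f: "f \<in> I" "f \<in> pw x y z a" "f \<notin> pw x y z (Suc a)" using a by blast
  have "len ?D \<le> len I + (2 * a + 1)" using U.generators_bound[OF Ii s f fD] .
  moreover have "min_gens R I \<le> len ?D - len I" using min_gens_le[OF Ii fD DI nI DN] by blast
  ultimately have "d \<le> 2 * t" using d t by simp
  then have "pw x y z (2 * t) \<subseteq> I" using pw_anti[of d "2 * t"] pw_power[of d] dI by blast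
  then show False using socle_degree_bound[OF I(1) s] a(1) t by blast
qed

end

theorem theorem2p2:
  fixes S :: "('a, 'b) ring_scheme" and \<mm> I :: "'a set" and d :: nat
  assumes "regular_local_ring S \<mm>"
    and "krull_dim S = 3"
    and "contains_field S"
    and "primary_to S \<mm> I"
    and "gorenstein_local_ring (S Quot I)"
    and "d = min_gens S I - 3"
  shows "\<not> \<mm> [^]\<^bsub>ideals_set S\<^esub> d \<subseteq> I"
proof -
  interpret S: noeth_local S \<mm>
    by (rule noetherian_local_ring_imp_noeth_local) (use assms(1) in \<open>simp add: regular_local_ring_def\<close>)
  have "min_gens S \<mm> = 3"
    using assms(1,2) by (simp add: regular_local_ring_def numeral_eq_enat)
  moreover have "\<exists>n A. A \<subseteq> carrier S \<and> finite A \<and> card A = n \<and> \<mm> = Idl\<^bsub>S\<^esub> A"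
    using S.finetely_gen[OF S.n_ideal] by blast
  ultimately have "\<exists>A. A \<subseteq> carrier S \<and> finite A \<and> card A = 3 \<and> \<mm> = Idl\<^bsub>S\<^esub> A"
    using LeastI_ex[of "\<lambda>n. \<exists>A. A \<subseteq> carrier S \<and> finite A \<and> card A = n \<and> \<mm> = Idl\<^bsub>S\<^esub> A"]
    unfolding min_gens_def by simp
  then obtain A where A: "A \<subseteq> carrier S" "card A = 3" "\<mm> = Idl\<^bsub>S\<^esub> A" by blast
  obtain x y z where xyz: "A = {x, y, z}" using A(2) by (auto simp: card_3_iff)
  have c: "x \<in> carrier S" "y \<in> carrier S" "z \<in> carrier S" using A(1) xyz by auto
  have gens: "x \<in> \<mm>" "y \<in> \<mm>" "z \<in> \<mm>" using S.genideal_self[OF A(1)] A(3) xyz by auto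
  let ?J = "S.adj (S.adj (S.adj {\<zero>\<^bsub>S\<^esub>} x) y) z"
  have 1: "ideal (S.adj {\<zero>\<^bsub>S\<^esub>} x) S" using S.adj_ideal[OF S.zeroideal c(1)] .
  have 2: "ideal (S.adj (S.adj {\<zero>\<^bsub>S\<^esub>} x) y) S" using S.adj_ideal[OF 1 c(2)] .
  have "A \<subseteq> ?J" unfolding xyz
    using S.adj_gen[OF S.zeroideal c(1)] S.adj_sub[OF 1 c(2)] S.adj_gen[OF 1 c(2)] S.adj_sub[OF 2 c(3)] S.adj_gen[OF 2 c(3)]
    by blast
  then have generate: "\<mm> \<subseteq> ?J" unfolding A(3) using S.genideal_minimal[OF S.adj_ideal[OF 2 c(3)]] by blast
  have "enat 2 < krull_dim S" using assms(2) by (simp add: numeral_eq_enat)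
  then obtain n P where n: "enat 2 < enat n" and P: "\<And>i. i \<le> n \<Longrightarrow> primeideal (P i) S" "\<And>i. i < n \<Longrightarrow> P i \<subset> P (Suc i)"
    unfolding krull_dim_def less_Sup_iff by blast
  then have n3: "3 \<le> n" by simp
  have p: "primeideal (P 0) S" "primeideal (P 1) S" "primeideal (P 2) S" "primeideal (P 3) S" using P(1) n3 by auto
  have q: "P 0 \<subset> P 1" "P 1 \<subset> P 2" "P 2 \<subset> P 3" using P(2)[of 0] P(2)[of 1] P(2)[of 2] n3
    by (auto simp: numeral_2_eq_2 numeral_3_eq_3)
  have "P 2 \<noteq> \<mm>" using q(3) S.prime_sub_n[OF p(4)] by blast
  then interpret T: height_three S \<mm> x y z
    using S.krull_height_two[OF p(1-3) q(1,2)] gens generate c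
    by (intro height_three.intro height_three_axioms.intro three_gens.intro three_gens_axioms.intro
        S.noeth_local_axioms S.is_cring) auto
  have I: "ideal I S" "I \<noteq> carrier S" and rad: "radical S I = \<mm>"
    using assms(4) by (auto simp: primary_to_def primary_ideal_def)
  have "S.fin I"
  proof (rule S.fin_if_primes[OF I(1)])
    fix Q assume Q: "primeideal Q S" "I \<subseteq> Q"
    have "\<mm> \<subseteq> Q" using rad S.prime_pow[OF Q(1)] Q(2) unfolding radical_def by blast
    then show "Q = \<mm>" using S.prime_sub_n[OF Q(1)] by blast
  qed
  then show ?thesis
    using S.gorenstein_simple_socle[OF _ I(2) assms(5)] T.power_not_contained[OF _ I(2) _ assms(6)] by blast
qed

end
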